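(* There is a randomized algorithm (ApproxConvex) with the following guarantee. Given $q_0,q_1$ satisfying Assumption (A), a pair $(\xi,\zeta)$ such that $(q_0,q_1)$ is $(\xi,\zeta)$-regular, a number $\hat\gamma\geq 0$ with $\lambda_{\min}(A(\hat\gamma))\geq\xi$, an error parameter $0<\epsilon\leq\kappa^2\xi$ (where $\kappa=\zeta/\xi$), and a failure probability $p>0$, it outputs $\tilde\gamma_-,\tilde\gamma_+\in\mathbb{R}$ and $\tilde x\in\mathbb{R}^n$ such that, with probability at least $1-p$, $$\mathrm{Opt}\leq\max\{q(\tilde\gamma_-,\tilde x),q(\tilde\gamma_+,\tilde x)\}\leq\widetilde{\mathrm{Opt}}+\epsilon/2\leq\mathrm{Opt}+\epsilon,$$ where $\widetilde{\mathrm{Opt}}:=\min_{x\in\mathbb{R}^n}\max\{q(\tilde\gamma_-,x),q(\tilde\gamma_+,x)\}$. The algorithm runs in time $$\tilde O\left(\frac{N\kappa^{3/2}\sqrt{\zeta}}{\sqrt{\epsilon}}\log\left(\frac{n}{p}\right)\log\left(\frac{\kappa}{\epsilon}\right)\right).$$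
   Context: For symmetric $A_0,A_1\in\mathbb{R}^{n\times n}$, $b_0,b_1\in\mathbb{R}^n$, $c_0,c_1\in\mathbb{R}$, let $q_i(x)=x^\top A_ix+2b_i^\top x+c_i$ ($i=0,1$). For $\gamma\in\mathbb{R}$ let $A(\gamma)=A_0+\gamma A_1$ and $q(\gamma,x)=q_0(x)+\gamma q_1(x)$. $\mathrm{Opt}:=\min\{q_0(x): q_1(x)\leq 0\}$. Assumption (A): $A_0$ and $A_1$ each have a negative eigenvalue, there exists $\gamma^*\geq 0$ with $A(\gamma^* )\succ 0$, and $\|A_0\|,\|A_1\|,\|b_0\|,\|b_1\|,|c_1|\leq 1$ (spectral norm for matrices, Euclidean norm for vectors). Under (A), $\Gamma:=\{\gamma\geq0: A(\gamma)\succeq 0\}$ is a nonempty compact interval $[\gamma_-,\gamma_+]$. Regularity: $\xi^*:=\min\{1,\max_{\gamma\geq 0}\lambda_{\min}(A(\gamma))\}$, $\zeta^*:=\max\{1,\gamma_+\}$; $(q_0,q_1)$ is $(\xi,\zeta)$-regular if $0<\xi\leq\xi^*$ and $\zeta\geq\zeta^*$. $\lambda_{\min}$ is the smallest eigenvalue. $N$ is the number of nonzero entries of $A_0$ and $A_1$; $\tilde O$ hides $\log\log$ factors. *)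

theory Defs
  imports "HOL-Probability.Probability" "Jordan_Normal_Form.Char_Poly"
begin

section \<open>Quadratic functions and the generalized trust region subproblem\<close>

text \<open>The dimension varies inside the statement (one algorithm serves every dimension), so vectors
  and matrices are carrier-based.\<close>

definition minimum_on :: "('a \<Rightarrow> real) \<Rightarrow> 'a set \<Rightarrow> real" where
  "minimum_on f S = (LEAST v. v \<in> f ` S)"

definition attains_minimum_on :: "('a \<Rightarrow> real) \<Rightarrow> 'a set \<Rightarrow> bool" where
  "attains_minimum_on f S \<longleftrightarrow> (\<exists>x\<in>S. \<forall>y\<in>S. f x \<le> f y)"

definition maximum_on :: "('a \<Rightarrow> real) \<Rightarrow> 'a set \<Rightarrow> real" where
  "maximum_on f S = (GREATEST v. v \<in> f ` S)"

definition quad :: "real mat \<Rightarrow> real Matrix.vec \<Rightarrow> real \<Rightarrow> real Matrix.vec \<Rightarrow> real" where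
  "quad A b c x = scalar_prod x (A *\<^sub>v x) + 2 * scalar_prod b x + c"

definition pencil :: "real mat \<Rightarrow> real mat \<Rightarrow> real \<Rightarrow> real mat" where
  "pencil A0 A1 \<gamma> = A0 + \<gamma> \<cdot>\<^sub>m A1"

definition pos_def :: "real mat \<Rightarrow> bool" where
  "pos_def A \<longleftrightarrow> (\<forall>x \<in> carrier_vec (dim_row A). x \<noteq> 0\<^sub>v (dim_row A) \<longrightarrow> 0 < scalar_prod x (A *\<^sub>v x))"

definition pos_semidef :: "real mat \<Rightarrow> bool" where
  "pos_semidef A \<longleftrightarrow> (\<forall>x \<in> carrier_vec (dim_row A). 0 \<le> scalar_prod x (A *\<^sub>v x))"

definition lambda_min :: "real mat \<Rightarrow> real" where
  "lambda_min A = Min {k. eigenvalue A k}"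

definition vec_norm :: "real Matrix.vec \<Rightarrow> real" where
  "vec_norm x = sqrt (scalar_prod x x)"

definition spectral_norm :: "real mat \<Rightarrow> real" where
  "spectral_norm A = Sup {vec_norm (A *\<^sub>v x) |x. x \<in> carrier_vec (dim_col A) \<and> vec_norm x \<le> 1}"

definition quadratic_data ::
    "nat \<Rightarrow> real mat \<Rightarrow> real mat \<Rightarrow> real Matrix.vec \<Rightarrow> real Matrix.vec \<Rightarrow> bool" where
  "quadratic_data n A0 A1 b0 b1 \<longleftrightarrow>
     A0 \<in> carrier_mat n n \<and> A1 \<in> carrier_mat n n \<and>
     transpose_mat A0 = A0 \<and> transpose_mat A1 = A1 \<and>
     b0 \<in> carrier_vec n \<and> b1 \<in> carrier_vec n"

definition assumption_A ::
    "real mat \<Rightarrow> real mat \<Rightarrow> real Matrix.vec \<Rightarrow> real Matrix.vec \<Rightarrow> real \<Rightarrow> bool" where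
  "assumption_A A0 A1 b0 b1 c1 \<longleftrightarrow>
     (\<exists>k<0. eigenvalue A0 k) \<and> (\<exists>k<0. eigenvalue A1 k) \<and>
     (\<exists>\<gamma>\<ge>0. pos_def (pencil A0 A1 \<gamma>)) \<and>
     spectral_norm A0 \<le> 1 \<and> spectral_norm A1 \<le> 1 \<and>
     vec_norm b0 \<le> 1 \<and> vec_norm b1 \<le> 1 \<and> \<bar>c1\<bar> \<le> 1"

definition gamma_plus :: "real mat \<Rightarrow> real mat \<Rightarrow> real" where
  "gamma_plus A0 A1 = (GREATEST \<gamma>. 0 \<le> \<gamma> \<and> pos_semidef (pencil A0 A1 \<gamma>))"

definition xi_star :: "real mat \<Rightarrow> real mat \<Rightarrow> real" where
  "xi_star A0 A1 = min 1 (maximum_on (\<lambda>\<gamma>. lambda_min (pencil A0 A1 \<gamma>)) {0..})"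

definition zeta_star :: "real mat \<Rightarrow> real mat \<Rightarrow> real" where
  "zeta_star A0 A1 = max 1 (gamma_plus A0 A1)"

definition regular_pair :: "real mat \<Rightarrow> real mat \<Rightarrow> real \<Rightarrow> real \<Rightarrow> bool" where
  "regular_pair A0 A1 \<xi> \<zeta> \<longleftrightarrow> 0 < \<xi> \<and> \<xi> \<le> xi_star A0 A1 \<and> zeta_star A0 A1 \<le> \<zeta>"

definition nonzero_positions :: "real mat \<Rightarrow> (nat \<times> nat) set" where
  "nonzero_positions A = {(i, j). i < dim_row A \<and> j < dim_col A \<and> A $$ (i, j) \<noteq> 0}"

definition nnz :: "real mat \<Rightarrow> nat" where
  "nnz A = card (nonzero_positions A)"


section \<open>A randomized unit-cost real RAM\<close>

text \<open>Algorithms are finite programs, independent of the dimension and of the data.  The machine has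
  named registers and named arrays, each kind holding either natural numbers (counters, addresses) or
  exact reals.  Naturals support only addition, truncated subtraction and comparison.  Reals support
  field operations, square roots and comparison; the only literals are naturals, so programs cannot
  contain non-computable constants, and there is no rounding from reals to naturals.
  Division and square root are total as in HOL (division by 0 gives 0).\<close>

type_synonym vname = string

datatype nexp =
    NConst nat
  | NVar vname
  | NArr vname nexp
  | NAdd nexp nexp
  | NSub nexp nexp

datatype rexp =
    RNat nexp
  | RVar vname
  | RArr vname nexp
  | RAdd rexp rexp
  | RSub rexp rexp
  | RMul rexp rexp
  | RDiv rexp rexp
  | RSqrt rexp

datatype bexp =
    NLess nexp nexp
  | RLess rexp rexp
  | BNot bexp
  | BAnd bexp bexp

datatype com =
    Skip
  | NAssign vname nexp
  | NStore vname nexp nexp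
  | RAssign vname rexp
  | RStore vname nexp rexp
  | Sample vname
  | Seq com com
  | Cond bexp com com
  | While bexp com

text \<open>The infinite tape holds the random numbers; the head points to the first unused one.\<close>

record state =
  nvar :: "vname \<Rightarrow> nat"
  narr :: "vname \<Rightarrow> nat \<Rightarrow> nat"
  rvar :: "vname \<Rightarrow> real"
  rarr :: "vname \<Rightarrow> nat \<Rightarrow> real"
  tape :: "nat \<Rightarrow> real"
  head :: nat

primrec nval :: "nexp \<Rightarrow> state \<Rightarrow> nat" where
  "nval (NConst k) s = k"
| "nval (NVar x) s = nvar s x"
| "nval (NArr a e) s = narr s a (nval e s)"
| "nval (NAdd e f) s = nval e s + nval f s"
| "nval (NSub e f) s = nval e s - nval f s"

primrec rval :: "rexp \<Rightarrow> state \<Rightarrow> real" where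
  "rval (RNat e) s = real (nval e s)"
| "rval (RVar x) s = rvar s x"
| "rval (RArr a e) s = rarr s a (nval e s)"
| "rval (RAdd e f) s = rval e s + rval f s"
| "rval (RSub e f) s = rval e s - rval f s"
| "rval (RMul e f) s = rval e s * rval f s"
| "rval (RDiv e f) s = rval e s / rval f s"
| "rval (RSqrt e) s = sqrt (rval e s)"

primrec bval :: "bexp \<Rightarrow> state \<Rightarrow> bool" where
  "bval (NLess e f) s \<longleftrightarrow> nval e s < nval f s"
| "bval (RLess e f) s \<longleftrightarrow> rval e s < rval f s"
| "bval (BNot b) s \<longleftrightarrow> \<not> bval b s"
| "bval (BAnd b c) s \<longleftrightarrow> bval b s \<and> bval c s"

text \<open>\<open>exec c s t s'\<close>: started in \<open>s\<close>, the program \<open>c\<close> halts in \<open>s'\<close> after \<open>t\<close> steps.  Every executed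
  elementary command and every evaluated guard is one step.  Expressions have a size fixed by the
  program, so charging each of their operations separately would change \<open>t\<close> by at most a factor that
  depends on the program only.\<close>

inductive exec :: "com \<Rightarrow> state \<Rightarrow> nat \<Rightarrow> state \<Rightarrow> bool" where
  exec_Skip: "exec Skip s 1 s"
| exec_NAssign: "exec (NAssign x e) s 1 (s\<lparr>nvar := (nvar s)(x := nval e s)\<rparr>)"
| exec_NStore: "exec (NStore a i e) s 1
    (s\<lparr>narr := (narr s)(a := (narr s a)(nval i s := nval e s))\<rparr>)"
| exec_RAssign: "exec (RAssign x e) s 1 (s\<lparr>rvar := (rvar s)(x := rval e s)\<rparr>)"
| exec_RStore: "exec (RStore a i e) s 1
    (s\<lparr>rarr := (rarr s)(a := (rarr s a)(nval i s := rval e s))\<rparr>)"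
| exec_Sample: "exec (Sample x) s 1
    (s\<lparr>rvar := (rvar s)(x := tape s (head s)), head := Suc (head s)\<rparr>)"
| exec_Seq: "exec c s t s' \<Longrightarrow> exec d s' u s'' \<Longrightarrow> exec (Seq c d) s (t + u) s''"
| exec_CondT: "bval b s \<Longrightarrow> exec c s t s' \<Longrightarrow> exec (Cond b c d) s (Suc t) s'"
| exec_CondF: "\<not> bval b s \<Longrightarrow> exec d s t s' \<Longrightarrow> exec (Cond b c d) s (Suc t) s'"
| exec_WhileF: "\<not> bval b s \<Longrightarrow> exec (While b c) s 1 s"
| exec_WhileT: "bval b s \<Longrightarrow> exec c s t s' \<Longrightarrow> exec (While b c) s' u s'' \<Longrightarrow>
    exec (While b c) s (Suc (t + u)) s''"

inductive_cases exec_elims: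
  "exec Skip s t s'"
  "exec (NAssign x e) s t s'"
  "exec (NStore a i e) s t s'"
  "exec (RAssign x e) s t s'"
  "exec (RStore a i e) s t s'"
  "exec (Sample x) s t s'"
  "exec (Seq c d) s t s'"
  "exec (Cond b c d) s t s'"
inductive_cases exec_WhileE: "exec (While b c) s t s'"

text \<open>For a fixed tape a run is deterministic.\<close>

lemma exec_deterministic:
  "exec c s t s' \<Longrightarrow> exec c s u s'' \<Longrightarrow> u = t \<and> s'' = s'"
proof (induction arbitrary: u s'' rule: exec.induct)
  case (exec_WhileF b s c)
  then show ?case by (auto elim: exec_WhileE)
next
  case (exec_WhileT b s c t s' v s3)
  from exec_WhileT.prems exec_WhileT.hyps(1) obtain t1 v1 s1 where
    "exec c s t1 s1" "exec (While b c) s1 v1 s''" "u = Suc (t1 + v1)"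
    by (auto elim: exec_WhileE)
  with exec_WhileT.IH show ?case by blast
next
  case (exec_Seq c s t s' d v s3)
  from exec_Seq.prems obtain t1 v1 s1 where
    "exec c s t1 s1" "exec d s1 v1 s''" "u = t1 + v1"
    by (auto elim: exec_elims(7))
  with exec_Seq.IH show ?case by blast
next
  case (exec_CondT b s c t s' d)
  from exec_CondT.prems exec_CondT.hyps(1) obtain t1 where "exec c s t1 s''" "u = Suc t1"
    by (auto elim: exec_elims(8))
  with exec_CondT.IH show ?case by blast
next
  case (exec_CondF b s d t s' c)
  from exec_CondF.prems exec_CondF.hyps(1) obtain t1 where "exec d s t1 s''" "u = Suc t1"
    by (auto elim: exec_elims(8))
  with exec_CondF.IH show ?case by blast
qed (erule exec_elims; simp)+

text \<open>Samples are independent standard normal variables; normalizing \<open>n\<close> of them gives a uniformly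
  distributed unit vector.\<close>

definition tape_measure :: "(nat \<Rightarrow> real) measure" where
  "tape_measure = PiM UNIV (\<lambda>_. std_normal_distribution)"


section \<open>Input, output and running time\<close>

text \<open>A matrix is given to the machine as a list of its nonzero entries, in arbitrary order.\<close>

definition lists_nonzeros :: "(nat \<times> nat) list \<Rightarrow> real mat \<Rightarrow> bool" where
  "lists_nonzeros L A \<longleftrightarrow> distinct L \<and> set L = nonzero_positions A"

definition array_of :: "('b \<Rightarrow> 'a::zero) \<Rightarrow> 'b list \<Rightarrow> nat \<Rightarrow> 'a" where
  "array_of f xs k = (if k < length xs then f (xs ! k) else 0)"

definition input_state ::
    "nat \<Rightarrow> real mat \<Rightarrow> real mat \<Rightarrow> (nat \<times> nat) list \<Rightarrow> (nat \<times> nat) list \<Rightarrow>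
     real Matrix.vec \<Rightarrow> real Matrix.vec \<Rightarrow> real \<Rightarrow> real \<Rightarrow>
     real \<Rightarrow> real \<Rightarrow> real \<Rightarrow> real \<Rightarrow> real \<Rightarrow> (nat \<Rightarrow> real) \<Rightarrow> state" where
  "input_state n A0 A1 L0 L1 b0 b1 c0 c1 \<xi> \<zeta> \<gamma> \<epsilon> p \<omega> =
    \<lparr> nvar = (\<lambda>_. 0)(''n'' := n, ''nnz0'' := length L0, ''nnz1'' := length L1),
      narr = (\<lambda>_ _. 0)
        (''row0'' := array_of fst L0, ''col0'' := array_of snd L0,
         ''row1'' := array_of fst L1, ''col1'' := array_of snd L1),
      rvar = (\<lambda>_. 0)
        (''c0'' := c0, ''c1'' := c1, ''xi'' := \<xi>, ''zeta'' := \<zeta>,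
         ''gamma_hat'' := \<gamma>, ''epsilon'' := \<epsilon>, ''p'' := p),
      rarr = (\<lambda>_ _. 0)
        (''A0'' := array_of (\<lambda>ij. A0 $$ ij) L0, ''A1'' := array_of (\<lambda>ij. A1 $$ ij) L1,
         ''b0'' := array_of (\<lambda>x. x) (list_of_vec b0),
         ''b1'' := array_of (\<lambda>x. x) (list_of_vec b1)),
      tape = \<omega>,
      head = 0 \<rparr>"

definition out_gamma_minus :: "state \<Rightarrow> real" where
  "out_gamma_minus s = rvar s ''gamma_minus''"

definition out_gamma_plus :: "state \<Rightarrow> real" where
  "out_gamma_plus s = rvar s ''gamma_plus''"

definition out_x :: "nat \<Rightarrow> state \<Rightarrow> real Matrix.vec" where
  "out_x n s = Matrix.vec n (rarr s ''x'')"

text \<open>Logarithmic factors in a running time are read as \<open>max {1, ln x}\<close>: for admissible parameters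
  \<open>\<kappa> / \<epsilon>\<close> may be less than 1, and \<open>n / p\<close> is if \<open>p > n\<close>.\<close>

definition log_factor :: "real \<Rightarrow> real" where
  "log_factor x = max 1 (ln x)"

definition main_time :: "nat \<Rightarrow> nat \<Rightarrow> real \<Rightarrow> real \<Rightarrow> real \<Rightarrow> real \<Rightarrow> real" where
  "main_time n N \<zeta> \<kappa> \<epsilon> p =
     real N * \<kappa> powr (3/2) * sqrt \<zeta> / sqrt \<epsilon> * log_factor (real n / p) * log_factor (\<kappa> / \<epsilon>)"

text \<open>The factors hidden by the soft-O notation are powers of this quantity.\<close>

definition loglog_factor :: "nat \<Rightarrow> real \<Rightarrow> real \<Rightarrow> real \<Rightarrow> real" where
  "loglog_factor n \<kappa> \<epsilon> p =
     log_factor (log_factor (real n / p)) * log_factor (log_factor (\<kappa> / \<epsilon>))"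

end

theory Submission
  imports Defs "HOL-Library.Function_Algebras" "Jordan_Normal_Form.Spectral_Radius"
begin

text \<open>Let \<open>A(\<gamma>) = A0 + \<gamma> A1\<close> and let \<open>\<Gamma>\<close> be the interval where \<open>A(\<gamma>)\<close> is semidefinite.  If \<open>\<gamma>\<close> lies outside
  \<open>\<Gamma>\<close>, moving along a direction of negative curvature of \<open>A(\<gamma>)\<close> to the boundary \<open>q1 = 0\<close> shows
  \<open>Opt \<le> q(\<gamma>, x)\<close> for all \<open>x\<close> on the appropriate side of the boundary.  Hence for nonnegative
  parameters just outside the two ends of \<open>\<Gamma>\<close> the maximum of the two quadratics has minimum exactly
  \<open>Opt\<close>.  For parameters just inside \<open>\<Gamma>\<close> both quadratics are convex, and an accelerated gradient
  method for their maximum, compared with a solution of the constrained problem, gives a point whose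
  value is close to \<open>Opt\<close>.

  The ends of \<open>\<Gamma>\<close> are located to precision \<open>\<delta> \<sim> \<epsilon> / \<kappa>\<^sup>2\<close> by bisection.  Since the smallest eigenvalue is
  concave in \<open>\<gamma>\<close>, at resolution \<open>h\<close> it suffices to distinguish \<open>\<lambda>\<^sub>m\<^sub>i\<^sub>n \<ge> h / \<kappa>\<close> from \<open>\<lambda>\<^sub>m\<^sub>i\<^sub>n < 0\<close>; this is done by
  observing whether Chebyshev polynomials of the shifted matrix blow up a Gaussian vector.  The costs
  of the levels form a geometric series dominated by the last one, so no logarithm of \<open>\<kappa> / \<epsilon>\<close> is
  lost.  One Gaussian vector serves all tests, because at each level there is only one point, fixed
  in advance, where an undetected error can occur.\<close>

section \<open>Vectors as real sequences\<close>

text \<open>The outer quadratics are not convex, so descent is impossible there; the inner pair is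
  convex, but its minimum may lie below Opt. So the point found for the inner pair is judged with
  the outer one. The move costs at most \<open>4 * \<delta> * \<bar>q1 x\<bar>\<close>. On the
  relevant sublevel set x has norm O(\<kappa>), hence q1 is O(\<kappa>^2), and this dictates
  \<delta>. Since the outer minimum is Opt itself, the claims about it reduce to: the value found is
  at most Opt + \<epsilon>/2.

  A test errs on one side only. A vector that has grown disproves a lower bound on the form,
  whatever the start vector was; a vector that has not grown misleads only if it is nearly
  orthogonal to one particular eigenvector. A test with step h is granted a failure probability
  proportional to p \<delta>/h. These shares form a geometric series, and they enter the number of
  rounds only through log(h/\<delta>), which is absorbed because a test with step h needs fewer
  rounds than the finest one by a factor sqrt(\<delta>/h).\<close>

instantiation "fun" :: (type, scaleR) scaleR
begin

definition scaleR_fun_def: "r *\<^sub>R f = (\<lambda>x. r *\<^sub>R f x)"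

instance ..

end

lemma scaleR_fun_apply [simp]: "(r *\<^sub>R f) x = r *\<^sub>R f x"
  by (simp add: scaleR_fun_def)

instance "fun" :: (type, real_vector) real_vector
  by standard (simp_all add: fun_eq_iff scaleR_add_right scaleR_add_left)

text \<open>Only the first \<open>n\<close> coordinates count, so \<^term>\<open>ip n\<close> is a degenerate inner product on all
  sequences; in exchange the arrays of the machine are vectors as they stand.\<close>

definition ip :: "nat \<Rightarrow> (nat \<Rightarrow> real) \<Rightarrow> (nat \<Rightarrow> real) \<Rightarrow> real" where
  "ip n x y = (\<Sum>i<n. x i * y i)"

lemma ip_add_left: "ip n (x + y) z = ip n x z + ip n y z"
  and ip_add_right: "ip n z (x + y) = ip n z x + ip n z y"
  and ip_diff_left: "ip n (x - y) z = ip n x z - ip n y z"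
  and ip_diff_right: "ip n z (x - y) = ip n z x - ip n z y"
  and ip_minus_left: "ip n (- x) z = - ip n x z"
  and ip_minus_right: "ip n z (- x) = - ip n z x"
  and ip_scale_left: "ip n (a *\<^sub>R x) z = a * ip n x z"
  and ip_scale_right: "ip n z (a *\<^sub>R x) = a * ip n z x"
  and ip_zero_left: "ip n 0 z = 0"
  and ip_zero_right: "ip n z 0 = 0"
  unfolding ip_def
  by (simp_all add: algebra_simps sum.distrib sum_subtractf sum_distrib_left sum_negf fun_Compl_def)

lemmas ip_simps = ip_add_left ip_add_right ip_diff_left ip_diff_right ip_minus_left ip_minus_right
  ip_scale_left ip_scale_right ip_zero_left ip_zero_right

lemma ip_commute: "ip n x y = ip n y x"
  by (simp add: ip_def mult.commute)

lemma ip_nonneg [simp]: "0 \<le> ip n x x"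
  by (simp add: ip_def sum_nonneg)

lemma ip_cong: "(\<And>i. i < n \<Longrightarrow> x i = x' i) \<Longrightarrow> (\<And>i. i < n \<Longrightarrow> y i = y' i) \<Longrightarrow> ip n x y = ip n x' y'"
  by (simp add: ip_def)

definition self_adjoint :: "nat \<Rightarrow> ((nat \<Rightarrow> real) \<Rightarrow> nat \<Rightarrow> real) \<Rightarrow> bool" where
  "self_adjoint n A \<longleftrightarrow> linear A \<and> (\<forall>x y. ip n x (A y) = ip n (A x) y)"

lemma self_adjointD:
  assumes "self_adjoint n A"
  shows "A (x + y) = A x + A y" "A (x - y) = A x - A y" "A (a *\<^sub>R x) = a *\<^sub>R A x" "A 0 = 0"
    "ip n (A x) y = ip n x (A y)"
  using assms unfolding self_adjoint_def
  by (auto simp: linear_add linear_diff linear_scale linear_0)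

lemma self_adjoint_add_scale:
  assumes "self_adjoint n A" "self_adjoint n B"
  shows "self_adjoint n (\<lambda>x. a *\<^sub>R A x + b *\<^sub>R B x)"
  using assms unfolding self_adjoint_def
  by (auto simp: ip_simps intro!: linear_compose_add linear_compose_scale_right)

lemma self_adjoint_id: "self_adjoint n (\<lambda>x. x)"
  by (simp add: self_adjoint_def linear_iff)

lemma quadratic_nonneg_imp_discriminant:
  fixes a b c :: real
  assumes "\<And>t. 0 \<le> a * t\<^sup>2 + 2 * b * t + c"
  shows "b\<^sup>2 \<le> a * c"
proof (cases "a = 0")
  case True
  have "b = 0"
  proof (rule ccontr)
    assume "b \<noteq> 0"
    with True assms[of "- (c + 1) / (2 * b)"] show False
      by (simp add: field_simps)
  qed
  then show ?thesis using True by simp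
next
  case False
  have "a > 0"
  proof (rule ccontr)
    assume "\<not> a > 0"
    with False have a: "a < 0" by simp
    \<comment> \<open>So large that the negative quadratic term outweighs the other two and still
      leaves \<open>- t\<close>.\<close>
    define t where "t = (2 * \<bar>b\<bar> + \<bar>c\<bar> + 1) / (- a) + 1"
    have t: "t \<ge> 1" "- a * t \<ge> 2 * \<bar>b\<bar> + \<bar>c\<bar> + 1"
      using a by (auto simp: t_def field_simps)
    have "2 * b * t \<le> 2 * \<bar>b\<bar> * t" using t by (intro mult_right_mono) auto
    moreover have "c \<le> \<bar>c\<bar> * t" using t mult_left_mono[of 1 t "\<bar>c\<bar>"] by simp
    moreover have "(- a * t) * t \<ge> (2 * \<bar>b\<bar> + \<bar>c\<bar> + 1) * t"
      using t by (intro mult_right_mono) auto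
    ultimately have "a * t\<^sup>2 + 2 * b * t + c \<le> - t"
      by (simp add: power2_eq_square algebra_simps)
    with assms[of t] t show False by linarith
  qed
  with assms[of "- b / a"] show ?thesis
    by (simp add: field_simps power2_eq_square)
qed

text \<open>The form may be degenerate (already \<open>ip n\<close> is), so normalizing by its value
  is impossible; nonnegativity along the line \<open>x + t *\<^sub>R y\<close> gives the bound
  through the discriminant.\<close>

lemma psd_form_Cauchy_Schwarz:
  assumes "self_adjoint n S" "\<And>w. 0 \<le> ip n w (S w)"
  shows "(ip n x (S y))\<^sup>2 \<le> ip n x (S x) * ip n y (S y)"
proof -
  have "0 \<le> ip n y (S y) * t\<^sup>2 + 2 * ip n x (S y) * t + ip n x (S x)" for t
  proof -
    have "ip n y (S x) = ip n x (S y)"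
      using self_adjointD(5)[OF assms(1), of x y] ip_commute by metis
    then show ?thesis
      using assms(2)[of "x + t *\<^sub>R y"]
      by (simp add: self_adjointD(1-4)[OF assms(1)] ip_simps power2_eq_square algebra_simps)
  qed
  then show ?thesis
    using quadratic_nonneg_imp_discriminant by (metis mult.commute)
qed

lemma ip_Cauchy_Schwarz: "(ip n x y)\<^sup>2 \<le> ip n x x * ip n y y"
  using psd_form_Cauchy_Schwarz[OF self_adjoint_id, of n x y] by simp

text \<open>For a spectrum in [0, L] this is S^2 \<le> L S. Cauchy-Schwarz for the form of S,
  applied to \<open>S w\<close> and \<open>w\<close>, replaces a spectral decomposition: |S w|^4
  \<le> L |S w|^2 \<langle>w, S w\<rangle>.\<close>

lemma psd_form_image_bound:
  assumes "self_adjoint n S" "\<And>w. 0 \<le> ip n w (S w)" "\<And>w. ip n w (S w) \<le> L * ip n w w"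
  shows "ip n (S w) (S w) \<le> L * ip n w (S w)"
proof (cases "ip n (S w) (S w) = 0")
  case True
  have "0 \<le> L * ip n w (S w)"
  proof (cases "ip n w (S w) = 0")
    case False
    then have "ip n w (S w) > 0" using assms(2)[of w] by simp
    moreover have "L * ip n w w > 0" using assms(3)[of w] calculation by linarith
    ultimately show ?thesis
      by (smt (verit) ip_nonneg mult_nonneg_nonneg mult_nonpos_nonneg)
  qed simp
  then show ?thesis using True by simp
next
  case False
  then have pos: "ip n (S w) (S w) > 0" by (simp add: order_less_le)
  have "(ip n (S w) (S w))\<^sup>2 \<le> ip n (S w) (S (S w)) * ip n w (S w)"
    using psd_form_Cauchy_Schwarz[OF assms(1,2)] .
  also have "\<dots> \<le> (L * ip n (S w) (S w)) * ip n w (S w)"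
    using assms(2,3) by (intro mult_right_mono) auto
  finally have "ip n (S w) (S w) * ip n (S w) (S w) \<le> ip n (S w) (S w) * (L * ip n w (S w))"
    by (simp add: power2_eq_square mult_ac)
  then show ?thesis using pos by simp
qed

section \<open>The Chebyshev recurrence\<close>

text \<open>The components are \<open>T\<^sub>k(M) v\<close> and \<open>U\<^bsub>k-1\<^esub>(M) v\<close>.\<close>

primrec cheb :: "((nat \<Rightarrow> real) \<Rightarrow> nat \<Rightarrow> real) \<Rightarrow> (nat \<Rightarrow> real) \<Rightarrow> nat \<Rightarrow>
    (nat \<Rightarrow> real) \<times> (nat \<Rightarrow> real)" where
  "cheb M v 0 = (v, 0)"
| "cheb M v (Suc k) =
     (M (M (snd (cheb M v k)) + fst (cheb M v k)) - snd (cheb M v k),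
      M (snd (cheb M v k)) + fst (cheb M v k))"

primrec cheb_real :: "real \<Rightarrow> nat \<Rightarrow> real \<times> real" where
  "cheb_real \<mu> 0 = (1, 0)"
| "cheb_real \<mu> (Suc k) =
     (\<mu> * (\<mu> * snd (cheb_real \<mu> k) + fst (cheb_real \<mu> k)) - snd (cheb_real \<mu> k),
      \<mu> * snd (cheb_real \<mu> k) + fst (cheb_real \<mu> k))"

text \<open>The Pell identity T_k^2 + (1 - M^2) U_{k-1}^2 = 1, read as an identity of quadratic
  forms at v. It bounds |T_k(M) v| for contractions M without eigenvalues.\<close>

lemma cheb_Pell:
  assumes "self_adjoint n M"
  shows "ip n (fst (cheb M v k)) (fst (cheb M v k)) + ip n (snd (cheb M v k)) (snd (cheb M v k))
    - ip n (M (snd (cheb M v k))) (M (snd (cheb M v k))) = ip n v v"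
proof (induction k)
  case 0
  show ?case unfolding cheb.simps fst_conv snd_conv self_adjointD(4)[OF assms] ip_simps by simp
next
  case (Suc k)
  obtain c s where cs: "cheb M v k = (c, s)" by force
  define r where "r = M s + c"
  have 1: "ip n (M r) s = ip n r (M s)"
    using self_adjointD(5)[OF assms] by simp
  have 2: "ip n r r - 2 * ip n r (M s) = ip n c c - ip n (M s) (M s)"
    unfolding r_def by (simp add: ip_simps ip_commute)
  have "cheb M v (Suc k) = (M r - s, r)"
    by (simp only: cheb.simps cs fst_conv snd_conv r_def)
  then have 3: "fst (cheb M v (Suc k)) = M r - s" "snd (cheb M v (Suc k)) = r"
    by (simp_all only: fst_conv snd_conv)
  have "ip n (M r - s) (M r - s) = ip n (M r) (M r) - 2 * ip n r (M s) + ip n s s"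
    using 1 ip_commute[of n s "M r"] by (simp add: ip_simps)
  then show ?case using Suc 2 unfolding 3 cs fst_conv snd_conv by linarith
qed

lemma cheb_contraction:
  assumes "self_adjoint n M" "\<And>w. ip n (M w) (M w) \<le> ip n w w"
  shows "ip n (fst (cheb M v k)) (fst (cheb M v k)) \<le> ip n v v"
  using cheb_Pell[OF assms(1), of v k] assms(2)[of "snd (cheb M v k)"] by linarith

text \<open>Self-adjointness is already built into the hypothesis, so the component along u of an
  arbitrary start vector follows the scalar recurrence and v need not be decomposed.\<close>

lemma cheb_eigenvector:
  assumes "\<And>y. ip n u (M y) = \<mu> * ip n u y"
  shows "ip n u (fst (cheb M v k)) = fst (cheb_real \<mu> k) * ip n u v"
    and "ip n u (snd (cheb M v k)) = snd (cheb_real \<mu> k) * ip n u v"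
  by (induction k) (simp_all add: ip_simps assms algebra_simps)

lemma cheb_real_pos:
  fixes \<mu> :: real
  assumes "1 \<le> \<mu>"
  shows "1 \<le> fst (cheb_real \<mu> k)" "0 \<le> snd (cheb_real \<mu> k)"
proof (induction k)
  case (Suc k)
  case 1
  have "snd (cheb_real \<mu> k) \<le> \<mu> * (\<mu> * snd (cheb_real \<mu> k))"
    using Suc(2) assms by (smt (verit) mult_le_cancel_right1 mult_nonneg_nonneg)
  moreover have "1 \<le> \<mu> * fst (cheb_real \<mu> k)"
    using Suc(1) assms mult_mono[of 1 \<mu> 1] by simp
  ultimately show ?case by (simp add: algebra_simps)
next
  case (Suc k)
  case 2
  show ?case using Suc assms by simp
qed simp_all

text \<open>The machine evaluates the scalar polynomial only at the known point
  \<open>1 + e\<close>, while the unknown eigenvalue is mapped to a point further right; growth at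
  the former must carry over to the latter.\<close>

lemma cheb_real_mono:
  fixes \<mu> \<nu> :: real
  assumes "1 \<le> \<mu>" "\<mu> \<le> \<nu>"
  shows "fst (cheb_real \<mu> k) \<le> fst (cheb_real \<nu> k)"
    "snd (cheb_real \<mu> k) \<le> snd (cheb_real \<nu> k)"
proof (induction k)
  case (Suc k)
  case 1
  have 1: "(\<mu> * \<mu> - 1) * snd (cheb_real \<mu> k) \<le> (\<nu> * \<nu> - 1) * snd (cheb_real \<nu> k)"
    using Suc(2) assms cheb_real_pos(2)[OF assms(1)] mult_mono[of \<mu> \<nu> \<mu> \<nu>] mult_mono[of 1 \<nu> 1 \<nu>]
    by (intro mult_mono) auto
  have 2: "\<mu> * fst (cheb_real \<mu> k) \<le> \<nu> * fst (cheb_real \<nu> k)"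
    using Suc(1) assms cheb_real_pos(1)[OF assms(1), of k] by (intro mult_mono) auto
  show ?case using 1 2 by (simp add: algebra_simps)
next
  case (Suc k)
  case 2
  have "\<mu> * snd (cheb_real \<mu> k) \<le> \<nu> * snd (cheb_real \<nu> k)"
    using Suc(2) assms cheb_real_pos(2)[OF assms(1)] by (intro mult_mono) auto
  then show ?case using Suc(1) by simp
qed simp_all

text \<open>With a = sqrt(\<mu>^2 - 1) one has 2 T_k(\<mu>) = (\<mu> + a)^k + (\<mu> - a)^k, where
  \<mu> + a \<ge> 1 + sqrt(2 e) \<ge> exp(sqrt(2 e)/2). The rate sqrt e instead of e is the gain
  over the power method and the source of the square roots in the running time.\<close>

lemma cheb_real_growth:
  fixes e :: real
  assumes "0 < e" "2 * e \<le> 1"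
  shows "exp (real k * sqrt (2 * e) / 2) / 2 \<le> fst (cheb_real (1 + e) k)"
proof -
  define \<mu> where "\<mu> = 1 + e"
  define a where "a = sqrt (\<mu>\<^sup>2 - 1)"
  have ge: "2 * e \<le> \<mu>\<^sup>2 - 1" by (simp add: \<mu>_def power2_eq_square algebra_simps)
  have a2: "a * a = \<mu> * \<mu> - 1"
    using ge assms unfolding a_def by (simp add: power2_eq_square)
  have a0: "0 \<le> a" using ge assms unfolding a_def by simp
  have age: "sqrt (2 * e) \<le> a" unfolding a_def using ge by (rule real_sqrt_le_mono)
  have amu: "a < \<mu>"
  proof (rule ccontr)
    assume "\<not> a < \<mu>"
    then have "\<mu> * \<mu> \<le> a * a" using assms by (intro mult_mono) (auto simp: \<mu>_def)
    then show False using a2 by simp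
  qed
  define c s where "c k = fst (cheb_real \<mu> k)" and "s k = snd (cheb_real \<mu> k)" for k
  have plus: "c k + a * s k = (\<mu> + a) ^ k" for k
  proof (induction k)
    case (Suc k)
    have "c (Suc k) + a * s (Suc k) = (a * a) * s k + \<mu> * c k + a * (\<mu> * s k + c k)"
      unfolding a2 c_def s_def by (simp add: algebra_simps)
    also have "\<dots> = (\<mu> + a) * (c k + a * s k)" by (simp add: algebra_simps)
    finally show ?case using Suc by simp
  qed (simp add: c_def s_def)
  have minus: "c k - a * s k = (\<mu> - a) ^ k" for k
  proof (induction k)
    case (Suc k)
    have "c (Suc k) - a * s (Suc k) = (a * a) * s k + \<mu> * c k - a * (\<mu> * s k + c k)"
      unfolding a2 c_def s_def by (simp add: algebra_simps)
    also have "\<dots> = (\<mu> - a) * (c k - a * s k)" by (simp add: algebra_simps)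
    finally show ?case using Suc by simp
  qed (simp add: c_def s_def)
  have r: "0 \<le> sqrt (2 * e)" "sqrt (2 * e) \<le> 1" using assms by auto
  have "exp (sqrt (2 * e) / 2) \<le> 1 + sqrt (2 * e) / 2 + (sqrt (2 * e) / 2)\<^sup>2"
    using r by (intro exp_bound) linarith+
  also have "\<dots> \<le> 1 + sqrt (2 * e)"
    using r mult_left_mono[of "sqrt (2 * e)" 1 "sqrt (2 * e)"] by (simp add: power2_eq_square)
  also have "\<dots> \<le> \<mu> + a" using age assms by (simp add: \<mu>_def)
  finally have "exp (sqrt (2 * e) / 2) ^ k \<le> (\<mu> + a) ^ k"
    by (intro power_mono) auto
  also have "\<dots> \<le> 2 * c k"
    using plus[of k] minus[of k] amu zero_le_power[of "\<mu> - a" k] by linarith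
  finally show ?thesis
    by (simp add: c_def \<mu>_def exp_of_nat_mult [symmetric] mult.commute)
qed

text \<open>The machine has neither logarithms nor rounding, so it finds the degree by running the
  scalar recurrence until it reaches B. The first hitting index is therefore the exact number of
  rounds of that loop.\<close>

lemma cheb_real_hitting_time:
  fixes e B :: real
  assumes "0 < e" "2 * e \<le> 1"
  obtains m where "\<And>k. k < m \<Longrightarrow> fst (cheb_real (1 + e) k) < B"
    "B \<le> fst (cheb_real (1 + e) m)" "real m \<le> 1 + 2 * max 0 (ln (2 * B)) / sqrt (2 * e)"
proof -
  define c where "c k = fst (cheb_real (1 + e) k)" for k
  have r: "0 < sqrt (2 * e)" using assms by simp
  define x where "x = 2 * max 0 (ln (2 * B)) / sqrt (2 * e)"
  have reach: "B \<le> c k" if "x \<le> real k" for k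
  proof (cases "0 < B")
    case True
    have "max 0 (ln (2 * B)) \<le> real k * sqrt (2 * e) / 2"
      using that r unfolding x_def by (simp add: field_simps)
    then have "ln (2 * B) \<le> real k * sqrt (2 * e) / 2" by simp
    then have "2 * B \<le> exp (real k * sqrt (2 * e) / 2)"
      using True by (metis exp_le_cancel_iff exp_ln mult_pos_pos zero_less_numeral)
    then show ?thesis using cheb_real_growth[OF assms, of k] unfolding c_def by linarith
  next
    case False
    then show ?thesis using cheb_real_pos(1)[of "1 + e" k] assms unfolding c_def by linarith
  qed
  have x0: "0 \<le> x" using r unfolding x_def by simp
  have ex: "B \<le> c (nat \<lceil>x\<rceil>)" by (rule reach) linarith
  define m where "m = (LEAST k. B \<le> c k)"
  show thesis
  proof (rule that[of m])
    show "fst (cheb_real (1 + e) k) < B" if "k < m" for k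
      using not_less_Least[of k "\<lambda>k. B \<le> c k"] that by (simp add: m_def c_def)
    show "B \<le> fst (cheb_real (1 + e) m)"
      using LeastI[of "\<lambda>k. B \<le> c k", OF ex] by (simp add: m_def c_def)
    have "m \<le> nat \<lceil>x\<rceil>" unfolding m_def using ex by (rule Least_le)
    then show "real m \<le> 1 + 2 * max 0 (ln (2 * B)) / sqrt (2 * e)"
      using x0 unfolding x_def[symmetric] by linarith
  qed
qed

definition cheb_op :: "((nat \<Rightarrow> real) \<Rightarrow> nat \<Rightarrow> real) \<Rightarrow> real \<Rightarrow> real \<Rightarrow> (nat \<Rightarrow> real) \<Rightarrow> nat \<Rightarrow> real" where
  "cheb_op A L \<mu> w = \<mu> *\<^sub>R w + (- (2 / L)) *\<^sub>R A w"

lemma cheb_op_self_adjoint: "self_adjoint n A \<Longrightarrow> self_adjoint n (cheb_op A L \<mu>)"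
  unfolding cheb_op_def[abs_def] by (rule self_adjoint_add_scale[OF self_adjoint_id])

text \<open>If the spectrum of \<open>A\<close> lies in \<open>[\<eta>, L]\<close> then \<^term>\<open>cheb_op A L (1 + 2 * \<eta> / L)\<close> is a contraction,
  while a nonpositive eigenvalue of \<open>A\<close> is moved beyond \<open>1 + 2 * \<eta> / L\<close>, where the Chebyshev
  polynomials grow exponentially.\<close>

lemma cheb_test_bounded:
  assumes A: "self_adjoint n A" and up: "\<And>w. ip n w (A w) \<le> L * ip n w w"
    and lo: "\<And>w. \<eta> * ip n w w \<le> ip n w (A w)" and L: "0 < L" "0 \<le> \<eta>"
  shows "ip n (fst (cheb (cheb_op A L (1 + 2 * \<eta> / L)) v k)) (fst (cheb (cheb_op A L (1 + 2 * \<eta> / L)) v k))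
    \<le> ip n v v"
proof (rule cheb_contraction)
  show "self_adjoint n (cheb_op A L (1 + 2 * \<eta> / L))" using cheb_op_self_adjoint[OF A] .
  fix w
  \<comment> \<open>Subtracting \<eta> turns the operator into
    \<open>w - (2 / L) *\<^sub>R S w\<close> with 0 \<le> S \<le> L, whose spectrum lies in
    [-1, 1].\<close>
  define S where "S = (\<lambda>w. 1 *\<^sub>R A w + (- \<eta>) *\<^sub>R w)"
  have S: "self_adjoint n S" unfolding S_def using A self_adjoint_id by (rule self_adjoint_add_scale)
  have "ip n (S w) (S w) \<le> L * ip n w (S w)"
  proof (rule psd_form_image_bound[OF S])
    fix w
    show "0 \<le> ip n w (S w)" using lo[of w] by (simp add: S_def ip_simps)
    have "0 \<le> \<eta> * ip n w w" using L by simp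
    then show "ip n w (S w) \<le> L * ip n w w" using up[of w] by (simp add: S_def ip_simps)
  qed
  then have "ip n (S w) (S w) / L \<le> ip n w (S w)" using L by (simp add: field_simps)
  then have le: "(4 / L) * (ip n (S w) (S w) / L) \<le> (4 / L) * ip n w (S w)"
    using L by (intro mult_left_mono) auto
  have eq: "cheb_op A L (1 + 2 * \<eta> / L) w = w + (- (2 / L)) *\<^sub>R S w"
    by (simp add: cheb_op_def S_def fun_eq_iff algebra_simps)
  show "ip n (cheb_op A L (1 + 2 * \<eta> / L) w) (cheb_op A L (1 + 2 * \<eta> / L) w) \<le> ip n w w"
  proof -
    have "ip n (cheb_op A L (1 + 2 * \<eta> / L) w) (cheb_op A L (1 + 2 * \<eta> / L) w)
      = ip n w w - (4 / L) * ip n w (S w) + (4 / L) * (ip n (S w) (S w) / L)"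
      unfolding eq ip_simps using L by (simp add: ip_commute[of n "S w" w] field_simps)
    then show ?thesis using le by linarith
  qed
qed

text \<open>Read contrapositively: if the iterate is no longer than v although there is an
  eigenvalue l \<le> 0, then v is almost orthogonal to u. Only this event must be made improbable,
  and only for one fixed u.\<close>

lemma cheb_test_growth:
  assumes A: "self_adjoint n A" and eig: "\<And>y. ip n y (A u) = l * ip n y u" "l \<le> 0" "ip n u u = 1"
    and L: "0 < L" "0 \<le> \<eta>"
    and B: "0 \<le> B" "B \<le> fst (cheb_real (1 + 2 * \<eta> / L) k)"
    and pass: "ip n (fst (cheb (cheb_op A L (1 + 2 * \<eta> / L)) v k))
      (fst (cheb (cheb_op A L (1 + 2 * \<eta> / L)) v k)) \<le> ip n v v"
  shows "B\<^sup>2 * (ip n u v)\<^sup>2 \<le> ip n v v"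
proof -
  define \<mu> where "\<mu> = 1 + 2 * \<eta> / L - 2 / L * l"
  define M where "M = cheb_op A L (1 + 2 * \<eta> / L)"
  have "1 \<le> 1 + 2 * \<eta> / L" "1 + 2 * \<eta> / L \<le> \<mu>"
    using L eig(2) by (auto simp: \<mu>_def zero_le_mult_iff divide_le_0_iff)
  from cheb_real_mono(1)[OF this, of k] B(2) have "B \<le> fst (cheb_real \<mu> k)" by linarith
  then have "B\<^sup>2 * (ip n u v)\<^sup>2 \<le> (fst (cheb_real \<mu> k))\<^sup>2 * (ip n u v)\<^sup>2"
    using B(1) by (intro mult_right_mono power_mono) auto
  also have "\<dots> = (ip n u (fst (cheb M v k)))\<^sup>2"
  proof -
    have "ip n u (M y) = \<mu> * ip n u y" for y
    proof -
      have "ip n u (A y) = ip n y (A u)"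
        using self_adjointD(5)[OF A] ip_commute by metis
      then show ?thesis
        by (simp add: M_def cheb_op_def \<mu>_def ip_simps eig(1) ip_commute[of n y u] algebra_simps)
    qed
    from cheb_eigenvector(1)[of n u M \<mu>, OF this] show ?thesis by (simp add: power_mult_distrib)
  qed
  also have "\<dots> \<le> ip n v v"
    using ip_Cauchy_Schwarz[of n u "fst (cheb M v k)"] pass eig(3) by (simp add: M_def)
  finally show ?thesis .
qed

section \<open>Accelerated gradient steps for the maximum of two convex quadratics\<close>

definition qf :: "nat \<Rightarrow> ((nat \<Rightarrow> real) \<Rightarrow> nat \<Rightarrow> real) \<Rightarrow> (nat \<Rightarrow> real) \<Rightarrow> real \<Rightarrow> (nat \<Rightarrow> real) \<Rightarrow> real" where
  "qf n A b c x = ip n x (A x) + 2 * ip n b x + c"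

lemma qf_shift:
  assumes "self_adjoint n A"
  shows "qf n A b c (x + d) = qf n A b c x + ip n (2 *\<^sub>R (A x + b)) d + ip n d (A d)"
proof -
  have "ip n x (A d) = ip n d (A x)"
    using self_adjointD(5)[OF assms, of x d] ip_commute[of n "A x" d] by simp
  then show ?thesis
    using ip_commute[of n "A x" d]
    by (simp add: qf_def self_adjointD(1)[OF assms] ip_simps algebra_simps)
qed

lemma qf_convex:
  assumes "self_adjoint n A" "\<And>w. 0 \<le> ip n w (A w)" "0 \<le> \<theta>" "\<theta> \<le> 1"
  shows "qf n A b c (x + \<theta> *\<^sub>R (w - x)) \<le> (1 - \<theta>) * qf n A b c x + \<theta> * qf n A b c w"
proof -
  define d where "d = w - x"
  have w: "w = x + d" by (simp add: d_def)
  define G where "G = ip n (2 *\<^sub>R (A x + b)) d"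
  have "0 \<le> \<theta> * (1 - \<theta>) * ip n d (A d)"
    using assms(3,4) assms(2)[of d] by simp
  moreover have "qf n A b c (x + \<theta> *\<^sub>R d) = qf n A b c x + \<theta> * G + \<theta> * (\<theta> * ip n d (A d))"
    unfolding qf_shift[OF assms(1)] self_adjointD(3)[OF assms(1)] ip_scale_right ip_scale_left G_def by simp
  moreover have "qf n A b c w = qf n A b c x + G + ip n d (A d)"
    unfolding w qf_shift[OF assms(1)] G_def by simp
  ultimately show ?thesis unfolding d_def[symmetric] by (simp add: algebra_simps)
qed

lemma max_qf_convex:
  assumes "self_adjoint n A" "\<And>w. 0 \<le> ip n w (A w)" "self_adjoint n B" "\<And>w. 0 \<le> ip n w (B w)"
    and "0 \<le> \<theta>" "\<theta> \<le> 1"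
  shows "max (qf n A a \<alpha> (x + \<theta> *\<^sub>R (w - x))) (qf n B b \<beta> (x + \<theta> *\<^sub>R (w - x)))
    \<le> (1 - \<theta>) * max (qf n A a \<alpha> x) (qf n B b \<beta> x) + \<theta> * max (qf n A a \<alpha> w) (qf n B b \<beta> w)"
proof -
  have "(1 - \<theta>) * qf n A a \<alpha> x + \<theta> * qf n A a \<alpha> w
      \<le> (1 - \<theta>) * max (qf n A a \<alpha> x) (qf n B b \<beta> x) + \<theta> * max (qf n A a \<alpha> w) (qf n B b \<beta> w)"
    "(1 - \<theta>) * qf n B b \<beta> x + \<theta> * qf n B b \<beta> w
      \<le> (1 - \<theta>) * max (qf n A a \<alpha> x) (qf n B b \<beta> x) + \<theta> * max (qf n A a \<alpha> w) (qf n B b \<beta> w)"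
    using assms(5,6) by (intro add_mono mult_left_mono; simp)+
  then show ?thesis
    using qf_convex[OF assms(1,2,5,6), of a \<alpha> x w] qf_convex[OF assms(3,4,5,6), of b \<beta> x w] by linarith
qed

text \<open>For \<open>den\<close> \<ge> 0, a maximizer over [0, 1] of the concave dual objective
  num l - den l^2 / 2. The order of the tests keeps \<open>den = 0\<close> away from the
  quotient.\<close>

definition prox_weight :: "real \<Rightarrow> real \<Rightarrow> real" where
  "prox_weight num den = (if num \<le> 0 then 0 else if den \<le> num then 1 else num / den)"

text \<open>The step minimizes \<open>max\<^sub>i (f\<^sub>i(y) + \<langle>\<nabla>f\<^sub>i(y), x - y\<rangle>) + L/2 \<parallel>x - y\<parallel>\<^sup>2\<close>; the weight solves the
  one-dimensional dual problem.\<close>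

lemma prox_step:
  fixes n :: nat and L \<alpha> \<beta> :: real and a b y w :: "nat \<Rightarrow> real"
  assumes A: "self_adjoint n A" "\<And>w. 0 \<le> ip n w (A w)" "\<And>w. ip n w (A w) \<le> L / 2 * ip n w w"
    and B: "self_adjoint n B" "\<And>w. 0 \<le> ip n w (B w)" "\<And>w. ip n w (B w) \<le> L / 2 * ip n w w"
    and L: "0 < L"
    and G: "G = 2 *\<^sub>R (A y + a)" and H: "H = 2 *\<^sub>R (B y + b)"
    and num: "num = L * (qf n A a \<alpha> y - qf n B b \<beta> y) - ip n H (G - H)"
    and den: "den = ip n (G - H) (G - H)"
    and x: "x = y - (1 / L) *\<^sub>R (prox_weight num den *\<^sub>R G + (1 - prox_weight num den) *\<^sub>R H)"
  shows "max (qf n A a \<alpha> x) (qf n B b \<beta> x)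
    \<le> max (qf n A a \<alpha> w) (qf n B b \<beta> w) + L / 2 * (ip n (w - y) (w - y) - ip n (w - x) (w - x))"
proof -
  define l where "l = prox_weight num den"
  define P where "P = l *\<^sub>R G + (1 - l) *\<^sub>R H"
  define d where "d = x - y"
  define e where "e = w - y"
  have den0: "0 \<le> den" unfolding den by simp
  have l: "0 \<le> l" "l \<le> 1" using den0 by (auto simp: l_def prox_weight_def)
  have xd: "x = y + d" and we: "w = y + e" by (simp_all add: d_def e_def)
  have dP: "d = (- 1 / L) *\<^sub>R P" unfolding d_def x P_def l_def by simp
  have Pd: "P = (- L) *\<^sub>R d" unfolding dP using L by simp
  define fy gy where "fy = qf n A a \<alpha> y" and "gy = qf n B b \<beta> y"
  define lf where "lf = fy + ip n G d + L / 2 * ip n d d"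
  define lg where "lg = gy + ip n H d + L / 2 * ip n d d"
  have fx: "qf n A a \<alpha> x \<le> lf" using A(3)[of d]
    unfolding xd qf_shift[OF A(1)] lf_def fy_def G by linarith
  have gx: "qf n B b \<beta> x \<le> lg" using B(3)[of d]
    unfolding xd qf_shift[OF B(1)] lg_def gy_def H by linarith
  have "lf - lg = fy - gy + ip n (G - H) d" by (simp add: lf_def lg_def ip_simps)
  also have "\<dots> = fy - gy - ip n (G - H) P / L" unfolding dP by (simp add: ip_simps)
  also have "ip n (G - H) P = l * den + ip n H (G - H)"
    unfolding P_def den by (simp add: ip_simps algebra_simps ip_commute)
  finally have diff: "lf - lg = (num - l * den) / L"
    using L unfolding num fy_def gy_def by (simp add: field_simps)
  \<comment> \<open>Complementary slackness: full weight rests on one model only if that model is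
    the larger one, and for weights strictly between 0 and 1 the two models agree. So the maximum is
    the weighted mean.\<close>
  have kkt: "max lf lg = l * lf + (1 - l) * lg"
  proof -
    consider "num \<le> 0" | "0 < num" "den \<le> num" | "0 < num" "num < den" by linarith
    then show ?thesis
    proof cases
      case 1
      then have l0: "l = 0" by (simp add: l_def prox_weight_def)
      with 1 diff L have "lf - lg \<le> 0" by (simp add: divide_le_0_iff)
      then show ?thesis using l0 by simp
    next
      case 2
      then have l1: "l = 1" by (simp add: l_def prox_weight_def)
      with 2 diff L have "0 \<le> lf - lg" by simp
      then show ?thesis using l1 by simp
    next
      case 3
      then have "l * den = num" by (simp add: l_def prox_weight_def)
      with diff have "lf = lg" by simp
      then show ?thesis by (simp add: algebra_simps)
    qed
  qed
  have "ip n P d = - L * ip n d d" "ip n P e = - L * ip n d e"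
    unfolding Pd by (simp_all add: ip_simps)
  moreover have "ip n P d = l * ip n G d + (1 - l) * ip n H d"
    "ip n P e = l * ip n G e + (1 - l) * ip n H e"
    by (simp_all add: P_def ip_simps)
  ultimately have Pe: "l * ip n G d + (1 - l) * ip n H d = - L * ip n d d"
    "l * ip n G e + (1 - l) * ip n H e = - L * ip n d e" by simp_all
  have "l * lf + (1 - l) * lg = (l * fy + (1 - l) * gy) + (l * ip n G d + (1 - l) * ip n H d)
      + L / 2 * ip n d d"
  proof -
    have "l * (fy + P + L / 2 * D) + (1 - l) * (gy + Q + L / 2 * D)
      = (l * fy + (1 - l) * gy) + (l * P + (1 - l) * Q) + L / 2 * D" for P Q D
      by (simp add: field_simps)
    then show ?thesis unfolding lf_def lg_def .
  qed
  then have lhs: "max lf lg = (l * fy + (1 - l) * gy) - L / 2 * ip n d d"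
    unfolding kkt Pe by linarith
  have wx: "w - x = e - d" by (simp add: e_def d_def)
  have dist: "ip n (w - y) (w - y) - ip n (w - x) (w - x) = 2 * ip n d e - ip n d d"
    unfolding wx e_def[symmetric] by (simp add: ip_simps ip_commute[of n e d])
  have fw: "fy + ip n G e \<le> qf n A a \<alpha> w"
    unfolding we qf_shift[OF A(1)] fy_def G using A(2)[of e] by simp
  have gw: "gy + ip n H e \<le> qf n B b \<beta> w"
    unfolding we qf_shift[OF B(1)] gy_def H using B(2)[of e] by simp
  have "(l * fy + (1 - l) * gy) + (l * ip n G e + (1 - l) * ip n H e)
      = l * (fy + ip n G e) + (1 - l) * (gy + ip n H e)"
    by (simp add: algebra_simps)
  also have "\<dots> \<le> l * max (qf n A a \<alpha> w) (qf n B b \<beta> w) + (1 - l) * max (qf n A a \<alpha> w) (qf n B b \<beta> w)"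
    using l fw gw by (intro add_mono mult_left_mono) auto
  finally have "(l * fy + (1 - l) * gy) - L * ip n d e \<le> max (qf n A a \<alpha> w) (qf n B b \<beta> w)"
    unfolding Pe by (simp add: algebra_simps)
  then show ?thesis unfolding dist using fx gx lhs by (simp add: algebra_simps)
qed

text \<open>The prox inequality is applied at the convex combination of x and w with weight 1/t: its
  distances to y and to x' are 1/t times those of w to z and to z'. Multiplying by t^2 and using t^2
  - t = t0^2 makes the potentials match. The level \<open>c\<close> instead of \<open>F w\<close>
  allows a comparison with Opt at a point that need not minimize F.\<close>

lemma accelerated_step:
  fixes F :: "(nat \<Rightarrow> real) \<Rightarrow> real"
  assumes prox: "\<And>w. F x' \<le> F w + L / 2 * (ip n (w - y) (w - y) - ip n (w - x') (w - x'))"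
    and conv: "F (x + (1 / t) *\<^sub>R (w - x)) \<le> (1 - 1 / t) * F x + 1 / t * F w"
    and t: "1 \<le> t" "t\<^sup>2 - t = t0\<^sup>2" and y: "y = x + (1 / t) *\<^sub>R (z - x)"
    and z': "z' = z + t *\<^sub>R (x' - y)" and c: "F w \<le> c"
  shows "t\<^sup>2 * (F x' - c) + L / 2 * ip n (w - z') (w - z') \<le> t0\<^sup>2 * (F x - c) + L / 2 * ip n (w - z) (w - z)"
proof -
  define v where "v = x + (1 / t) *\<^sub>R (w - x)"
  have vy: "v - y = (1 / t) *\<^sub>R (w - z)" unfolding v_def y by (simp add: fun_eq_iff algebra_simps diff_divide_distrib)
  have vx: "v - x' = (1 / t) *\<^sub>R (w - z')"
    unfolding v_def z' y using t by (simp add: fun_eq_iff field_simps)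
  have sq: "ip n (a *\<^sub>R u) (a *\<^sub>R u) = a\<^sup>2 * ip n u u" for a u by (simp add: ip_simps power2_eq_square)
  have "F x' \<le> (1 - 1 / t) * F x + 1 / t * F w
      + L / 2 * ((1 / t)\<^sup>2 * ip n (w - z) (w - z) - (1 / t)\<^sup>2 * ip n (w - z') (w - z'))"
    using prox[of v] conv unfolding vy vx sq v_def[symmetric] by linarith
  moreover have "1 / t * F w \<le> 1 / t * c" using c t by (intro mult_left_mono) auto
  ultimately have "F x' \<le> (1 - 1 / t) * F x + 1 / t * c
      + L / 2 * ((1 / t)\<^sup>2 * ip n (w - z) (w - z) - (1 / t)\<^sup>2 * ip n (w - z') (w - z'))"
    by linarith
  then have "t\<^sup>2 * F x' \<le> t\<^sup>2 * ((1 - 1 / t) * F x + 1 / t * c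
      + L / 2 * ((1 / t)\<^sup>2 * ip n (w - z) (w - z) - (1 / t)\<^sup>2 * ip n (w - z') (w - z')))"
    by (intro mult_left_mono) auto
  also have "\<dots> = (t\<^sup>2 - t) * F x + t * c + L / 2 * (ip n (w - z) (w - z) - ip n (w - z') (w - z'))"
  proof -
    have r: "t\<^sup>2 * (1 / t)\<^sup>2 = 1" "t\<^sup>2 * (1 / t) = t" using t(1) by (simp_all add: power2_eq_square)
    have "t\<^sup>2 * ((1 - 1 / t) * P + 1 / t * c + L / 2 * ((1 / t)\<^sup>2 * D - (1 / t)\<^sup>2 * D'))
      = (t\<^sup>2 - t\<^sup>2 * (1 / t)) * P + t\<^sup>2 * (1 / t) * c + L / 2 * ((t\<^sup>2 * (1 / t)\<^sup>2) * D - (t\<^sup>2 * (1 / t)\<^sup>2) * D')"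
      for P D D' by (simp only: algebra_simps)
    then show ?thesis unfolding r by simp
  qed
  finally have "t\<^sup>2 * F x' \<le> t0\<^sup>2 * F x + (t\<^sup>2 - t0\<^sup>2) * c
      + L / 2 * (ip n (w - z) (w - z) - ip n (w - z') (w - z'))"
    using t(2) by (simp add: algebra_simps)
  then show ?thesis by (simp add: algebra_simps)
qed

section \<open>The pencil and the dual intervals\<close>

text \<open>All that the analysis needs about the instance, as inequalities between quadratic forms.
  The only spectral assumption is \<open>neg_eigenvector\<close>; it provides the direction to which
  the random vector must not be nearly orthogonal. \<open>x0\<close> is a solution of the
  constrained problem.\<close>

locale gtrs =
  fixes n :: nat and A0 A1 :: "(nat \<Rightarrow> real) \<Rightarrow> nat \<Rightarrow> real" and b0 b1 :: "nat \<Rightarrow> real"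
    and c0 c1 \<xi> \<zeta> \<gamma>h :: real and x0 :: "nat \<Rightarrow> real"
  assumes A0: "self_adjoint n A0" and A1: "self_adjoint n A1"
    and A0_bound: "\<bar>ip n w (A0 w)\<bar> \<le> ip n w w" and A1_bound: "\<bar>ip n w (A1 w)\<bar> \<le> ip n w w"
    and b0_bound: "\<bar>ip n b0 w\<bar> \<le> sqrt (ip n w w)" and b1_bound: "\<bar>ip n b1 w\<bar> \<le> sqrt (ip n w w)"
    and c1_bound: "\<bar>c1\<bar> \<le> 1"
    and \<xi>: "0 < \<xi>" "\<xi> \<le> 1" and \<zeta>: "1 \<le> \<zeta>" and \<gamma>h: "0 \<le> \<gamma>h"
    and hat: "\<xi> * ip n w w \<le> ip n w (A0 w + \<gamma>h *\<^sub>R A1 w)"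
    and \<zeta>_bound: "0 \<le> \<gamma> \<Longrightarrow> (\<And>w. 0 \<le> ip n w (A0 w + \<gamma> *\<^sub>R A1 w)) \<Longrightarrow> \<gamma> \<le> \<zeta>"
    and A0_neg: "\<exists>w. ip n w (A0 w) < 0"
    and neg_eigenvector: "ip n w (A0 w + \<gamma> *\<^sub>R A1 w) < 0 \<Longrightarrow>
      \<exists>u l. ip n u u = 1 \<and> l \<le> 0 \<and> (\<forall>y. ip n y (A0 u + \<gamma> *\<^sub>R A1 u) = l * ip n y u)"
    and x0_feasible: "qf n A1 b1 c1 x0 \<le> 0"
    and x0_optimal: "qf n A1 b1 c1 y \<le> 0 \<Longrightarrow> qf n A0 b0 c0 x0 \<le> qf n A0 b0 c0 y"
begin

section \<open>Dependence of the pencil on its parameter\<close>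

definition "\<kappa> = \<zeta> / \<xi>"

definition A :: "real \<Rightarrow> (nat \<Rightarrow> real) \<Rightarrow> nat \<Rightarrow> real" where "A \<gamma> w = A0 w + \<gamma> *\<^sub>R A1 w"

definition q :: "real \<Rightarrow> (nat \<Rightarrow> real) \<Rightarrow> real" where
  "q \<gamma> = qf n (A \<gamma>) (b0 + \<gamma> *\<^sub>R b1) (c0 + \<gamma> * c1)"

definition psd :: "real \<Rightarrow> bool" where "psd \<gamma> \<longleftrightarrow> (\<forall>w. 0 \<le> ip n w (A \<gamma> w))"

abbreviation "q0 \<equiv> qf n A0 b0 c0"
abbreviation "q1 \<equiv> qf n A1 b1 c1"

lemma q_eq: "q \<gamma> x = q0 x + \<gamma> * q1 x"
  by (simp add: q_def qf_def A_def ip_simps algebra_simps)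

lemma form_eq: "ip n w (A \<gamma> w) = ip n w (A0 w) + \<gamma> * ip n w (A1 w)"
  by (simp add: A_def ip_simps)

lemma A_self_adjoint: "self_adjoint n (A \<gamma>)"
  using self_adjoint_add_scale[OF A0 A1, of 1 \<gamma>] by (simp add: A_def[abs_def])

lemma form_upper: "ip n w (A \<gamma> w) \<le> (1 + \<bar>\<gamma>\<bar>) * ip n w w"
proof -
  have "\<gamma> * ip n w (A1 w) \<le> \<bar>\<gamma>\<bar> * \<bar>ip n w (A1 w)\<bar>" by (metis abs_ge_self abs_mult)
  also have "\<dots> \<le> \<bar>\<gamma>\<bar> * ip n w w" using A1_bound[of w] by (intro mult_left_mono) auto
  finally show ?thesis unfolding form_eq using A0_bound[of w] by (simp add: algebra_simps)
qed

lemma hat_form: "\<xi> * ip n w w \<le> ip n w (A \<gamma>h w)"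
  using hat by (simp add: A_def)

lemma \<kappa>_ge_1: "1 \<le> \<kappa>"
  using \<xi> \<zeta> by (simp add: \<kappa>_def)

lemma psd_hat: "psd \<gamma>h"
  unfolding psd_def
proof
  fix w
  have "0 \<le> \<xi> * ip n w w" using \<xi> by simp
  then show "0 \<le> ip n w (A \<gamma>h w)" using hat_form[of w] by linarith
qed

lemma form_interpolate:
  assumes "\<gamma> = (1 - \<theta>) * \<alpha> + \<theta> * \<beta>"
  shows "ip n w (A \<gamma> w) = (1 - \<theta>) * ip n w (A \<alpha> w) + \<theta> * ip n w (A \<beta> w)"
  unfolding form_eq assms by (simp add: algebra_simps)

lemma psd_between:
  assumes "psd \<alpha>" "psd \<beta>" "\<alpha> \<le> \<gamma>" "\<gamma> \<le> \<beta>"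
  shows "psd \<gamma>"
proof (cases "\<alpha> = \<beta>")
  case False
  define \<theta> where "\<theta> = (\<gamma> - \<alpha>) / (\<beta> - \<alpha>)"
  have "\<theta> * (\<beta> - \<alpha>) = \<gamma> - \<alpha>" using False by (simp add: \<theta>_def)
  then have "\<theta> * \<beta> - \<theta> * \<alpha> = \<gamma> - \<alpha>" by (simp add: right_diff_distrib)
  then have *: "0 \<le> \<theta>" "\<theta> \<le> 1" "\<gamma> = (1 - \<theta>) * \<alpha> + \<theta> * \<beta>"
    using assms False by (simp_all add: \<theta>_def divide_le_eq left_diff_distrib)
  show ?thesis unfolding psd_def form_interpolate[OF *(3)]
    using assms(1,2) * unfolding psd_def by (intro allI add_nonneg_nonneg mult_nonneg_nonneg) auto
qed (use assms in auto)

lemma not_psd_0: "\<not> psd 0"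
  using A0_neg unfolding psd_def form_eq by (auto simp: not_le)

lemma psd_pos: "psd \<gamma> \<Longrightarrow> 0 < \<gamma>"
  using psd_between[of \<gamma> \<gamma>h 0] psd_hat not_psd_0 \<gamma>h by force

lemma psd_le_\<zeta>: "psd \<gamma> \<Longrightarrow> \<gamma> \<le> \<zeta>"
  using \<zeta>_bound[of \<gamma>] psd_pos[of \<gamma>] by (auto simp: psd_def A_def)

lemma hat_le_\<zeta>: "\<gamma>h \<le> \<zeta>"
  using psd_le_\<zeta> psd_hat by blast

text \<open>Distances from \<open>\<gamma>h\<close> in the direction \<sigma> = 1 or \<sigma> = -1:
  both ends of the interval become the supremum of a downward closed set of r \<ge> 0, and one
  search program finds either.\<close>

definition Psd :: "real \<Rightarrow> real \<Rightarrow> bool" where "Psd \<sigma> r \<longleftrightarrow> psd (\<gamma>h + \<sigma> * r)"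

lemma Psd_0: "Psd \<sigma> 0"
  by (simp add: Psd_def psd_hat)

lemma Psd_le:
  assumes "Psd \<sigma> r" "\<sigma> = 1 \<or> \<sigma> = -1" "0 \<le> r"
  shows "r \<le> \<zeta>"
  using assms psd_le_\<zeta>[of "\<gamma>h + \<sigma> * r"] psd_pos[of "\<gamma>h + \<sigma> * r"] \<gamma>h hat_le_\<zeta> unfolding Psd_def by auto

lemma Psd_mono:
  assumes "Psd \<sigma> r" "0 \<le> r'" "r' \<le> r" "\<sigma> = 1 \<or> \<sigma> = -1"
  shows "Psd \<sigma> r'"
  using assms psd_between[of "\<gamma>h" "\<gamma>h + r" "\<gamma>h + r'"] psd_between[of "\<gamma>h - r" "\<gamma>h" "\<gamma>h - r'"] psd_hat
  unfolding Psd_def by auto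

text \<open>By linearity in the parameter, the form at distance r is an interpolation between the
  one at \<open>\<gamma>h\<close>, which is at least \<xi>, and the one at r + h, which is
  nonnegative. The first has weight h/(r + h) \<ge> h/\<zeta>, which gives \<xi> h/\<zeta> =
  h/\<kappa>. This is the eigenvalue gap on which the tests rely.\<close>

lemma form_lower_if_Psd:
  assumes "Psd \<sigma> (r + h)" "\<sigma> = 1 \<or> \<sigma> = -1" "0 \<le> r" "0 < h"
  shows "h / \<kappa> * ip n w w \<le> ip n w (A (\<gamma>h + \<sigma> * r) w)"
proof -
  define \<theta> where "\<theta> = r / (r + h)"
  have "\<theta> * (r + h) = r" using assms by (simp add: \<theta>_def)
  then have "\<theta> * (\<sigma> * (r + h)) = \<sigma> * r" by (metis mult.left_commute)
  moreover have "(1 - \<theta>) * \<gamma>h + \<theta> * (\<gamma>h + \<sigma> * (r + h)) = \<gamma>h + \<theta> * (\<sigma> * (r + h))"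
    by (simp add: distrib_left left_diff_distrib)
  ultimately have *: "\<gamma>h + \<sigma> * r = (1 - \<theta>) * \<gamma>h + \<theta> * (\<gamma>h + \<sigma> * (r + h))"
    by linarith
  have \<theta>: "0 \<le> \<theta>" "\<theta> \<le> 1" using assms by (auto simp: \<theta>_def)
  have rh: "r + h \<le> \<zeta>" using Psd_le[OF assms(1,2)] assms by simp
  have "h / \<kappa> = \<xi> * (h / \<zeta>)" by (simp add: \<kappa>_def)
  also have "\<dots> \<le> \<xi> * (1 - \<theta>)"
  proof (rule mult_left_mono)
    have "1 - \<theta> = h / (r + h)" using assms by (simp add: \<theta>_def field_simps)
    also have "\<dots> \<ge> h / \<zeta>" using rh assms \<zeta> by (intro divide_left_mono mult_pos_pos) auto
    finally show "h / \<zeta> \<le> 1 - \<theta>" .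
  qed (use \<xi> in simp)
  finally have "h / \<kappa> * ip n w w \<le> \<xi> * (1 - \<theta>) * ip n w w"
    by (intro mult_right_mono) auto
  also have "\<dots> \<le> (1 - \<theta>) * ip n w (A \<gamma>h w)"
    using hat_form[of w] \<theta> mult_left_mono[of "\<xi> * ip n w w" "ip n w (A \<gamma>h w)" "1 - \<theta>"] by (simp add: mult_ac)
  also have "\<dots> \<le> ip n w (A (\<gamma>h + \<sigma> * r) w)"
    unfolding form_interpolate[OF *] using assms(1) \<theta> by (simp add: Psd_def psd_def)
  finally show ?thesis .
qed

text \<open>Along w the function q(\<gamma>, .) is concave, so it does not increase in at least one
  of the two directions. Along w, \<open>s * q1\<close> is nonnegative at the start and tends to
  minus infinity on both sides, so the boundary is met in either direction; there q(\<gamma>, .)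
  coincides with q0.\<close>

lemma reach_boundary:
  assumes w: "ip n w (A \<gamma> w) \<le> 0" "s * ip n w (A1 w) < 0" and s: "s = 1 \<or> s = -1" and x: "0 \<le> s * q1 x"
  shows "\<exists>y. q1 y = 0 \<and> q0 y \<le> q0 x + \<gamma> * q1 x"
proof -
  define \<alpha> where "\<alpha> = - s * ip n w (A1 w)"
  define \<beta> where "\<beta> = - s * ip n (A1 x + b1) w"
  define c where "c = s * q1 x"
  define S where "S = sqrt (\<beta>\<^sup>2 + \<alpha> * c)"
  define g where "g = ip n (2 *\<^sub>R (A \<gamma> x + (b0 + \<gamma> *\<^sub>R b1))) w"
  have \<alpha>: "0 < \<alpha>" and c: "0 \<le> c" using w x by (auto simp: \<alpha>_def c_def)
  have S2: "S * S = \<beta>\<^sup>2 + \<alpha> * c" using \<alpha> c unfolding S_def by simp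
  have S: "\<bar>\<beta>\<bar> \<le> S" unfolding S_def using \<alpha> c by (simp add: real_le_rsqrt)
  have q1: "q1 (x + t *\<^sub>R w) = - s * (\<alpha> * t\<^sup>2 + 2 * \<beta> * t - c)" for t
    unfolding qf_shift[OF A1] self_adjointD(3)[OF A1] ip_scale_left ip_scale_right \<alpha>_def \<beta>_def c_def
    using s by (auto simp: power2_eq_square algebra_simps)
  have q\<gamma>: "q \<gamma> (x + t *\<^sub>R w) \<le> q \<gamma> x + t * g" for t
  proof -
    have "q \<gamma> (x + t *\<^sub>R w) = q \<gamma> x + t * g + t * (t * ip n w (A \<gamma> w))"
      unfolding q_def qf_shift[OF A_self_adjoint] self_adjointD(3)[OF A_self_adjoint] g_def
        ip_scale_right ip_scale_left by simp
    moreover have "t * (t * ip n w (A \<gamma> w)) \<le> 0"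
      using w(1) mult_nonneg_nonpos[of "t * t" "ip n w (A \<gamma> w)"] by (simp add: mult.assoc)
    ultimately show ?thesis by linarith
  qed
  \<comment> \<open>Because of \<bar>\<beta>\<bar> \<le> S the first root is nonnegative and the
    second nonpositive, so the sign of t can be chosen against the slope g.\<close>
  define t where "t = (if g \<le> 0 then (S - \<beta>) / \<alpha> else (- S - \<beta>) / \<alpha>)"
  have "t * g \<le> 0" using S \<alpha> by (auto simp: t_def mult_le_0_iff divide_le_0_iff zero_le_divide_iff)
  moreover have "\<alpha> * t\<^sup>2 + 2 * \<beta> * t - c = 0"
  proof -
    have "\<alpha> * t + \<beta> = S \<or> \<alpha> * t + \<beta> = - S" using \<alpha> by (simp add: t_def)
    then have "(\<alpha> * t + \<beta>) * (\<alpha> * t + \<beta>) = \<beta>\<^sup>2 + \<alpha> * c" using S2 by auto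
    then have "\<alpha> * (\<alpha> * t\<^sup>2 + 2 * \<beta> * t - c) = 0" by (simp add: power2_eq_square algebra_simps)
    then show ?thesis using \<alpha> by simp
  qed
  ultimately have "q1 (x + t *\<^sub>R w) = 0" "q \<gamma> (x + t *\<^sub>R w) \<le> q \<gamma> x"
    using q1[of t] q\<gamma>[of t] by auto
  then show ?thesis unfolding q_eq by auto
qed

lemma opt_le_upper:
  assumes "\<not> psd \<gamma>" "\<gamma>h \<le> \<gamma>" "0 \<le> q1 x"
  shows "q0 x0 \<le> q \<gamma> x"
proof -
  from assms(1) obtain w where w: "ip n w (A \<gamma> w) < 0" by (auto simp: psd_def not_le)
  \<comment> \<open>Positivity at \<open>\<gamma>h\<close> fixes the sign of the form of A1 at w,
    and thereby the side from which the boundary is reached along w.\<close>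
  have "0 \<le> ip n w (A \<gamma>h w)" using psd_hat by (simp add: psd_def)
  then have "(\<gamma> - \<gamma>h) * ip n w (A1 w) < 0" using w unfolding form_eq by (simp add: algebra_simps)
  then have "ip n w (A1 w) < 0" using assms(2) by (auto simp: mult_less_0_iff)
  then obtain y where "q1 y = 0" "q0 y \<le> q0 x + \<gamma> * q1 x"
    using reach_boundary[of w \<gamma> 1 x] w assms(3) by auto
  then show ?thesis using x0_optimal[of y] by (simp add: q_eq)
qed

lemma opt_le_lower:
  assumes "\<not> psd \<gamma>" "\<gamma> \<le> \<gamma>h" "q1 x \<le> 0"
  shows "q0 x0 \<le> q \<gamma> x"
proof -
  from assms(1) obtain w where w: "ip n w (A \<gamma> w) < 0" by (auto simp: psd_def not_le)
  have "0 \<le> ip n w (A \<gamma>h w)" using psd_hat by (simp add: psd_def)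
  then have "(\<gamma> - \<gamma>h) * ip n w (A1 w) < 0" using w unfolding form_eq by (simp add: algebra_simps)
  then have "0 < ip n w (A1 w)" using assms(2) by (auto simp: mult_less_0_iff)
  then obtain y where "q1 y = 0" "q0 y \<le> q0 x + \<gamma> * q1 x"
    using reach_boundary[of w \<gamma> "-1" x] w assms(3) by auto
  then show ?thesis using x0_optimal[of y] by (simp add: q_eq)
qed

section \<open>A priori bounds on the optimum and on near-optimal points\<close>

lemma opt_upper: "q0 x0 \<le> c0 + 2 * \<zeta>"
proof (cases "0 \<le> c1")
  case True
  \<comment> \<open>No feasible point is known if \<open>c1\<close> > 0, but the origin lies on the
    side q1 \<ge> 0 and 2 \<zeta> lies beyond the interval, so the upper outer inequality at the
    origin bounds Opt. The other case uses the parameter 0, which lies below the interval.\<close>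
  have "\<not> psd (2 * \<zeta>)" using psd_le_\<zeta>[of "2 * \<zeta>"] \<zeta> by auto
  moreover have "q1 0 = c1" "q0 0 = c0" by (simp_all only: qf_def ip_simps)
  ultimately have "q0 x0 \<le> c0 + 2 * \<zeta> * c1"
    using opt_le_upper[of "2 * \<zeta>" 0] True hat_le_\<zeta> \<zeta> by (simp add: q_eq)
  moreover have "2 * \<zeta> * c1 \<le> 2 * \<zeta> * 1" using c1_bound \<zeta> by (intro mult_left_mono) auto
  ultimately show ?thesis by simp
next
  case False
  moreover have "q1 0 = c1" "q0 0 = c0" by (simp_all only: qf_def ip_simps)
  ultimately show ?thesis using opt_le_lower[of 0 0] not_psd_0 \<gamma>h \<zeta> by (simp add: q_eq)
qed

text \<open>Coercivity \<xi> |x|^2 competes with linear terms of size \<zeta> |x|, whence the radius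
  5 \<kappa>. The slack \<kappa> \<zeta>/8 leaves room for the error \<epsilon>/8 of the descent
  method, since \<epsilon> \<le> \<kappa> \<zeta>.\<close>

lemma norm_bound:
  assumes "q \<gamma>h x \<le> c0 + 2 * \<zeta> + \<kappa> * \<zeta> / 8"
  shows "ip n x x \<le> 25 * \<kappa>\<^sup>2"
proof -
  define r where "r = sqrt (ip n x x)"
  have r: "0 \<le> r" "ip n x x = r * r" by (simp_all add: r_def)
  have "\<bar>\<gamma>h * ip n b1 x\<bar> \<le> \<zeta> * r"
    unfolding abs_mult using b1_bound[of x, folded r_def] \<gamma>h hat_le_\<zeta> r(1) by (intro mult_mono) auto
  moreover have "\<bar>ip n b0 x\<bar> \<le> \<zeta> * r"
    using b0_bound[of x, folded r_def] mult_right_mono[of 1 \<zeta> r] \<zeta> r(1) by linarith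
  moreover have "\<bar>\<gamma>h * c1\<bar> \<le> \<zeta> * 1"
    unfolding abs_mult using c1_bound \<gamma>h hat_le_\<zeta> by (intro mult_mono) auto
  moreover have "q \<gamma>h x = ip n x (A \<gamma>h x) + 2 * (ip n b0 x + \<gamma>h * ip n b1 x) + c0 + \<gamma>h * c1"
    by (simp add: q_def qf_def ip_simps)
  ultimately have main: "\<xi> * (r * r) \<le> 4 * (\<zeta> * r) + 3 * \<zeta> + \<kappa> * \<zeta> / 8"
    using assms hat_form[of x] unfolding r(2) abs_le_iff by argo
  have "r \<le> 5 * \<kappa>"
  proof (rule ccontr)
    assume "\<not> r \<le> 5 * \<kappa>"
    then have gt: "5 * \<kappa> < r" by simp
    have "5 * \<zeta> \<le> \<xi> * r" using gt \<xi> by (simp add: \<kappa>_def field_simps)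
    then have "5 * \<zeta> * r \<le> \<xi> * r * r" using r(1) by (intro mult_right_mono) auto
    with main have "\<zeta> * r \<le> \<zeta> * (3 + \<kappa> / 8)" by (simp add: algebra_simps)
    then have "r \<le> 3 + \<kappa> / 8" using \<zeta> by simp
    then show False using gt \<kappa>_ge_1 by linarith
  qed
  then have "r * r \<le> (5 * \<kappa>) * (5 * \<kappa>)" using r(1) by (intro mult_mono) auto
  then show ?thesis unfolding r(2) by (simp add: power2_eq_square)
qed

lemma q1_bound:
  assumes "ip n x x \<le> 25 * \<kappa>\<^sup>2"
  shows "\<bar>q1 x\<bar> \<le> 36 * \<kappa>\<^sup>2"
proof -
  have "ip n x x \<le> (5 * \<kappa>)\<^sup>2" using assms by (simp add: power_mult_distrib)
  then have "sqrt (ip n x x) \<le> 5 * \<kappa>" using \<kappa>_ge_1 by (intro real_le_lsqrt) auto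
  then have "\<bar>q1 x\<bar> \<le> 25 * \<kappa>\<^sup>2 + 2 * (5 * \<kappa>) + 1"
    using A1_bound[of x] b1_bound[of x] c1_bound assms unfolding qf_def by linarith
  also have "\<dots> \<le> 36 * \<kappa>\<^sup>2"
  proof -
    have "\<kappa> \<le> \<kappa> * \<kappa>" using \<kappa>_ge_1 mult_left_mono[of 1 \<kappa> \<kappa>] by simp
    then show ?thesis using \<kappa>_ge_1 unfolding power2_eq_square by linarith
  qed
  finally show ?thesis .
qed

section \<open>Transfer from the inner to the outer parameters\<close>

lemma q_between:
  assumes "\<alpha> \<le> \<gamma>" "\<gamma> \<le> \<beta>"
  shows "q \<gamma> x \<le> max (q \<alpha> x) (q \<beta> x)"
proof (cases "0 \<le> q1 x")
  case True
  then have "\<gamma> * q1 x \<le> \<beta> * q1 x" using assms by (intro mult_right_mono)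
  then show ?thesis unfolding q_eq by simp
next
  case False
  then have "\<gamma> * q1 x \<le> \<alpha> * q1 x" using assms by (intro mult_right_mono_neg) auto
  then show ?thesis unfolding q_eq by simp
qed

lemma q_x0_le: "0 \<le> \<gamma> \<Longrightarrow> q \<gamma> x0 \<le> q0 x0"
  using x0_feasible by (simp add: q_eq mult_nonneg_nonpos)

lemma x0_bound: "ip n x0 x0 \<le> 25 * \<kappa>\<^sup>2"
proof (rule norm_bound)
  have "0 \<le> \<kappa> * \<zeta> / 8" using \<kappa>_ge_1 \<zeta> by simp
  then show "q \<gamma>h x0 \<le> c0 + 2 * \<zeta> + \<kappa> * \<zeta> / 8"
    using q_x0_le[OF \<gamma>h] opt_upper by linarith
qed

lemma outer_opt_le:
  assumes "\<not> psd \<gamma>m'" "\<not> psd \<gamma>p'" "\<gamma>m' \<le> \<gamma>h" "\<gamma>h \<le> \<gamma>p'"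
  shows "q0 x0 \<le> max (q \<gamma>m' z) (q \<gamma>p' z)"
  using opt_le_upper[of \<gamma>p' z] opt_le_lower[of \<gamma>m' z] assms by (cases "0 \<le> q1 z") auto

text \<open>As \<open>\<gamma>h\<close> lies between the inner parameters, x is in the sublevel set
  of \<open>norm_bound\<close>. Moving a parameter by 4 \<delta> changes its quadratic by at most 4
  \<delta> 36 \<kappa>^2, which is at most \<epsilon>/4 by the constant 1000 in \<delta>; with the
  error \<epsilon>/8 the sum stays below \<epsilon>/2.\<close>

lemma outer_value_le:
  assumes "\<gamma>m \<le> \<gamma>h" "\<gamma>h \<le> \<gamma>p" "\<gamma>m' \<le> \<gamma>m" "\<gamma>p \<le> \<gamma>p'"
    and "\<gamma>m - \<gamma>m' \<le> 4 * \<delta>" "\<gamma>p' - \<gamma>p \<le> 4 * \<delta>"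
    and x: "max (q \<gamma>m x) (q \<gamma>p x) \<le> q0 x0 + \<epsilon> / 8"
    and \<epsilon>: "\<epsilon> \<le> \<kappa> * \<zeta>" "0 < \<epsilon>" and \<delta>: "\<delta> = \<epsilon> / (1000 * \<kappa>\<^sup>2)"
  shows "max (q \<gamma>m' x) (q \<gamma>p' x) \<le> q0 x0 + \<epsilon> / 2"
proof -
  have "ip n x x \<le> 25 * \<kappa>\<^sup>2"
    using norm_bound[of x] q_between[OF assms(1,2), of x] x opt_upper \<epsilon> by linarith
  then have q1: "\<bar>q1 x\<bar> \<le> 36 * \<kappa>\<^sup>2" by (rule q1_bound)
  have "0 < \<delta>" using \<delta> \<epsilon> \<kappa>_ge_1 by simp
  have "4 * \<delta> * \<bar>q1 x\<bar> \<le> 4 * \<delta> * (36 * \<kappa>\<^sup>2)"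
    using q1 \<open>0 < \<delta>\<close> by (intro mult_left_mono) auto
  also have "\<dots> \<le> \<epsilon> / 4" unfolding \<delta> using \<kappa>_ge_1 \<epsilon> by (simp add: field_simps)
  finally have small: "4 * \<delta> * \<bar>q1 x\<bar> \<le> \<epsilon> / 4" .
  have "q \<alpha> x \<le> q \<beta> x + \<epsilon> / 4" if "\<bar>\<alpha> - \<beta>\<bar> \<le> 4 * \<delta>" for \<alpha> \<beta>
  proof -
    have "(\<alpha> - \<beta>) * q1 x \<le> \<bar>\<alpha> - \<beta>\<bar> * \<bar>q1 x\<bar>" by (metis abs_ge_self abs_mult)
    also have "\<dots> \<le> 4 * \<delta> * \<bar>q1 x\<bar>" using that by (intro mult_right_mono) auto
    finally show ?thesis using small by (simp add: q_eq algebra_simps)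
  qed
  from this[of \<gamma>m' \<gamma>m] this[of \<gamma>p' \<gamma>p] show ?thesis using assms(3-6) x \<epsilon> by auto
qed

end

section \<open>The random starting vector\<close>

lemma prob_space_tape: "prob_space tape_measure"
  unfolding tape_measure_def
  by (intro prob_space_PiM prob_space_normal_density) simp

lemma space_tape [simp]: "space tape_measure = UNIV"
  by (simp add: tape_measure_def space_PiM)

lemma measurable_tape_coordinate [measurable]: "(\<lambda>\<omega>. \<omega> i) \<in> borel_measurable tape_measure"
  unfolding tape_measure_def by measurable

lemma tape_component: "distr tape_measure borel (\<lambda>\<omega>. \<omega> i) = std_normal_distribution"
proof -
  have "distr tape_measure borel (\<lambda>\<omega>. \<omega> i) = distr tape_measure std_normal_distribution (\<lambda>\<omega>. \<omega> i)"
    by (intro distr_cong) auto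
  also have "\<dots> = std_normal_distribution"
    unfolding tape_measure_def
    by (rule distr_PiM_component) (auto intro!: prob_space_normal_density)
  finally show ?thesis .
qed

lemma tape_component_distributed: "distributed tape_measure lborel (\<lambda>\<omega>. \<omega> i) std_normal_density"
proof -
  have "distr tape_measure lborel (\<lambda>\<omega>. \<omega> i) = std_normal_distribution"
    unfolding tape_component[of i, symmetric] by (intro distr_cong) auto
  then show ?thesis by (simp add: distributed_def)
qed

lemma tape_indep:
  assumes "finite I" "I \<noteq> {}"
  shows "prob_space.indep_vars tape_measure (\<lambda>_. borel) (\<lambda>i \<omega>. \<omega> i) I"
proof -
  interpret prob_space tape_measure by (rule prob_space_tape)
  interpret P: product_prob_space "\<lambda>_. std_normal_distribution" "UNIV :: nat set"
    by (intro product_prob_spaceI prob_space_normal_density) simp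
  have "distr tape_measure (Pi\<^sub>M I (\<lambda>_. borel)) (\<lambda>x. \<lambda>i\<in>I. x i)
      = distr tape_measure (Pi\<^sub>M I (\<lambda>_. std_normal_distribution)) (\<lambda>x. restrict x I)"
    by (intro distr_cong) (auto intro!: sets_PiM_cong)
  also have "\<dots> = Pi\<^sub>M I (\<lambda>_. std_normal_distribution)"
    unfolding tape_measure_def using P.distr_PiM_restrict_finite[OF assms(1)] by simp
  finally show ?thesis
    by (subst indep_vars_iff_distr_eq_PiM'[OF assms(2)]) (simp_all add: tape_component)
qed

lemma tape_ip_distributed:
  assumes "ip n u u = 1"
  shows "distributed tape_measure lborel (ip n u) std_normal_density"
proof -
  interpret prob_space tape_measure by (rule prob_space_tape)
  \<comment> \<open>Coordinates with \<open>u i = 0\<close> are dropped, since a normal density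
    needs a positive standard deviation.\<close>
  define I where "I = {i. i < n \<and> u i \<noteq> 0}"
  have fin: "finite I" by (simp add: I_def)
  have norm: "(\<Sum>i\<in>I. \<bar>u i\<bar>\<^sup>2) = 1"
  proof -
    have "(\<Sum>i\<in>I. \<bar>u i\<bar>\<^sup>2) = (\<Sum>i<n. u i * u i)"
      unfolding I_def by (intro sum.mono_neutral_cong_left) (auto simp: power2_eq_square)
    then show ?thesis using assms by (simp add: ip_def)
  qed
  have ne: "I \<noteq> {}" using norm by (intro notI) simp
  have "distributed tape_measure lborel (\<lambda>x. \<Sum>i\<in>I. 0 + u i * x i)
      (normal_density (\<Sum>i\<in>I. 0 + u i * 0) (sqrt (\<Sum>i\<in>I. (\<bar>u i\<bar> * 1)\<^sup>2)))"
  proof (rule sum_indep_normal[OF fin ne])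
    show "indep_vars (\<lambda>i. borel) (\<lambda>i x. 0 + u i * x i) I"
      using indep_vars_compose2[OF tape_indep[OF fin ne], of "\<lambda>i y. 0 + u i * y" "\<lambda>_. borel"] by simp
    show "distributed tape_measure lborel (\<lambda>x. 0 + u i * x i) (normal_density (0 + u i * 0) (\<bar>u i\<bar> * 1))"
      if "i \<in> I" for i
      using that by (intro normal_density_affine tape_component_distributed) (auto simp: I_def)
  qed (auto simp: I_def)
  moreover have "(\<lambda>x. \<Sum>i\<in>I. 0 + u i * x i) = ip n u"
    unfolding I_def ip_def by (intro ext sum.mono_neutral_cong_left) auto
  ultimately show ?thesis using norm by simp
qed

lemma measurable_ip [measurable]: "ip n u \<in> borel_measurable tape_measure"
  unfolding ip_def by measurable

lemma measurable_ip_self [measurable]: "(\<lambda>\<omega>. ip n \<omega> \<omega>) \<in> borel_measurable tape_measure"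
  unfolding ip_def by measurable

lemma tape_ip_anticoncentration:
  assumes "ip n u u = 1" "0 \<le> t"
  shows "measure tape_measure {\<omega>. \<bar>ip n u \<omega>\<bar> \<le> t} \<le> t"
proof -
  interpret prob_space tape_measure by (rule prob_space_tape)
  have "emeasure tape_measure (ip n u -` {-t..t} \<inter> space tape_measure)
      = (\<integral>\<^sup>+x. ennreal (std_normal_density x) * indicator {-t..t} x \<partial>lborel)"
    by (rule distributed_emeasure[OF tape_ip_distributed[OF assms(1)]]) simp
  also have "\<dots> \<le> (\<integral>\<^sup>+x. ennreal (1 / 2) * indicator {-t..t} x \<partial>lborel)"
  proof (intro nn_integral_mono mult_right_mono ennreal_leI)
    fix x :: real
    have "sqrt 4 \<le> sqrt (2 * pi)" using pi_ge_two by (intro real_sqrt_le_mono) linarith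
    then have "1 / sqrt (2 * pi) \<le> 1 / 2" by (simp add: field_simps)
    then have "1 / sqrt (2 * pi) * exp (- x\<^sup>2 / 2) \<le> 1 / 2 * 1" by (intro mult_mono) auto
    then show "std_normal_density x \<le> 1 / 2" by (simp add: std_normal_density_def)
  qed auto
  also have "\<dots> = ennreal (1 / 2) * ennreal (2 * t)"
    using assms(2) by (subst nn_integral_cmult_indicator) auto
  also have "\<dots> = ennreal t" using assms(2) by (subst ennreal_mult[symmetric]) auto
  finally have "emeasure tape_measure (ip n u -` {-t..t} \<inter> space tape_measure) \<le> ennreal t" .
  moreover have "ip n u -` {-t..t} \<inter> space tape_measure = {\<omega>. \<bar>ip n u \<omega>\<bar> \<le> t}" by auto
  ultimately show ?thesis
    using assms(2) by (simp add: emeasure_eq_measure)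
qed

lemma tape_norm_tail:
  assumes "0 < s" "0 < n"
  shows "measure tape_measure {\<omega>. real n * s \<le> ip n \<omega> \<omega>} \<le> 1 / s"
proof -
  interpret prob_space tape_measure by (rule prob_space_tape)
  have int: "integrable tape_measure (\<lambda>\<omega>. (\<omega> i)\<^sup>2)" for i
    using distributed_integrable[OF tape_component_distributed[of i], of "\<lambda>x. x\<^sup>2"]
      integrable_std_normal_moment[of 2] by simp
  have E: "(\<integral>\<omega>. (\<omega> i)\<^sup>2 \<partial>tape_measure) = 1" for i
    using distributed_integral[OF tape_component_distributed[of i], of "\<lambda>x. x\<^sup>2"]
      integral_std_normal_moment_even[of 1] by (simp add: fact_numeral)
  have sq: "ip n \<omega> \<omega> = (\<Sum>i<n. (\<omega> i)\<^sup>2)" for \<omega> by (simp add: ip_def power2_eq_square)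
  have "measure tape_measure {\<omega> \<in> space tape_measure. real n * s \<le> ip n \<omega> \<omega>}
      \<le> (\<integral>\<omega>. ip n \<omega> \<omega> \<partial>tape_measure) / (real n * s)"
    using assms int by (intro integral_Markov_inequality_measure[where A = "{}"]) (auto simp: sq sum_nonneg)
  also have "(\<integral>\<omega>. ip n \<omega> \<omega> \<partial>tape_measure) = real n"
    using int by (simp add: sq E)
  finally show ?thesis using assms by simp
qed

text \<open>The event forces |\<omega>|^2 \<ge> 2n/p or |\<langle>u, \<omega>\<rangle>| \<le> p/2:
  otherwise its left side would be at least (4n/p^2)^2 (p/2)^2 = (2n/p)^2 \<ge> 2n/p > |\<omega>|^2.
  Markov's inequality and the density bound 1/2 give p/2 for each.\<close>

lemma tape_bad_event:
  assumes u: "ip n u u = 1" and p: "0 < p" "p \<le> 1" and n: "0 < n"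
  shows "measure tape_measure {\<omega>. (4 * real n / p\<^sup>2)\<^sup>2 * (ip n u \<omega>)\<^sup>2 \<le> ip n \<omega> \<omega>} \<le> p"
proof -
  interpret prob_space tape_measure by (rule prob_space_tape)
  have "{\<omega>. (4 * real n / p\<^sup>2)\<^sup>2 * (ip n u \<omega>)\<^sup>2 \<le> ip n \<omega> \<omega>}
      \<subseteq> {\<omega>. real n * (2 / p) \<le> ip n \<omega> \<omega>} \<union> {\<omega>. \<bar>ip n u \<omega>\<bar> \<le> p / 2}"
  proof
    fix \<omega> assume "\<omega> \<in> {\<omega>. (4 * real n / p\<^sup>2)\<^sup>2 * (ip n u \<omega>)\<^sup>2 \<le> ip n \<omega> \<omega>}"
    then have bad: "(4 * real n / p\<^sup>2)\<^sup>2 * (ip n u \<omega>)\<^sup>2 \<le> ip n \<omega> \<omega>" by simp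
    have "\<bar>ip n u \<omega>\<bar> \<le> p / 2" if "ip n \<omega> \<omega> < real n * (2 / p)"
    proof (rule ccontr)
      assume "\<not> \<bar>ip n u \<omega>\<bar> \<le> p / 2"
      then have "(p / 2)\<^sup>2 \<le> \<bar>ip n u \<omega>\<bar>\<^sup>2" using p by (intro power_mono) auto
      then have "(4 * real n / p\<^sup>2)\<^sup>2 * (p / 2)\<^sup>2 \<le> (4 * real n / p\<^sup>2)\<^sup>2 * (ip n u \<omega>)\<^sup>2"
        by (intro mult_left_mono) auto
      moreover have "(4 * real n / p\<^sup>2)\<^sup>2 * (p / 2)\<^sup>2 = (real n * (2 / p)) * (real n * (2 / p))"
        using p by (simp add: power2_eq_square)
      moreover have "real n * (2 / p) * 1 \<le> (real n * (2 / p)) * (real n * (2 / p))"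
      proof (intro mult_left_mono)
        have "1 * 1 \<le> real n * (2 / p)" using n p by (intro mult_mono) (auto simp: field_simps)
        then show "1 \<le> real n * (2 / p)" by simp
      qed (use p in auto)
      ultimately show False using bad that by linarith
    qed
    then show "\<omega> \<in> {\<omega>. real n * (2 / p) \<le> ip n \<omega> \<omega>} \<union> {\<omega>. \<bar>ip n u \<omega>\<bar> \<le> p / 2}"
      by force
  qed
  moreover have m: "{\<omega>. real n * (2 / p) \<le> ip n \<omega> \<omega>} \<in> events" "{\<omega>. \<bar>ip n u \<omega>\<bar> \<le> p / 2} \<in> events"
  proof -
    have "{\<omega> \<in> space tape_measure. real n * (2 / p) \<le> ip n \<omega> \<omega>} \<in> events" by measurable
    then show "{\<omega>. real n * (2 / p) \<le> ip n \<omega> \<omega>} \<in> events" by simp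
    have "{\<omega> \<in> space tape_measure. \<bar>ip n u \<omega>\<bar> \<le> p / 2} \<in> events" by measurable
    then show "{\<omega>. \<bar>ip n u \<omega>\<bar> \<le> p / 2} \<in> events" by simp
  qed
  ultimately have "prob {\<omega>. (4 * real n / p\<^sup>2)\<^sup>2 * (ip n u \<omega>)\<^sup>2 \<le> ip n \<omega> \<omega>}
      \<le> prob ({\<omega>. real n * (2 / p) \<le> ip n \<omega> \<omega>} \<union> {\<omega>. \<bar>ip n u \<omega>\<bar> \<le> p / 2})"
    by (intro finite_measure_mono) auto
  also have "\<dots> \<le> prob {\<omega>. real n * (2 / p) \<le> ip n \<omega> \<omega>} + prob {\<omega>. \<bar>ip n u \<omega>\<bar> \<le> p / 2}"
    using m by (rule measure_Un_le)
  also have "\<dots> \<le> 1 / (2 / p) + p / 2"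
    using p n u by (intro add_mono tape_norm_tail tape_ip_anticoncentration) auto
  finally show ?thesis using p by simp
qed

lemma tape_good_event:
  assumes fin: "finite K" and u: "\<And>k. k \<in> K \<Longrightarrow> ip n (u k) (u k) = 1"
    and p: "\<And>k. k \<in> K \<Longrightarrow> 0 < pr k \<and> pr k \<le> 1" "(\<Sum>k\<in>K. pr k) \<le> p" and n: "0 < n"
  shows "\<exists>E\<in>sets tape_measure. 1 - p \<le> measure tape_measure E \<and>
    (\<forall>\<omega>\<in>E. \<forall>k\<in>K. ip n \<omega> \<omega> < (4 * real n / (pr k)\<^sup>2)\<^sup>2 * (ip n (u k) \<omega>)\<^sup>2)"
proof -
  interpret prob_space tape_measure by (rule prob_space_tape)
  define bad where "bad k = {\<omega>. (4 * real n / (pr k)\<^sup>2)\<^sup>2 * (ip n (u k) \<omega>)\<^sup>2 \<le> ip n \<omega> \<omega>}" for k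
  have bad: "bad k \<in> events" for k
  proof -
    have "{\<omega> \<in> space tape_measure. (4 * real n / (pr k)\<^sup>2)\<^sup>2 * (ip n (u k) \<omega>)\<^sup>2 \<le> ip n \<omega> \<omega>} \<in> events"
      by measurable
    then show ?thesis by (simp add: bad_def)
  qed
  have "prob (\<Union>k\<in>K. bad k) \<le> (\<Sum>k\<in>K. prob (bad k))"
    using bad by (intro finite_measure_subadditive_finite fin) auto
  also have "\<dots> \<le> (\<Sum>k\<in>K. pr k)"
    unfolding bad_def using u p n by (intro sum_mono tape_bad_event) auto
  finally have "prob (\<Union>k\<in>K. bad k) \<le> p" using p(2) by linarith
  moreover have "(\<Union>k\<in>K. bad k) \<in> events" using bad fin by auto
  ultimately have "1 - p \<le> prob (space tape_measure - (\<Union>k\<in>K. bad k))"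
    by (subst prob_compl) auto
  moreover have "space tape_measure - (\<Union>k\<in>K. bad k) \<in> events"
    using \<open>(\<Union>k\<in>K. bad k) \<in> events\<close> by (rule sets.compl_sets)
  ultimately show ?thesis
    by (intro bexI[of _ "space tape_measure - (\<Union>k\<in>K. bad k)"]) (auto simp: bad_def not_le)
qed

section \<open>Reasoning about programs\<close>

text \<open>Since runs are deterministic, one halting run with the property is total correctness.
  The postcondition sees the number of steps, so cost and effect are established together.\<close>

definition runs :: "com \<Rightarrow> state \<Rightarrow> (real \<Rightarrow> state \<Rightarrow> bool) \<Rightarrow> bool" where
  "runs c s Q \<longleftrightarrow> (\<exists>t s'. exec c s t s' \<and> Q (real t) s')"

lemma runs_Skip: "runs Skip s Q \<longleftrightarrow> Q 1 s"
  unfolding runs_def by (metis exec_Skip exec_deterministic of_nat_1)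

lemma runs_NAssign: "runs (NAssign x e) s Q \<longleftrightarrow> Q 1 (s\<lparr>nvar := (nvar s)(x := nval e s)\<rparr>)"
  unfolding runs_def by (metis exec_NAssign exec_deterministic of_nat_1)

lemma runs_RAssign: "runs (RAssign x e) s Q \<longleftrightarrow> Q 1 (s\<lparr>rvar := (rvar s)(x := rval e s)\<rparr>)"
  unfolding runs_def by (metis exec_RAssign exec_deterministic of_nat_1)

lemma runs_RStore:
  "runs (RStore a i e) s Q \<longleftrightarrow> Q 1 (s\<lparr>rarr := (rarr s)(a := (rarr s a)(nval i s := rval e s))\<rparr>)"
  unfolding runs_def by (metis exec_RStore exec_deterministic of_nat_1)

lemma runs_Sample:
  "runs (Sample x) s Q \<longleftrightarrow> Q 1 (s\<lparr>rvar := (rvar s)(x := tape s (head s)), head := Suc (head s)\<rparr>)"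
  unfolding runs_def by (metis exec_Sample exec_deterministic of_nat_1)

lemma runs_Seq: "runs (Seq c d) s Q \<longleftrightarrow> runs c s (\<lambda>t s'. runs d s' (\<lambda>u. Q (t + u)))"
proof
  assume "runs (Seq c d) s Q"
  then obtain t s' where "exec (Seq c d) s t s'" "Q (real t) s'" by (auto simp: runs_def)
  then show "runs c s (\<lambda>t s'. runs d s' (\<lambda>u. Q (t + u)))"
    unfolding runs_def by (auto elim!: exec_elims(7)) (metis of_nat_add)
next
  assume "runs c s (\<lambda>t s'. runs d s' (\<lambda>u. Q (t + u)))"
  then obtain t s' u s'' where "exec c s t s'" "exec d s' u s''" "Q (real t + real u) s''"
    by (auto simp: runs_def)
  then show "runs (Seq c d) s Q" unfolding runs_def by (metis exec_Seq of_nat_add)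
qed

lemma runs_Cond:
  "runs (Cond b c d) s Q \<longleftrightarrow> runs (if bval b s then c else d) s (\<lambda>t. Q (1 + t))"
proof
  assume "runs (Cond b c d) s Q"
  then obtain t s' where *: "exec (Cond b c d) s t s'" "Q (real t) s'" by (auto simp: runs_def)
  from *(1) obtain u where "exec (if bval b s then c else d) s u s'" "t = Suc u"
    by (rule exec_elims(8)) auto
  with *(2) show "runs (if bval b s then c else d) s (\<lambda>t. Q (1 + t))" unfolding runs_def
    by (intro exI[of _ u] exI[of _ s']) simp
next
  assume "runs (if bval b s then c else d) s (\<lambda>t. Q (1 + t))"
  then obtain t s' where *: "exec (if bval b s then c else d) s t s'" "Q (1 + real t) s'"
    by (auto simp: runs_def)
  then have "exec (Cond b c d) s (Suc t) s'" by (auto intro: exec_CondT exec_CondF split: if_splits)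
  with *(2) show "runs (Cond b c d) s Q" unfolding runs_def by (metis of_nat_Suc)
qed

lemma runs_mono: "runs c s P \<Longrightarrow> (\<And>t s'. P t s' \<Longrightarrow> Q t s') \<Longrightarrow> runs c s Q"
  unfolding runs_def by blast

lemma runs_SeqI:
  assumes "runs c s P" "\<And>t s'. P t s' \<Longrightarrow> runs d s' (\<lambda>u. Q (t + u))"
  shows "runs (Seq c d) s Q"
  unfolding runs_Seq by (rule runs_mono[OF assms(1)]) (rule assms(2))

lemmas runs_simps = runs_Skip runs_NAssign runs_RAssign runs_RStore runs_Sample runs_Seq runs_Cond

lemma runs_WhileF: "\<not> bval b s \<Longrightarrow> Q 1 s \<Longrightarrow> runs (While b c) s Q"
  unfolding runs_def by (metis exec_WhileF of_nat_1)

lemma runs_WhileT: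
  assumes "bval b s" "runs c s (\<lambda>t s'. runs (While b c) s' (\<lambda>u. Q (1 + t + u)))"
  shows "runs (While b c) s Q"
proof -
  from assms(2) obtain t s' u s'' where
    *: "exec c s t s'" "exec (While b c) s' u s''" "Q (1 + real t + real u) s''"
    by (auto simp: runs_def)
  have "exec (While b c) s (Suc (t + u)) s''" using assms(1) *(1,2) by (rule exec_WhileT)
  moreover have "real (Suc (t + u)) = 1 + real t + real u" by simp
  ultimately show ?thesis unfolding runs_def using *(3) by metis
qed

lemma runs_For:
  assumes init: "I 0 s"
    and step: "\<And>k s. k < m \<Longrightarrow> I k s \<Longrightarrow> bval b s \<and> runs c s (\<lambda>t s'. I (Suc k) s' \<and> t \<le> T)"
    and exit: "\<And>s. I m s \<Longrightarrow> \<not> bval b s"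
  shows "runs (While b c) s (\<lambda>t s'. I m s' \<and> t \<le> real m * (T + 1) + 1)"
proof -
  have "runs (While b c) s (\<lambda>t s'. I m s' \<and> t \<le> real j * (T + 1) + 1)" if "I (m - j) s" "j \<le> m" for j s
    using that
  proof (induction j arbitrary: s)
    case 0
    then show ?case using exit[of s] by (auto intro!: runs_WhileF)
  next
    case (Suc j)
    then have *: "m - Suc j < m" "Suc (m - Suc j) = m - j" "j \<le> m" by auto
    have "bval b s" and body: "runs c s (\<lambda>t s'. I (m - j) s' \<and> t \<le> T)"
      using step[OF *(1) Suc.prems(1)] *(2) by auto
    show ?case
    proof (rule runs_WhileT[OF \<open>bval b s\<close>])
      show "runs c s (\<lambda>t s'. runs (While b c) s' (\<lambda>u s'. I m s' \<and> 1 + t + u \<le> real (Suc j) * (T + 1) + 1))"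
        using body by (rule runs_mono) (auto intro!: runs_mono[OF Suc.IH] * simp: algebra_simps)
    qed
  qed
  from this[of m s] init show ?thesis by simp
qed

text \<open>For loops whose rounds have different costs or are not counted in advance. Each round is
  paid for by the potential, guard included; hence the potential drops by at least 1, which proves
  termination, and its initial value bounds the total time.\<close>

lemma runs_While_potential:
  fixes \<Phi> :: "state \<Rightarrow> real"
  assumes init: "I s"
    and step: "\<And>s. I s \<Longrightarrow> bval b s \<Longrightarrow> runs c s (\<lambda>t s'. I s' \<and> t + 1 + \<Phi> s' \<le> \<Phi> s)"
    and nonneg: "\<And>s. I s \<Longrightarrow> 0 \<le> \<Phi> s"
  shows "runs (While b c) s (\<lambda>t s'. I s' \<and> \<not> bval b s' \<and> t \<le> \<Phi> s + 1)"
  using init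
proof (induction "nat \<lfloor>\<Phi> s\<rfloor>" arbitrary: s rule: less_induct)
  case less
  show ?case
  proof (cases "bval b s")
    case True
    from step[OF less.prems True] obtain t s' where
      *: "exec c s t s'" "I s'" "real t + 1 + \<Phi> s' \<le> \<Phi> s" by (auto simp: runs_def)
    have "0 \<le> \<Phi> s'" using nonneg * by blast
    then have "nat \<lfloor>\<Phi> s'\<rfloor> < nat \<lfloor>\<Phi> s\<rfloor>" using *(3) by linarith
    from less.hyps[OF this *(2)] have
      "runs (While b c) s' (\<lambda>u s''. I s'' \<and> \<not> bval b s'' \<and> 1 + real t + u \<le> \<Phi> s + 1)"
      by (rule runs_mono) (use *(3) in auto)
    then have "runs c s (\<lambda>t s'. runs (While b c) s' (\<lambda>u s''. I s'' \<and> \<not> bval b s'' \<and> 1 + t + u \<le> \<Phi> s + 1))"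
      using *(1) unfolding runs_def by blast
    then show ?thesis using True by (intro runs_WhileT)
  next
    case False
    then show ?thesis using less.prems nonneg by (intro runs_WhileF) auto
  qed
qed

text \<open>The position of the tape head is left unconstrained.\<close>

definition frame :: "vname set \<Rightarrow> vname set \<Rightarrow> vname set \<Rightarrow> state \<Rightarrow> state \<Rightarrow> bool" where
  "frame N R D s s' \<longleftrightarrow> (\<forall>x. x \<notin> N \<longrightarrow> nvar s' x = nvar s x) \<and> (\<forall>x. x \<notin> R \<longrightarrow> rvar s' x = rvar s x) \<and>
     (\<forall>x. x \<notin> D \<longrightarrow> rarr s' x = rarr s x) \<and> narr s' = narr s \<and> tape s' = tape s"

lemma frame_refl: "frame N R D s s"
  by (simp add: frame_def)

lemma frameD:
  assumes "frame N R D s s'"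
  shows "x \<notin> N \<Longrightarrow> nvar s' x = nvar s x" "x \<notin> R \<Longrightarrow> rvar s' x = rvar s x" "x \<notin> D \<Longrightarrow> rarr s' x = rarr s x"
    "narr s' = narr s" "tape s' = tape s"
  using assms by (auto simp: frame_def)

lemma frame_trans:
  assumes "frame N R D s s'" "frame N' R' D' s' s''" "N' \<subseteq> N" "R' \<subseteq> R" "D' \<subseteq> D"
  shows "frame N R D s s''"
  using assms unfolding frame_def by (metis subsetD)

lemma frame_mono:
  assumes "frame N' R' D' s s'" "N' \<subseteq> N" "R' \<subseteq> R" "D' \<subseteq> D"
  shows "frame N R D s s'"
  by (rule frame_trans[OF frame_refl assms])

definition incr :: "vname \<Rightarrow> com" where "incr x = NAssign x (NAdd (NVar x) (NConst 1))"

definition for_loop :: "vname \<Rightarrow> com \<Rightarrow> com" where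
  "for_loop m c = Seq (NAssign ''i'' (NConst 0))
     (While (NLess (NVar ''i'') (NVar m)) (Seq c (incr ''i'')))"

text \<open>The counter is removed from the frame of the body, so the body must leave it alone; the
  invariant is demanded for the state after the increment that the loop itself performs.\<close>

lemma runs_for_loop:
  assumes m: "m \<noteq> ''i''" "nvar s m = l"
    and N: "''i'' \<in> N" "m \<notin> N"
    and init: "I 0 (s\<lparr>nvar := (nvar s)(''i'' := 0)\<rparr>)"
    and step: "\<And>k s'. k < l \<Longrightarrow> frame N R D s s' \<Longrightarrow> nvar s' ''i'' = k \<Longrightarrow> I k s' \<Longrightarrow>
      runs c s' (\<lambda>t s''. frame (N - {''i''}) R D s' s'' \<and> I (Suc k) (s''\<lparr>nvar := (nvar s'')(''i'' := Suc k)\<rparr>) \<and> t \<le> T)"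
  shows "runs (for_loop m c) s (\<lambda>t s'. frame N R D s s' \<and> I l s' \<and> t \<le> real l * (T + 2) + 2)"
  unfolding for_loop_def runs_Seq runs_NAssign
proof (rule runs_mono[OF runs_For[where I = "\<lambda>k s'. frame N R D s s' \<and> nvar s' ''i'' = k \<and> I k s'" and m = l and T = "T + 1"]])
  show "frame N R D s (s\<lparr>nvar := (nvar s)(''i'' := nval (NConst 0) s)\<rparr>) \<and>
    nvar (s\<lparr>nvar := (nvar s)(''i'' := nval (NConst 0) s)\<rparr>) ''i'' = 0 \<and>
    I 0 (s\<lparr>nvar := (nvar s)(''i'' := nval (NConst 0) s)\<rparr>)"
    using N init by (auto simp: frame_def)
next
  fix k s' assume k: "k < l" and I: "frame N R D s s' \<and> nvar s' ''i'' = k \<and> I k s'"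
  have "nvar s' m = l" using I m N by (metis frameD(1))
  moreover have "runs (Seq c (incr ''i'')) s' (\<lambda>t s'. (frame N R D s s' \<and> nvar s' ''i'' = Suc k \<and> I (Suc k) s') \<and> t \<le> T + 1)"
    unfolding incr_def
  proof (rule runs_SeqI[OF step[OF k]])
    fix t s'' assume *: "frame (N - {''i''}) R D s' s'' \<and> I (Suc k) (s''\<lparr>nvar := (nvar s'')(''i'' := Suc k)\<rparr>) \<and> t \<le> T"
    then have i: "nvar s'' ''i'' = k" using I by (auto simp: frame_def)
    have "frame N R D s (s''\<lparr>nvar := (nvar s'')(''i'' := Suc k)\<rparr>)"
      using * I N by (auto simp: frame_def)
    then show "runs (NAssign ''i'' (NAdd (NVar ''i'') (NConst 1))) s''
      (\<lambda>u s'. (frame N R D s s' \<and> nvar s' ''i'' = Suc k \<and> I (Suc k) s') \<and> t + u \<le> T + 1)"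
      using * i by (simp add: runs_NAssign)
  qed (use I in auto)
  ultimately show "bval (NLess (NVar ''i'') (NVar m)) s' \<and>
    runs (Seq c (incr ''i'')) s' (\<lambda>t s'. (frame N R D s s' \<and> nvar s' ''i'' = Suc k \<and> I (Suc k) s') \<and> t \<le> T + 1)"
    using k I by simp
next
  fix s' assume I: "frame N R D s s' \<and> nvar s' ''i'' = l \<and> I l s'"
  have "nvar s' m = l" using I m N by (metis frameD(1))
  then show "\<not> bval (NLess (NVar ''i'') (NVar m)) s'" using I by simp
qed (auto simp: algebra_simps)

section \<open>Vector operations\<close>

definition vec_loop :: "vname \<Rightarrow> rexp \<Rightarrow> com" where
  "vec_loop Y e = for_loop ''n'' (RStore Y (NVar ''i'') e)"

text \<open>The expression may read entry \<open>i\<close> of the array that is being overwritten.\<close>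

lemma runs_vec_loop:
  assumes n: "nvar s ''n'' = n"
    and e: "\<And>k s'. k < n \<Longrightarrow> frame {''i''} {} {Y} s s' \<Longrightarrow> nvar s' ''i'' = k \<Longrightarrow>
      rarr s' Y k = rarr s Y k \<Longrightarrow> rval e s' = f k"
  shows "runs (vec_loop Y e) s
    (\<lambda>t s'. frame {''i''} {} {Y} s s' \<and> (\<forall>k<n. rarr s' Y k = f k) \<and> t \<le> 3 * real n + 2)"
  unfolding vec_loop_def
proof (rule runs_mono[OF runs_for_loop[where N = "{''i''}" and R = "{}" and D = "{Y}" and l = n and T = 1
    and I = "\<lambda>k s'. (\<forall>j<k. rarr s' Y j = f j) \<and> (\<forall>j\<ge>k. rarr s' Y j = rarr s Y j)"]])
  fix k s' assume "k < n" "frame {''i''} {} {Y} s s'" "nvar s' ''i'' = k"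
    "(\<forall>j<k. rarr s' Y j = f j) \<and> (\<forall>j\<ge>k. rarr s' Y j = rarr s Y j)"
  then show "runs (RStore Y (NVar ''i'') e) s' (\<lambda>t s''. frame ({''i''} - {''i''}) {} {Y} s' s'' \<and>
    ((\<forall>j<Suc k. rarr (s''\<lparr>nvar := (nvar s'')(''i'' := Suc k)\<rparr>) Y j = f j) \<and>
     (\<forall>j\<ge>Suc k. rarr (s''\<lparr>nvar := (nvar s'')(''i'' := Suc k)\<rparr>) Y j = rarr s Y j)) \<and> t \<le> 1)"
    using e[of k s'] by (auto simp: runs_RStore frame_def less_Suc_eq)
qed (use n in \<open>auto simp: frame_def\<close>)

definition sum_loop :: "vname \<Rightarrow> rexp \<Rightarrow> com" where
  "sum_loop r e = Seq (RAssign r (RNat (NConst 0))) (for_loop ''n'' (RAssign r (RAdd (RVar r) e)))"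

lemma runs_sum_loop:
  assumes n: "nvar s ''n'' = n"
    and e: "\<And>k s'. k < n \<Longrightarrow> frame {''i''} {r} {} s s' \<Longrightarrow> nvar s' ''i'' = k \<Longrightarrow> rval e s' = f k"
  shows "runs (sum_loop r e) s
    (\<lambda>t s'. frame {''i''} {r} {} s s' \<and> rvar s' r = (\<Sum>k<n. f k) \<and> t \<le> 3 * real n + 3)"
  unfolding sum_loop_def runs_Seq runs_RAssign
proof (rule runs_mono[OF runs_for_loop[where N = "{''i''}" and R = "{r}" and D = "{}" and l = n and T = 1
    and I = "\<lambda>k s'. rvar s' r = (\<Sum>j<k. f j)"]])
  let ?s = "s\<lparr>rvar := (rvar s)(r := rval (RNat (NConst 0)) s)\<rparr>"
  fix k s' assume "k < n" "frame {''i''} {r} {} ?s s'" "nvar s' ''i'' = k" "rvar s' r = (\<Sum>j<k. f j)"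
  moreover from this have "frame {''i''} {r} {} s s'" by (auto simp: frame_def)
  ultimately show "runs (RAssign r (RAdd (RVar r) e)) s' (\<lambda>t s''. frame ({''i''} - {''i''}) {r} {} s' s'' \<and>
      rvar (s''\<lparr>nvar := (nvar s'')(''i'' := Suc k)\<rparr>) r = (\<Sum>j<Suc k. f j) \<and> t \<le> 1)"
    using e[of k s'] by (auto simp: runs_RAssign frame_def)
qed (use n in \<open>auto simp: frame_def\<close>)

text \<open>The target accumulates, so the stored entries may come in any order and both matrices of
  the pencil can be applied to one target, at a cost linear in the number of nonzeros.\<close>

definition sparse_add :: "vname \<Rightarrow> vname \<Rightarrow> vname \<Rightarrow> vname \<Rightarrow> rexp \<Rightarrow> vname \<Rightarrow> vname \<Rightarrow> com" where
  "sparse_add m ro co ar g X Y = for_loop m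
     (RStore Y (NArr ro (NVar ''i'')) (RAdd (RArr Y (NArr ro (NVar ''i'')))
        (RMul g (RMul (RArr ar (NVar ''i'')) (RArr X (NArr co (NVar ''i'')))))))"

lemma runs_sparse_add:
  assumes m: "nvar s m = l" "m \<noteq> ''i''" and Y: "Y \<noteq> X" "Y \<noteq> ar"
    and g: "\<And>s'. frame {''i''} {} {Y} s s' \<Longrightarrow> rval g s' = \<gamma>"
  shows "runs (sparse_add m ro co ar g X Y) s (\<lambda>t s'. frame {''i''} {} {Y} s s' \<and>
    (\<forall>j. rarr s' Y j = rarr s Y j +
       \<gamma> * (\<Sum>k<l. if narr s ro k = j then rarr s ar k * rarr s X (narr s co k) else 0)) \<and>
    t \<le> 3 * real l + 2)"
  unfolding sparse_add_def
proof (rule runs_mono[OF runs_for_loop[where N = "{''i''}" and R = "{}" and D = "{Y}" and l = l and T = 1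
    and I = "\<lambda>k s'. \<forall>j. rarr s' Y j = rarr s Y j +
       \<gamma> * (\<Sum>k<k. if narr s ro k = j then rarr s ar k * rarr s X (narr s co k) else 0)"]])
  fix k s' assume *: "k < l" "frame {''i''} {} {Y} s s'" "nvar s' ''i'' = k"
    "\<forall>j. rarr s' Y j = rarr s Y j +
       \<gamma> * (\<Sum>k<k. if narr s ro k = j then rarr s ar k * rarr s X (narr s co k) else 0)"
  have "narr s' = narr s" "rarr s' X = rarr s X" "rarr s' ar = rarr s ar"
    using *(2) Y by (auto simp: frame_def)
  then show "runs (RStore Y (NArr ro (NVar ''i'')) (RAdd (RArr Y (NArr ro (NVar ''i'')))
        (RMul g (RMul (RArr ar (NVar ''i'')) (RArr X (NArr co (NVar ''i''))))))) s'
     (\<lambda>t s''. frame ({''i''} - {''i''}) {} {Y} s' s'' \<and>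
       (\<forall>j. rarr (s''\<lparr>nvar := (nvar s'')(''i'' := Suc k)\<rparr>) Y j = rarr s Y j +
         \<gamma> * (\<Sum>k<Suc k. if narr s ro k = j then rarr s ar k * rarr s X (narr s co k) else 0)) \<and> t \<le> 1)"
    using * g[OF *(2)] by (auto simp: runs_RStore frame_def algebra_simps)
qed (use m in \<open>auto simp: frame_def\<close>)

text \<open>The value 0 beyond n lets eigenvector equations hold between whole sequences once the
  eigenvector vanishes there too.\<close>

definition op :: "nat \<Rightarrow> real mat \<Rightarrow> (nat \<Rightarrow> real) \<Rightarrow> nat \<Rightarrow> real" where
  "op n A x i = (if i < n then (\<Sum>j<n. A $$ (i, j) * x j) else 0)"

lemma sum_nonzeros:
  assumes A: "A \<in> carrier_mat n n" and L: "lists_nonzeros L A" and i: "i < n"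
  shows "(\<Sum>k<length L. if array_of fst L k = i then array_of (\<lambda>ij. A $$ ij) L k * x (array_of snd L k) else 0)
    = op n A x i"
proof -
  have "(\<Sum>k<length L. if array_of fst L k = i then array_of (\<lambda>ij. A $$ ij) L k * x (array_of snd L k) else 0)
      = (\<Sum>k<length L. if fst (L ! k) = i then A $$ (L ! k) * x (snd (L ! k)) else 0)"
    by (intro sum.cong) (auto simp: array_of_def)
  also have "\<dots> = (\<Sum>ij\<in>set L. if fst ij = i then A $$ ij * x (snd ij) else 0)"
    using sum.reindex_bij_betw[OF bij_betw_nth[OF _ refl refl], of L
        "\<lambda>ij. if fst ij = i then A $$ ij * x (snd ij) else 0"] L
    by (simp add: lists_nonzeros_def)
  also have "\<dots> = (\<Sum>ij\<in>(\<lambda>j. (i, j)) ` {..<n}. A $$ ij * x (snd ij))"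
  proof (rule sum.mono_neutral_cong)
    show "A $$ ij * x (snd ij) = 0" if "ij \<in> (\<lambda>j. (i, j)) ` {..<n} - set L" for ij
      using that L A i by (auto simp: lists_nonzeros_def nonzero_positions_def)
    show "(if fst ij = i then A $$ ij * x (snd ij) else 0) = 0" if "ij \<in> set L - (\<lambda>j. (i, j)) ` {..<n}" for ij
      using that L A i by (cases ij) (auto simp: lists_nonzeros_def nonzero_positions_def)
  qed auto
  also have "\<dots> = (\<Sum>j<n. A $$ (i, j) * x j)"
    by (subst sum.reindex) (auto simp: inj_on_def)
  finally show ?thesis using i by (simp add: op_def)
qed

definition mat_vec :: "rexp \<Rightarrow> vname \<Rightarrow> vname \<Rightarrow> com" where
  "mat_vec g X Y = Seq (vec_loop Y (RNat (NConst 0)))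
     (Seq (sparse_add ''nnz0'' ''row0'' ''col0'' ''A0'' (RNat (NConst 1)) X Y)
          (sparse_add ''nnz1'' ''row1'' ''col1'' ''A1'' g X Y))"

definition holds_matrices :: "nat \<Rightarrow> real mat \<Rightarrow> real mat \<Rightarrow> (nat \<times> nat) list \<Rightarrow> (nat \<times> nat) list \<Rightarrow> state \<Rightarrow> bool" where
  "holds_matrices n A0 A1 L0 L1 s \<longleftrightarrow>
     nvar s ''n'' = n \<and> nvar s ''nnz0'' = length L0 \<and> nvar s ''nnz1'' = length L1 \<and>
     narr s ''row0'' = array_of fst L0 \<and> narr s ''col0'' = array_of snd L0 \<and>
     narr s ''row1'' = array_of fst L1 \<and> narr s ''col1'' = array_of snd L1 \<and>
     rarr s ''A0'' = array_of (\<lambda>ij. A0 $$ ij) L0 \<and> rarr s ''A1'' = array_of (\<lambda>ij. A1 $$ ij) L1"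

lemma runs_mat_vec:
  assumes A: "A0 \<in> carrier_mat n n" "A1 \<in> carrier_mat n n" "lists_nonzeros L0 A0" "lists_nonzeros L1 A1"
    and s: "holds_matrices n A0 A1 L0 L1 s" and Y: "Y \<noteq> X" "Y \<noteq> ''A0''" "Y \<noteq> ''A1''"
    and g: "\<And>s'. frame {''i''} {} {Y} s s' \<Longrightarrow> rval g s' = \<gamma>"
  shows "runs (mat_vec g X Y) s (\<lambda>t s'. frame {''i''} {} {Y} s s' \<and>
    (\<forall>i<n. rarr s' Y i = op n A0 (rarr s X) i + \<gamma> * op n A1 (rarr s X) i) \<and>
    t \<le> 3 * real n + 3 * real (length L0) + 3 * real (length L1) + 6)"
proof -
  have n: "nvar s ''n'' = n" using s by (simp add: holds_matrices_def)
  obtain t1 s1 where e1: "exec (vec_loop Y (RNat (NConst 0))) s t1 s1" and f1: "frame {''i''} {} {Y} s s1"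
    and Y1: "\<forall>k<n. rarr s1 Y k = 0" and t1: "real t1 \<le> 3 * real n + 2"
    using runs_vec_loop[OF n, of Y "RNat (NConst 0)" "\<lambda>_. 0"] unfolding runs_def by auto
  note v1 = frameD[OF f1]
  have s1: "nvar s1 ''nnz0'' = length L0" using s v1 by (simp add: holds_matrices_def)
  obtain t2 s2 where e2: "exec (sparse_add ''nnz0'' ''row0'' ''col0'' ''A0'' (RNat (NConst 1)) X Y) s1 t2 s2"
    and f2: "frame {''i''} {} {Y} s1 s2"
    and Y2: "\<And>j. rarr s2 Y j = rarr s1 Y j + 1 * (\<Sum>k<length L0. if narr s1 ''row0'' k = j
       then rarr s1 ''A0'' k * rarr s1 X (narr s1 ''col0'' k) else 0)" and t2: "real t2 \<le> 3 * real (length L0) + 2"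
    using runs_sparse_add[OF s1 _ Y(1,2), of "RNat (NConst 1)" 1 "''row0''" "''col0''"]
    unfolding runs_def by auto
  note v2 = frameD[OF f2]
  have s2: "nvar s2 ''nnz1'' = length L1" using s v1 v2 by (simp add: holds_matrices_def)
  have f02: "frame {''i''} {} {Y} s s2" using f1 f2 by (rule frame_trans) auto
  have g2: "rval g s' = \<gamma>" if "frame {''i''} {} {Y} s2 s'" for s'
    using frame_trans[OF f02 that] by (intro g) auto
  obtain t3 s3 where e3: "exec (sparse_add ''nnz1'' ''row1'' ''col1'' ''A1'' g X Y) s2 t3 s3"
    and f3: "frame {''i''} {} {Y} s2 s3"
    and Y3: "\<And>j. rarr s3 Y j = rarr s2 Y j + \<gamma> * (\<Sum>k<length L1. if narr s2 ''row1'' k = j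
       then rarr s2 ''A1'' k * rarr s2 X (narr s2 ''col1'' k) else 0)" and t3: "real t3 \<le> 3 * real (length L1) + 2"
    using runs_sparse_add[OF s2 _ Y(1,3) g2, of "''row1''" "''col1''"] unfolding runs_def by auto
  have arr: "narr s2 = narr s" "narr s1 = narr s" "rarr s1 X = rarr s X" "rarr s2 X = rarr s X"
    "rarr s1 ''A0'' = rarr s ''A0''" "rarr s2 ''A1'' = rarr s ''A1''"
    using Y v1 v2 by simp_all
  have "rarr s3 Y i = op n A0 (rarr s X) i + \<gamma> * op n A1 (rarr s X) i" if "i < n" for i
    using s Y1 that unfolding Y3 Y2 arr sum_nonzeros[OF A(1,3) that, symmetric]
      sum_nonzeros[OF A(2,4) that, symmetric] by (simp add: holds_matrices_def cong: if_cong)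
  moreover have "exec (mat_vec g X Y) s (t1 + (t2 + t3)) s3"
    unfolding mat_vec_def by (rule exec_Seq[OF e1 exec_Seq[OF e2 e3]])
  moreover have "frame {''i''} {} {Y} s s3" using f02 f3 by (rule frame_trans) auto
  ultimately show ?thesis unfolding runs_def
    using t1 t2 t3 by (intro exI[of _ "t1 + (t2 + t3)"] exI[of _ s3]) auto
qed

section \<open>The randomized test for semidefiniteness\<close>

abbreviation (input) "lit k \<equiv> RNat (NConst k)"
abbreviation (input) "entry X \<equiv> RArr X (NVar ''i'')"

abbreviation (input) "coreR \<equiv> {''tn'', ''tc'', ''ts''}"
abbreviation (input) "testD \<equiv> {''C'', ''S'', ''Y'', ''Z''}"
abbreviation (input) "S_update \<equiv>
     RAdd (RAdd (RMul (RVar ''mu'') (entry ''S'')) (RMul (RVar ''nl'') (entry ''Y''))) (entry ''C'')"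
abbreviation (input) "C_update \<equiv>
     RSub (RAdd (RMul (RVar ''mu'') (entry ''Y'')) (RMul (RVar ''nl'') (entry ''Z''))) (entry ''S'')"
abbreviation (input) "scalar_update \<equiv>
     Seq (RAssign ''tn'' (RAdd (RMul (RVar ''mu'') (RVar ''ts'')) (RVar ''tc''))) (Seq (RAssign ''tc''
     (RSub (RMul (RVar ''mu'') (RVar ''tn'')) (RVar ''ts''))) (RAssign ''ts'' (RVar ''tn'')))"

text \<open>The new second component waits in \<open>Y\<close> until the old one has been used for
  \<open>C\<close>; \<open>tn\<close> plays the same role in the scalar recurrence, which runs
  alongside.\<close>

definition cheb_body :: com where
  "cheb_body =
    Seq (mat_vec (RVar ''g'') ''S'' ''Y'')
   (Seq (vec_loop ''Y'' S_update)
   (Seq (mat_vec (RVar ''g'') ''Y'' ''Z'')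
   (Seq (vec_loop ''C'' C_update)
   (Seq (vec_loop ''S'' (entry ''Y''))
   scalar_update))))"

definition eig_core :: com where
  "eig_core =
    Seq (vec_loop ''C'' (entry ''v''))
   (Seq (vec_loop ''S'' (lit 0))
   (Seq (While (RLess (RVar ''tc'') (RVar ''B'')) cheb_body)
   (Seq (sum_loop ''nc'' (RMul (entry ''C'') (entry ''C'')))
        (sum_loop ''nv'' (RMul (entry ''v'') (entry ''v''))))))"

text \<open>With \<eta> = h/\<kappa> and L = 4 \<zeta>, \<open>mu\<close> is 1 + 2 \<eta>/L and
  \<open>nl\<close> is -2/L. The threshold \<open>B\<close> is 4 n / r^2 from
  \<open>tape_bad_event\<close>, where r = p \<delta>/(4 h) is the failure probability granted to a
  test with step h.\<close>

definition eig_test :: com where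
  "eig_test =
    Seq (RAssign ''mu'' (RAdd (lit 1) (RDiv (RMul (RVar ''h'') (RVar ''xi'')) (RMul (lit 2) (RMul (RVar ''zeta'') (RVar ''zeta''))))))
   (Seq (RAssign ''nl'' (RSub (lit 0) (RDiv (lit 2) (RMul (lit 4) (RVar ''zeta'')))))
   (Seq (RAssign ''tn'' (RDiv (RVar ''h'') (RMul (RVar ''delta'') (RVar ''p''))))
   (Seq (RAssign ''B'' (RMul (lit 64) (RMul (RNat (NVar ''n'')) (RMul (RVar ''tn'') (RVar ''tn'')))))
   (Seq (RAssign ''tc'' (lit 1))
   (Seq (RAssign ''ts'' (lit 0))
        eig_core)))))"

lemma op_cong: "(\<And>j. j < n \<Longrightarrow> x j = y j) \<Longrightarrow> op n A x i = op n A y i"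
  by (simp add: op_def)

text \<open>The bound on n absorbs passes over vectors into the cost of a matrix product. The bound
  on \<epsilon> is the assumed one, as \<kappa> \<zeta> = \<kappa>^2 \<xi>.\<close>

locale gtrs_machine = gtrs n "op n A0m" "op n A1m" b0 b1 c0 c1 \<xi> \<zeta> \<gamma>h x0
  for n A0m A1m b0 b1 c0 c1 \<xi> \<zeta> \<gamma>h x0 +
  fixes L0 L1 :: "(nat \<times> nat) list" and \<epsilon> p :: real
  assumes A0m: "A0m \<in> carrier_mat n n" "lists_nonzeros L0 A0m"
    and A1m: "A1m \<in> carrier_mat n n" "lists_nonzeros L1 A1m"
    and n_pos: "0 < n" and n_le: "n \<le> length L0 + length L1"
    and \<epsilon>: "0 < \<epsilon>" "\<epsilon> \<le> \<kappa> * \<zeta>" and p: "0 < p"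
begin

definition N :: real where "N = real (length L0 + length L1)"

definition \<delta> :: real where "\<delta> = \<epsilon> / (1000 * \<kappa>\<^sup>2)"

lemma N_ge: "real n \<le> N" "1 \<le> N"
  using n_pos n_le by (auto simp: N_def)

lemma \<delta>_pos: "0 < \<delta>"
  using \<epsilon> \<kappa>_ge_1 by (simp add: \<delta>_def)

lemma A_cong: "(\<And>j. j < n \<Longrightarrow> x j = y j) \<Longrightarrow> A \<gamma> x i = A \<gamma> y i"
  using op_cong[of n x y] by (simp add: A_def)

abbreviation "loaded s \<equiv> holds_matrices n A0m A1m L0 L1 s"

lemma loaded_n: "loaded s \<Longrightarrow> nvar s ''n'' = n"
  by (simp add: holds_matrices_def)

lemma loaded_frame:
  assumes "loaded s" "frame {''i''} R D s s'" "''A0'' \<notin> D" "''A1'' \<notin> D"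
  shows "loaded s'"
  using assms by (simp add: holds_matrices_def frameD[OF assms(2)])

lemma mat_vecE:
  assumes "loaded s" "Y \<noteq> X" "Y \<noteq> ''A0''" "Y \<noteq> ''A1''" "rvar s x = \<gamma>"
  obtains t s' where "exec (mat_vec (RVar x) X Y) s t s'" "frame {''i''} {} {Y} s s'"
    "\<And>i. i < n \<Longrightarrow> rarr s' Y i = A \<gamma> (rarr s X) i" "real t \<le> 12 * N"
proof -
  have "runs (mat_vec (RVar x) X Y) s (\<lambda>t s'. frame {''i''} {} {Y} s s' \<and>
    (\<forall>i<n. rarr s' Y i = op n A0m (rarr s X) i + \<gamma> * op n A1m (rarr s X) i) \<and>
    t \<le> 3 * real n + 3 * real (length L0) + 3 * real (length L1) + 6)"
    using assms(5) by (intro runs_mat_vec A0m A1m assms(1-4)) (auto simp: frame_def)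
  then obtain t s' where *: "exec (mat_vec (RVar x) X Y) s t s'" "frame {''i''} {} {Y} s s'"
    "\<forall>i<n. rarr s' Y i = op n A0m (rarr s X) i + \<gamma> * op n A1m (rarr s X) i"
    "real t \<le> 3 * real n + 3 * real (length L0) + 3 * real (length L1) + 6"
    unfolding runs_def by blast
  show thesis
  proof (rule that[OF *(1,2)])
    show "rarr s' Y i = A \<gamma> (rarr s X) i" if "i < n" for i
      using *(3) that by (simp add: A_def)
    show "real t \<le> 12 * N" using *(4) N_ge by (simp add: N_def)
  qed
qed

lemma vec_loopE:
  assumes "nvar s ''n'' = n"
    and "\<And>k s'. k < n \<Longrightarrow> frame {''i''} {} {Y} s s' \<Longrightarrow> nvar s' ''i'' = k \<Longrightarrow>
      rarr s' Y k = rarr s Y k \<Longrightarrow> rval e s' = f k"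
  obtains t s' where "exec (vec_loop Y e) s t s'" "frame {''i''} {} {Y} s s'"
    "\<And>i. i < n \<Longrightarrow> rarr s' Y i = f i" "real t \<le> 5 * N"
proof -
  have "runs (vec_loop Y e) s
    (\<lambda>t s'. frame {''i''} {} {Y} s s' \<and> (\<forall>k<n. rarr s' Y k = f k) \<and> t \<le> 3 * real n + 2)"
    using assms by (rule runs_vec_loop)
  then obtain t s' where
    *: "exec (vec_loop Y e) s t s'" "frame {''i''} {} {Y} s s'" "\<forall>i<n. rarr s' Y i = f i"
      "real t \<le> 3 * real n + 2"
    unfolding runs_def by blast
  show thesis by (rule that[OF *(1,2)]) (use *(3,4) N_ge in auto)
qed

lemma sum_loopE:
  assumes "nvar s ''n'' = n"
    and "\<And>k s'. k < n \<Longrightarrow> frame {''i''} {r} {} s s' \<Longrightarrow> nvar s' ''i'' = k \<Longrightarrow> rval e s' = f k"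
  obtains t s' where "exec (sum_loop r e) s t s'" "frame {''i''} {r} {} s s'"
    "rvar s' r = (\<Sum>k<n. f k)" "real t \<le> 6 * N"
proof -
  have "runs (sum_loop r e) s
    (\<lambda>t s'. frame {''i''} {r} {} s s' \<and> rvar s' r = (\<Sum>k<n. f k) \<and> t \<le> 3 * real n + 3)"
    using assms by (rule runs_sum_loop)
  then obtain t s' where
    *: "exec (sum_loop r e) s t s'" "frame {''i''} {r} {} s s'" "rvar s' r = (\<Sum>k<n. f k)"
      "real t \<le> 3 * real n + 3"
    unfolding runs_def by blast
  show thesis by (rule that[OF *(1-3)]) (use *(4) N_ge in auto)
qed

lemma runs_cheb_body:
  assumes s: "loaded s" "rvar s ''g'' = \<gamma>" "rvar s ''mu'' = \<mu>" "rvar s ''nl'' = - (2 / L)"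
    and C: "\<forall>i<n. rarr s ''C'' i = c i" and S: "\<forall>i<n. rarr s ''S'' i = d i"
    and M: "M = cheb_op (A \<gamma>) L \<mu>"
  shows "runs cheb_body s (\<lambda>t s'. frame {''i''} coreR testD s s' \<and>
    (\<forall>i<n. rarr s' ''C'' i = (M (M d + c) - d) i) \<and> (\<forall>i<n. rarr s' ''S'' i = (M d + c) i) \<and>
    rvar s' ''tc'' = \<mu> * (\<mu> * rvar s ''ts'' + rvar s ''tc'') - rvar s ''ts'' \<and>
    rvar s' ''ts'' = \<mu> * rvar s ''ts'' + rvar s ''tc'' \<and> t \<le> 42 * N)"
proof -
  obtain t1 s1 where e1: "exec (mat_vec (RVar ''g'') ''S'' ''Y'') s t1 s1" and f1: "frame {''i''} {} {''Y''} s s1"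
    and Y1: "\<And>i. i < n \<Longrightarrow> rarr s1 ''Y'' i = A \<gamma> (rarr s ''S'') i" and t1: "real t1 \<le> 12 * N"
    by (rule mat_vecE[OF s(1) _ _ _ s(2), of "''Y''" "''S''"]) auto
  have h1: "loaded s1" using loaded_frame[OF s(1) f1] by simp
  note v1 = frameD[OF f1]
  have Y1': "rarr s1 ''Y'' i = A \<gamma> d i" if "i < n" for i
    using Y1[OF that] A_cong[of "rarr s ''S''" d \<gamma> i] S by simp
  obtain t2 s2 where e2: "exec (vec_loop ''Y'' S_update) s1 t2 s2"
    and f2: "frame {''i''} {} {''Y''} s1 s2"
    and Y2: "\<And>i. i < n \<Longrightarrow> rarr s2 ''Y'' i = (M d + c) i" and t2: "real t2 \<le> 5 * N"
  proof (rule vec_loopE[OF loaded_n[OF h1], of "''Y''" _ "M d + c"])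
    fix k s' assume k: "k < n" "nvar s' ''i'' = k" "rarr s' ''Y'' k = rarr s1 ''Y'' k"
      and f: "frame {''i''} {} {''Y''} s1 s'"
    show "rval S_update s' = (M d + c) k"
      using k s C S by (simp add: frameD[OF f] v1 Y1' M cheb_op_def)
  qed blast
  note v2 = frameD[OF f2]
  have h2: "loaded s2" using loaded_frame[OF h1 f2] by simp
  have g2: "rvar s2 ''g'' = \<gamma>" using s v1 v2 by simp
  obtain t3 s3 where e3: "exec (mat_vec (RVar ''g'') ''Y'' ''Z'') s2 t3 s3" and f3: "frame {''i''} {} {''Z''} s2 s3"
    and Z3: "\<And>i. i < n \<Longrightarrow> rarr s3 ''Z'' i = A \<gamma> (rarr s2 ''Y'') i" and t3: "real t3 \<le> 12 * N"
    by (rule mat_vecE[OF h2 _ _ _ g2, of "''Z''" "''Y''"]) auto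
  note v3 = frameD[OF f3]
  have h3: "loaded s3" using loaded_frame[OF h2 f3] by simp
  have Z3': "rarr s3 ''Z'' i = A \<gamma> (M d + c) i" if "i < n" for i
    using Z3[OF that] A_cong[of "rarr s2 ''Y''" "M d + c" \<gamma> i] Y2 by simp
  obtain t4 s4 where e4: "exec (vec_loop ''C'' C_update) s3 t4 s4"
    and f4: "frame {''i''} {} {''C''} s3 s4"
    and C4: "\<And>i. i < n \<Longrightarrow> rarr s4 ''C'' i = (M (M d + c) - d) i" and t4: "real t4 \<le> 5 * N"
  proof (rule vec_loopE[OF loaded_n[OF h3], of "''C''" _ "M (M d + c) - d"])
    fix k s' assume k: "k < n" "nvar s' ''i'' = k"
      and f: "frame {''i''} {} {''C''} s3 s'"
    have "M (M d + c) k = \<mu> * (M d + c) k + (- (2 / L)) * A \<gamma> (M d + c) k"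
      by (subst M) (simp add: cheb_op_def)
    then show "rval C_update s' = (M (M d + c) - d) k"
      using k s S Y2[OF k(1)] Z3'[OF k(1)] by (simp add: frameD[OF f] v1 v2 v3)
  qed blast
  note v4 = frameD[OF f4]
  have h4: "loaded s4" using loaded_frame[OF h3 f4] by simp
  obtain t5 s5 where e5: "exec (vec_loop ''S'' (entry ''Y'')) s4 t5 s5"
    and f5: "frame {''i''} {} {''S''} s4 s5"
    and S5: "\<And>i. i < n \<Longrightarrow> rarr s5 ''S'' i = (M d + c) i" and t5: "real t5 \<le> 5 * N"
  proof (rule vec_loopE[OF loaded_n[OF h4], of "''S''" _ "M d + c"])
    fix k s' assume k: "k < n" "nvar s' ''i'' = k"
      and f: "frame {''i''} {} {''S''} s4 s'"
    show "rval (entry ''Y'') s' = (M d + c) k"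
      using k Y2[OF k(1)] by (simp add: frameD[OF f] v3 v4)
  qed blast
  note v5 = frameD[OF f5]
  have f05: "frame {''i''} {} testD s s5"
    by (intro frame_trans[OF frame_trans[OF frame_trans[OF frame_trans[OF frame_mono[OF f1] f2] f3] f4] f5]) auto
  have "runs scalar_update s5 (\<lambda>t s'. frame {''i''} coreR testD s s' \<and>
        rarr s' = rarr s5 \<and>
      rvar s' ''tc'' = \<mu> * (\<mu> * rvar s ''ts'' + rvar s ''tc'') - rvar s ''ts'' \<and>
      rvar s' ''ts'' = \<mu> * rvar s ''ts'' + rvar s ''tc'' \<and> t \<le> 3)"
    using f05 s by (simp add: runs_simps frameD[OF f05] frame_def)
  then obtain t6 s6 where e6: "exec scalar_update s5 t6 s6"
      "frame {''i''} coreR testD s s6" "rarr s6 = rarr s5"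
      "rvar s6 ''tc'' = \<mu> * (\<mu> * rvar s ''ts'' + rvar s ''tc'') - rvar s ''ts''"
      "rvar s6 ''ts'' = \<mu> * rvar s ''ts'' + rvar s ''tc''" "real t6 \<le> 3"
    unfolding runs_def by blast
  have C6: "rarr s6 ''C'' i = (M (M d + c) - d) i" if "i < n" for i
    using C4[OF that] e6(3) v5 by simp
  have S6: "rarr s6 ''S'' i = (M d + c) i" if "i < n" for i
    using S5[OF that] e6(3) by simp
  show ?thesis
    unfolding runs_def
  proof (intro exI conjI)
    show "exec cheb_body s (t1 + (t2 + (t3 + (t4 + (t5 + t6))))) s6"
      unfolding cheb_body_def
      by (rule exec_Seq[OF e1 exec_Seq[OF e2 exec_Seq[OF e3 exec_Seq[OF e4 exec_Seq[OF e5 e6(1)]]]]])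
    show "real (t1 + (t2 + (t3 + (t4 + (t5 + t6))))) \<le> 42 * N"
      using t1 t2 t3 t4 t5 e6(6) N_ge by simp
  qed (use e6 C6 S6 in auto)
qed

lemma runs_eig_core:
  assumes s: "loaded s" "rvar s ''g'' = \<gamma>" "rvar s ''mu'' = 1 + e" "rvar s ''nl'' = - (2 / L)"
      "rvar s ''B'' = B" "rvar s ''tc'' = 1" "rvar s ''ts'' = 0"
    and v: "v = rarr s ''v''" and e: "0 < e" "2 * e \<le> 1"
    and M: "M = cheb_op (A \<gamma>) L (1 + e)"
  shows "runs eig_core s (\<lambda>t s'. frame {''i''} {''tn'', ''tc'', ''ts'', ''nc'', ''nv''} testD s s' \<and>
    (\<exists>k. B \<le> fst (cheb_real (1 + e) k) \<and> rvar s' ''nc'' = ip n (fst (cheb M v k)) (fst (cheb M v k))) \<and>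
    rvar s' ''nv'' = ip n v v \<and> t \<le> N * (66 + 86 * (max 0 (ln (2 * B)) / sqrt (2 * e))))"
proof -
  obtain t1 s1 where e1: "exec (vec_loop ''C'' (entry ''v'')) s t1 s1" and f1: "frame {''i''} {} {''C''} s s1"
    and C1: "\<And>i. i < n \<Longrightarrow> rarr s1 ''C'' i = v i" and t1: "real t1 \<le> 5 * N"
  proof (rule vec_loopE[OF loaded_n[OF s(1)], of "''C''" _ v])
    fix k s' assume k: "k < n" "nvar s' ''i'' = k" and f: "frame {''i''} {} {''C''} s s'"
    show "rval (entry ''v'') s' = v k" using k by (simp add: frameD[OF f] v)
  qed blast
  note v1 = frameD[OF f1]
  have h1: "loaded s1" using loaded_frame[OF s(1) f1] by simp
  obtain t2 s2 where e2: "exec (vec_loop ''S'' (lit 0)) s1 t2 s2" and f2: "frame {''i''} {} {''S''} s1 s2"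
    and S2: "\<And>i. i < n \<Longrightarrow> rarr s2 ''S'' i = 0" and t2: "real t2 \<le> 5 * N"
    by (rule vec_loopE[OF loaded_n[OF h1], of "''S''" "lit 0" "\<lambda>_. 0"]) auto
  note v2 = frameD[OF f2]
  have h2: "loaded s2" using loaded_frame[OF h1 f2] by simp
  \<comment> \<open>The loop guard compares the scalar polynomial with \<open>B\<close>, so the loop
    makes exactly m rounds, whatever the vectors do.\<close>
  obtain m where m: "\<And>k. k < m \<Longrightarrow> fst (cheb_real (1 + e) k) < B"
    "B \<le> fst (cheb_real (1 + e) m)" "real m \<le> 1 + 2 * max 0 (ln (2 * B)) / sqrt (2 * e)"
    using cheb_real_hitting_time[OF e] by blast
  define I where "I k s' \<longleftrightarrow> frame {''i''} coreR testD s s' \<and>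
    (\<forall>i<n. rarr s' ''C'' i = fst (cheb M v k) i) \<and> (\<forall>i<n. rarr s' ''S'' i = snd (cheb M v k) i) \<and>
    rvar s' ''tc'' = fst (cheb_real (1 + e) k) \<and> rvar s' ''ts'' = snd (cheb_real (1 + e) k)" for k s'
  have "runs (While (RLess (RVar ''tc'') (RVar ''B'')) cheb_body) s2 (\<lambda>t s'. I m s' \<and> t \<le> real m * (42 * N + 1) + 1)"
  proof (rule runs_For)
    have "frame {''i''} coreR testD s s2"
      by (intro frame_trans[OF frame_mono[OF f1] f2]) auto
    then show "I 0 s2" unfolding I_def using C1 S2 s v1 v2 by simp
  next
    fix k s' assume k: "k < m" and I: "I k s'"
    then have f: "frame {''i''} coreR testD s s'" by (simp add: I_def)
    have h: "loaded s'" using loaded_frame[OF s(1) f] by simp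
    have r: "rvar s' ''g'' = \<gamma>" "rvar s' ''mu'' = 1 + e" "rvar s' ''nl'' = - (2 / L)" "rvar s' ''B'' = B"
      using s by (simp_all add: frameD[OF f])
    have C: "\<forall>i<n. rarr s' ''C'' i = fst (cheb M v k) i" "\<forall>i<n. rarr s' ''S'' i = snd (cheb M v k) i"
      using I by (auto simp: I_def)
    have "runs cheb_body s' (\<lambda>t s'. I (Suc k) s' \<and> t \<le> 42 * N)"
    proof (rule runs_mono[OF runs_cheb_body[OF h r(1-3) C M]])
      fix t s'' assume *: "frame {''i''} coreR testD s' s'' \<and>
       (\<forall>i<n. rarr s'' ''C'' i = (M (M (snd (cheb M v k)) + fst (cheb M v k)) - snd (cheb M v k)) i) \<and>
       (\<forall>i<n. rarr s'' ''S'' i = (M (snd (cheb M v k)) + fst (cheb M v k)) i) \<and>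
       rvar s'' ''tc'' = (1 + e) * ((1 + e) * rvar s' ''ts'' + rvar s' ''tc'') - rvar s' ''ts'' \<and>
       rvar s'' ''ts'' = (1 + e) * rvar s' ''ts'' + rvar s' ''tc'' \<and> t \<le> 42 * N"
      have "frame {''i''} coreR testD s s''"
        using f conjunct1[OF *] by (rule frame_trans) auto
      moreover have "rvar s' ''tc'' = fst (cheb_real (1 + e) k)" "rvar s' ''ts'' = snd (cheb_real (1 + e) k)"
        using I by (auto simp: I_def)
      ultimately show "I (Suc k) s'' \<and> t \<le> 42 * N"
        using * unfolding I_def cheb.simps cheb_real.simps fst_conv snd_conv by simp
    qed
    moreover have "bval (RLess (RVar ''tc'') (RVar ''B'')) s'"
      using m(1)[OF k] I r(4) by (simp add: I_def)
    ultimately show "bval (RLess (RVar ''tc'') (RVar ''B'')) s' \<and> runs cheb_body s' (\<lambda>t s'. I (Suc k) s' \<and> t \<le> 42 * N)"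
      by simp
  next
    fix s' assume I: "I m s'"
    then have f: "frame {''i''} coreR testD s s'" by (simp add: I_def)
    show "\<not> bval (RLess (RVar ''tc'') (RVar ''B'')) s'"
      using I m(2) s by (simp add: I_def frameD[OF f])
  qed
  then obtain t3 s3 where e3: "exec (While (RLess (RVar ''tc'') (RVar ''B'')) cheb_body) s2 t3 s3"
    and I3: "I m s3" and t3: "real t3 \<le> real m * (42 * N + 1) + 1"
    unfolding runs_def by blast
  have f3: "frame {''i''} coreR testD s s3"
    and C3: "\<And>i. i < n \<Longrightarrow> rarr s3 ''C'' i = fst (cheb M v m) i" using I3 by (auto simp: I_def)
  note v3 = frameD[OF f3]
  have h3: "loaded s3" using loaded_frame[OF s(1) f3] by simp
  obtain t4 s4 where e4: "exec (sum_loop ''nc'' (RMul (entry ''C'') (entry ''C''))) s3 t4 s4"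
    and f4: "frame {''i''} {''nc''} {} s3 s4"
    and nc: "rvar s4 ''nc'' = (\<Sum>k<n. fst (cheb M v m) k * fst (cheb M v m) k)" and t4: "real t4 \<le> 6 * N"
  proof (rule sum_loopE[OF loaded_n[OF h3], of "''nc''" _ "\<lambda>k. fst (cheb M v m) k * fst (cheb M v m) k"])
    fix k s' assume k: "k < n" "nvar s' ''i'' = k" and f: "frame {''i''} {''nc''} {} s3 s'"
    show "rval (RMul (entry ''C'') (entry ''C'')) s' = fst (cheb M v m) k * fst (cheb M v m) k"
      using k C3 by (simp add: frameD[OF f])
  qed blast
  note v4 = frameD[OF f4]
  have h4: "loaded s4" using loaded_frame[OF h3 f4] by simp
  obtain t5 s5 where e5: "exec (sum_loop ''nv'' (RMul (entry ''v'') (entry ''v''))) s4 t5 s5"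
    and f5: "frame {''i''} {''nv''} {} s4 s5"
    and nv: "rvar s5 ''nv'' = (\<Sum>k<n. v k * v k)" and t5: "real t5 \<le> 6 * N"
  proof (rule sum_loopE[OF loaded_n[OF h4], of "''nv''" _ "\<lambda>k. v k * v k"])
    fix k s' assume k: "k < n" "nvar s' ''i'' = k" and f: "frame {''i''} {''nv''} {} s4 s'"
    show "rval (RMul (entry ''v'') (entry ''v'')) s' = v k * v k"
      using k by (simp add: frameD[OF f] v4 v3 v)
  qed blast
  note v5 = frameD[OF f5]
  show ?thesis
    unfolding runs_def
  proof (intro exI conjI)
    show "exec eig_core s (t1 + (t2 + (t3 + (t4 + t5)))) s5"
      unfolding eig_core_def
      by (rule exec_Seq[OF e1 exec_Seq[OF e2 exec_Seq[OF e3 exec_Seq[OF e4 e5]]]])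
    show "frame {''i''} {''tn'', ''tc'', ''ts'', ''nc'', ''nv''} testD s s5"
      by (intro frame_trans[OF frame_trans[OF frame_mono[OF f3] f4] f5]) auto
    show "B \<le> fst (cheb_real (1 + e) m)" using m(2) .
    show "rvar s5 ''nc'' = ip n (fst (cheb M v m)) (fst (cheb M v m))"
      using nc v5 by (simp add: ip_def)
    show "rvar s5 ''nv'' = ip n v v" using nv by (simp add: ip_def)
    have "real m * (42 * N + 1) \<le> real m * (43 * N)" using N_ge by (intro mult_left_mono) auto
    also have "\<dots> \<le> (1 + 2 * max 0 (ln (2 * B)) / sqrt (2 * e)) * (43 * N)"
      using m(3) N_ge by (intro mult_right_mono) auto
    finally have "real m * (42 * N + 1) \<le> N * (43 + 86 * (max 0 (ln (2 * B)) / sqrt (2 * e)))"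
      by (simp add: algebra_simps)
    then show "real (t1 + (t2 + (t3 + (t4 + t5)))) \<le> N * (66 + 86 * (max 0 (ln (2 * B)) / sqrt (2 * e)))"
      using t1 t2 t3 t4 t5 N_ge by (simp add: algebra_simps)
  qed
qed

end

section \<open>The search for the ends of the semidefinite interval\<close>

abbreviation (input) "g_update \<equiv>
     RAdd (RVar ''gamma_hat'') (RMul (RVar ''sg'') (RAdd (RVar ''lo'') (RVar ''h'')))"
abbreviation (input) "lo_update \<equiv>
     Cond (RLess (RVar ''nv'') (RVar ''nc'')) Skip (RAssign ''lo'' (RAdd (RVar ''lo'') (RVar ''h'')))"

definition eig_step :: com where
  "eig_step =
    Seq (RAssign ''g'' g_update)
   (Seq eig_test
        lo_update)"

text \<open>A failed test at lo + h only shows that lo + 2h is outside. If the end lies below lo +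
  4h, one test therefore brings it below lo + 3h and a second one below lo + 2h, for the updated lo;
  this is four times the halved step, hence two tests per level.\<close>

definition search :: com where
  "search =
    Seq (RAssign ''lo'' (lit 0))
   (Seq (RAssign ''h'' (RDiv (RVar ''zeta'') (lit 2)))
        (While (RLess (RVar ''delta'') (RVar ''h''))
          (Seq eig_step (Seq eig_step (RAssign ''h'' (RDiv (RVar ''h'') (lit 2)))))))"

abbreviation (input) "testR \<equiv> {''mu'', ''nl'', ''tn'', ''B'', ''tc'', ''ts'', ''nc'', ''nv''}"
abbreviation (input) "stepR \<equiv> {''g'', ''lo'', ''mu'', ''nl'', ''tn'', ''B'', ''tc'', ''ts'', ''nc'', ''nv''}"
abbreviation (input) "searchR \<equiv> {''h'', ''g'', ''lo'', ''mu'', ''nl'', ''tn'', ''B'', ''tc'', ''ts'', ''nc'', ''nv''}"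

context gtrs_machine
begin

definition static :: "state \<Rightarrow> bool" where
  "static s \<longleftrightarrow> loaded s \<and> (\<forall>i<n. rarr s ''b0'' i = b0 i) \<and> (\<forall>i<n. rarr s ''b1'' i = b1 i) \<and>
     rvar s ''c1'' = c1 \<and> rvar s ''xi'' = \<xi> \<and> rvar s ''zeta'' = \<zeta> \<and> rvar s ''gamma_hat'' = \<gamma>h \<and>
     rvar s ''epsilon'' = \<epsilon> \<and> rvar s ''p'' = p"

lemma static_frame:
  assumes "static s" "frame {''i''} R D s s'"
    "R \<inter> {''c1'', ''xi'', ''zeta'', ''gamma_hat'', ''epsilon'', ''p''} = {}"
    "D \<inter> {''A0'', ''A1'', ''b0'', ''b1''} = {}"
  shows "static s'"
proof -
  have "loaded s'" using assms by (intro loaded_frame[OF _ assms(2)]) (auto simp: static_def)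
  moreover have "rvar s' x = rvar s x" if "x \<in> {''c1'', ''xi'', ''zeta'', ''gamma_hat'', ''epsilon'', ''p''}" for x
    using that assms(3) by (intro frameD(2)[OF assms(2)]) blast
  moreover have "rarr s' x = rarr s x" if "x \<in> {''b0'', ''b1''}" for x
    using that assms(4) by (intro frameD(3)[OF assms(2)]) blast
  ultimately show ?thesis using assms(1) by (simp add: static_def)
qed

definition gap :: "real \<Rightarrow> real" where "gap h = h * \<xi> / (2 * (\<zeta> * \<zeta>))"

definition thr :: "real \<Rightarrow> real" where "thr h = 64 * (real n * (h / (\<delta> * p) * (h / (\<delta> * p))))"

definition iterate :: "real \<Rightarrow> real \<Rightarrow> (nat \<Rightarrow> real) \<Rightarrow> nat \<Rightarrow> nat \<Rightarrow> real" where
  "iterate \<gamma> h v k = fst (cheb (cheb_op (A \<gamma>) (4 * \<zeta>) (1 + gap h)) v k)"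

text \<open>The degree is left open here and in \<open>failed\<close>: only the fact that some run
  of the recurrence gave this outcome matters. If the smallest eigenvalue lies between 0 and
  h/\<kappa>, either outcome is acceptable.\<close>

definition passed :: "real \<Rightarrow> real \<Rightarrow> (nat \<Rightarrow> real) \<Rightarrow> bool" where
  "passed \<gamma> h v \<longleftrightarrow>
     (\<exists>k. thr h \<le> fst (cheb_real (1 + gap h) k) \<and> ip n (iterate \<gamma> h v k) (iterate \<gamma> h v k) \<le> ip n v v)"

definition failed :: "real \<Rightarrow> real \<Rightarrow> (nat \<Rightarrow> real) \<Rightarrow> bool" where
  "failed \<gamma> h v \<longleftrightarrow> (\<exists>k. ip n v v < ip n (iterate \<gamma> h v k) (iterate \<gamma> h v k))"

definition test_time :: "real \<Rightarrow> real" where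
  "test_time h = N * (72 + 86 * (max 0 (ln (2 * thr h)) / sqrt (2 * gap h)))"

lemma gap_bounds:
  assumes "0 < h" "h \<le> \<zeta>"
  shows "0 < gap h" "2 * gap h \<le> 1"
proof -
  show "0 < gap h" using assms \<xi> \<zeta> by (simp add: gap_def)
  have "h * \<xi> \<le> \<zeta> * \<zeta>" using assms \<xi> \<zeta> by (intro mult_mono) auto
  then show "2 * gap h \<le> 1" using \<zeta> by (simp add: gap_def field_simps)
qed

lemma runs_eig_test:
  assumes s: "static s" "rvar s ''g'' = \<gamma>" "rvar s ''delta'' = \<delta>" "rvar s ''h'' = h"
    and h: "0 < h" "h \<le> \<zeta>" and v: "v = rarr s ''v''"
  shows "runs eig_test s (\<lambda>t s'. frame {''i''} testR testD s s' \<and>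
    (\<exists>k. thr h \<le> fst (cheb_real (1 + gap h) k) \<and> rvar s' ''nc'' = ip n (iterate \<gamma> h v k) (iterate \<gamma> h v k)) \<and>
    rvar s' ''nv'' = ip n v v \<and> t \<le> test_time h)"
proof -
  define s1 where "s1 = s\<lparr>rvar := (rvar s)(''mu'' := 1 + gap h, ''nl'' := - (2 / (4 * \<zeta>)), ''tn'' := h / (\<delta> * p),
    ''B'' := thr h, ''tc'' := 1, ''ts'' := 0)\<rparr>"
  have l: "loaded s" using s by (simp add: static_def)
  then have n: "nvar s ''n'' = n" by (rule loaded_n)
  have l1: "loaded s1" using l by (simp add: s1_def holds_matrices_def)
  have f1: "frame {''i''} testR testD s s1" by (auto simp: s1_def frame_def)
  have "runs eig_core s1 (\<lambda>t s'. frame {''i''} {''tn'', ''tc'', ''ts'', ''nc'', ''nv''} testD s1 s' \<and>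
    (\<exists>k. thr h \<le> fst (cheb_real (1 + gap h) k) \<and> rvar s' ''nc'' = ip n (iterate \<gamma> h v k) (iterate \<gamma> h v k)) \<and>
    rvar s' ''nv'' = ip n v v \<and> t \<le> N * (66 + 86 * (max 0 (ln (2 * thr h)) / sqrt (2 * gap h))))"
    unfolding iterate_def
    using l1 s by (intro runs_eig_core gap_bounds[OF h]) (simp_all add: s1_def v)
  then have "runs eig_core s1 (\<lambda>t s'. frame {''i''} testR testD s s' \<and>
    (\<exists>k. thr h \<le> fst (cheb_real (1 + gap h) k) \<and> rvar s' ''nc'' = ip n (iterate \<gamma> h v k) (iterate \<gamma> h v k)) \<and>
    rvar s' ''nv'' = ip n v v \<and> 1 + (1 + (1 + (1 + (1 + (1 + t))))) \<le> test_time h)"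
  proof (rule runs_mono)
    fix t s' assume *: "frame {''i''} {''tn'', ''tc'', ''ts'', ''nc'', ''nv''} testD s1 s' \<and>
      (\<exists>k. thr h \<le> fst (cheb_real (1 + gap h) k) \<and> rvar s' ''nc'' = ip n (iterate \<gamma> h v k) (iterate \<gamma> h v k)) \<and>
      rvar s' ''nv'' = ip n v v \<and> t \<le> N * (66 + 86 * (max 0 (ln (2 * thr h)) / sqrt (2 * gap h)))"
    have "frame {''i''} testR testD s s'"
      using f1 conjunct1[OF *] by (rule frame_trans) auto
    moreover have "1 + (1 + (1 + (1 + (1 + (1 + t))))) \<le> test_time h"
      using * N_ge by (simp add: test_time_def algebra_simps)
    ultimately show "frame {''i''} testR testD s s' \<and>
      (\<exists>k. thr h \<le> fst (cheb_real (1 + gap h) k) \<and> rvar s' ''nc'' = ip n (iterate \<gamma> h v k) (iterate \<gamma> h v k)) \<and>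
      rvar s' ''nv'' = ip n v v \<and> 1 + (1 + (1 + (1 + (1 + (1 + t))))) \<le> test_time h"
      using * by simp
  qed
  moreover have "runs eig_test s Q \<longleftrightarrow> runs eig_core s1 (\<lambda>t. Q (1 + (1 + (1 + (1 + (1 + (1 + t)))))))" for Q
    using s n unfolding eig_test_def runs_Seq runs_RAssign
    by (simp add: static_def s1_def gap_def thr_def)
  ultimately show ?thesis by simp
qed

lemma runs_eig_step:
  assumes s: "static s" "rvar s ''sg'' = \<sigma>" "rvar s ''delta'' = \<delta>" "rvar s ''h'' = h" "rvar s ''lo'' = lo"
    and h: "0 < h" "h \<le> \<zeta>" and v: "v = rarr s ''v''" and \<gamma>: "\<gamma> = \<gamma>h + \<sigma> * (lo + h)"
  shows "runs eig_step s (\<lambda>t s'. frame {''i''} stepR testD s s' \<and>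
    (rvar s' ''lo'' = lo + h \<and> passed \<gamma> h v \<or>
     rvar s' ''lo'' = lo \<and> failed \<gamma> h v) \<and>
    t \<le> test_time h + 3)"
proof -
  define s1 where "s1 = s\<lparr>rvar := (rvar s)(''g'' := \<gamma>)\<rparr>"
  have f1: "frame {''i''} stepR testD s s1" by (auto simp: s1_def frame_def)
  have f1': "frame {''i''} {''g''} {} s s1" by (auto simp: s1_def frame_def)
  have st1: "static s1" using static_frame[OF s(1) f1'] by simp
  obtain t2 s2 where e2: "exec eig_test s1 t2 s2" and f2: "frame {''i''} testR testD s1 s2"
    and nc: "\<exists>k. thr h \<le> fst (cheb_real (1 + gap h) k) \<and> rvar s2 ''nc'' = ip n (iterate \<gamma> h v k) (iterate \<gamma> h v k)"
    and nv: "rvar s2 ''nv'' = ip n v v" and t2: "real t2 \<le> test_time h"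
    using runs_eig_test[OF st1 _ _ _ h, of \<gamma> v] s v unfolding runs_def by (auto simp: s1_def)
  have r2: "rvar s2 ''lo'' = lo" "rvar s2 ''h'' = h" using s by (simp_all add: frameD[OF f2] s1_def)
  have f02: "frame {''i''} stepR testD s s2" using f1 f2 by (rule frame_trans) auto
  have "runs lo_update s2
    (\<lambda>t s'. frame {''i''} stepR testD s s' \<and> (if rvar s2 ''nv'' < rvar s2 ''nc'' then rvar s' ''lo'' = lo else rvar s' ''lo'' = lo + h) \<and> t \<le> 2)"
    using f02 r2 by (simp add: runs_simps frame_def)
  then obtain t3 s3 where e3: "exec lo_update s2 t3 s3"
    and f3: "frame {''i''} stepR testD s s3"
    and lo3: "if rvar s2 ''nv'' < rvar s2 ''nc'' then rvar s3 ''lo'' = lo else rvar s3 ''lo'' = lo + h" and t3: "real t3 \<le> 2"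
    unfolding runs_def by blast
  have e1: "exec (RAssign ''g'' g_update) s 1 s1"
  proof -
    have "rval g_update s = \<gamma>"
      using s \<gamma> by (simp add: static_def)
    then show ?thesis unfolding s1_def by (metis exec_RAssign)
  qed
  show ?thesis
    unfolding runs_def
  proof (intro exI conjI)
    show "exec eig_step s (1 + (t2 + t3)) s3" unfolding eig_step_def by (rule exec_Seq[OF e1 exec_Seq[OF e2 e3]])
    show "real (1 + (t2 + t3)) \<le> test_time h + 3" using t2 t3 by simp
    show "rvar s3 ''lo'' = lo + h \<and> passed \<gamma> h v \<or>
     rvar s3 ''lo'' = lo \<and> failed \<gamma> h v"
      using lo3 nc nv unfolding passed_def failed_def by (auto simp: not_less split: if_splits)
  qed (rule f3)
qed

section \<open>The search grid and the correctness of its decisions\<close>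

definition step_len :: "nat \<Rightarrow> real" where "step_len j = \<zeta> / 2 ^ Suc j"

text \<open>As long as all decisions are correct, the search stays on the grid of multiples of the step
  length, so the only point where a step can wrongly succeed is the first grid point outside the
  semidefinite interval.  It does not depend on the random vector.\<close>

definition bad_point :: "real \<Rightarrow> nat \<Rightarrow> real" where
  "bad_point \<sigma> j = real (Suc (LEAST m. \<not> Psd \<sigma> (real (Suc m) * step_len j))) * step_len j"

definition bad_vec :: "real \<Rightarrow> nat \<Rightarrow> nat \<Rightarrow> real" where
  "bad_vec \<sigma> j = (SOME u. ip n u u = 1 \<and>
     (\<exists>l\<le>0. \<forall>y. ip n y (A (\<gamma>h + \<sigma> * bad_point \<sigma> j) u) = l * ip n y u))"

definition good :: "(nat \<Rightarrow> real) \<Rightarrow> bool" where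
  "good v \<longleftrightarrow> (\<forall>\<sigma>\<in>{1, -1}. \<forall>j. \<delta> < step_len j \<longrightarrow>
     ip n v v < (thr (step_len j))\<^sup>2 * (ip n (bad_vec \<sigma> j) v)\<^sup>2)"

lemma step_len_pos: "0 < step_len j"
  using \<zeta> by (simp add: step_len_def)

lemma step_len_le: "step_len j \<le> \<zeta> / 2"
proof -
  have "(1::real) \<le> 2 ^ j" by simp
  then show ?thesis using \<zeta> by (simp add: step_len_def field_simps)
qed

lemma bad_point_not_Psd:
  assumes \<sigma>: "\<sigma> = 1 \<or> \<sigma> = -1"
  shows "\<not> Psd \<sigma> (bad_point \<sigma> j)"
proof -
  obtain m :: nat where "\<zeta> / step_len j < real m" using reals_Archimedean2 by blast
  then have "\<zeta> < real (Suc m) * step_len j" using step_len_pos[of j] by (simp add: field_simps)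
  then have "\<not> Psd \<sigma> (real (Suc m) * step_len j)"
    using Psd_le[OF _ \<sigma>, of "real (Suc m) * step_len j"] step_len_pos[of j] by force
  then show ?thesis unfolding bad_point_def by (rule LeastI)
qed

lemma bad_vec:
  assumes \<sigma>: "\<sigma> = 1 \<or> \<sigma> = -1"
  shows "ip n (bad_vec \<sigma> j) (bad_vec \<sigma> j) = 1"
    and "\<exists>l\<le>0. \<forall>y. ip n y (A (\<gamma>h + \<sigma> * bad_point \<sigma> j) (bad_vec \<sigma> j)) = l * ip n y (bad_vec \<sigma> j)"
proof -
  from bad_point_not_Psd[OF \<sigma>] obtain w where "ip n w (A (\<gamma>h + \<sigma> * bad_point \<sigma> j) w) < 0"
    by (auto simp: Psd_def psd_def not_le)
  then obtain u l where "ip n u u = 1 \<and> l \<le> 0 \<and> (\<forall>y. ip n y (A (\<gamma>h + \<sigma> * bad_point \<sigma> j) u) = l * ip n y u)"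
    using neg_eigenvector unfolding A_def by blast
  then have "\<exists>u. ip n u u = 1 \<and> (\<exists>l\<le>0. \<forall>y. ip n y (A (\<gamma>h + \<sigma> * bad_point \<sigma> j) u) = l * ip n y u)"
    by blast
  from someI_ex[OF this] show "ip n (bad_vec \<sigma> j) (bad_vec \<sigma> j) = 1"
    "\<exists>l\<le>0. \<forall>y. ip n y (A (\<gamma>h + \<sigma> * bad_point \<sigma> j) (bad_vec \<sigma> j)) = l * ip n y (bad_vec \<sigma> j)"
    unfolding bad_vec_def by blast+
qed

lemma gap_eq: "gap h = 2 * (h / \<kappa>) / (4 * \<zeta>)"
  using \<xi> \<zeta> by (simp add: gap_def \<kappa>_def field_simps)

text \<open>This disposes of the dependence of \<open>lo\<close> on the random vector. Were lo + h
  outside, then by monotonicity it would be the first outer grid point, because \<open>lo\<close> is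
  a grid point inside. That is \<open>bad_point\<close>, and there a good vector must have
  grown.\<close>

lemma passed_imp_Psd:
  assumes good: "good v" and \<sigma>: "\<sigma> = 1 \<or> \<sigma> = -1" and j: "\<delta> < step_len j"
    and lo: "lo = real m * step_len j" "Psd \<sigma> lo"
    and k: "thr (step_len j) \<le> fst (cheb_real (1 + gap (step_len j)) k)"
    and pass: "ip n (iterate (\<gamma>h + \<sigma> * (lo + step_len j)) (step_len j) v k)
      (iterate (\<gamma>h + \<sigma> * (lo + step_len j)) (step_len j) v k) \<le> ip n v v"
  shows "Psd \<sigma> (lo + step_len j)"
proof (rule ccontr)
  let ?h = "step_len j"
  assume not: "\<not> Psd \<sigma> (lo + ?h)"
  have eq: "lo + ?h = real (Suc m) * ?h" using lo by (simp add: algebra_simps)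
  have "(LEAST m. \<not> Psd \<sigma> (real (Suc m) * ?h)) = m"
  proof (rule Least_equality)
    show "\<not> Psd \<sigma> (real (Suc m) * ?h)" using not eq by simp
    fix m' assume *: "\<not> Psd \<sigma> (real (Suc m') * ?h)"
    show "m \<le> m'"
    proof (rule ccontr)
      assume "\<not> m \<le> m'"
      then have "real (Suc m') * ?h \<le> real m * ?h" using step_len_pos[of j] by (intro mult_right_mono) auto
      then have "Psd \<sigma> (real (Suc m') * ?h)"
        using lo step_len_pos[of j] by (intro Psd_mono[OF lo(2) _ _ \<sigma>]) auto
      with * show False by simp
    qed
  qed
  then have bp: "bad_point \<sigma> j = lo + ?h" unfolding bad_point_def eq by simp
  from bad_vec(2)[OF \<sigma>, of j] obtain l where
    l: "l \<le> 0" "\<And>y. ip n y (A (\<gamma>h + \<sigma> * (lo + ?h)) (bad_vec \<sigma> j)) = l * ip n y (bad_vec \<sigma> j)"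
    unfolding bp by blast
  have "(thr ?h)\<^sup>2 * (ip n (bad_vec \<sigma> j) v)\<^sup>2 \<le> ip n v v"
  proof (rule cheb_test_growth[OF A_self_adjoint l(2,1) bad_vec(1)[OF \<sigma>]])
    show "0 < 4 * \<zeta>" "0 \<le> ?h / \<kappa>" "0 \<le> thr ?h"
      using \<zeta> \<kappa>_ge_1 step_len_pos[of j] by (auto simp: thr_def)
    show "thr ?h \<le> fst (cheb_real (1 + 2 * (?h / \<kappa>) / (4 * \<zeta>)) k)"
      using k by (simp only: gap_eq)
    show "ip n (fst (cheb (cheb_op (A (\<gamma>h + \<sigma> * (lo + ?h))) (4 * \<zeta>) (1 + 2 * (?h / \<kappa>) / (4 * \<zeta>))) v k))
       (fst (cheb (cheb_op (A (\<gamma>h + \<sigma> * (lo + ?h))) (4 * \<zeta>) (1 + 2 * (?h / \<kappa>) / (4 * \<zeta>))) v k)) \<le> ip n v v"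
      using pass by (simp only: gap_eq iterate_def)
  qed
  moreover have "ip n v v < (thr ?h)\<^sup>2 * (ip n (bad_vec \<sigma> j) v)\<^sup>2"
    using good \<sigma> j by (auto simp: good_def)
  ultimately show False by simp
qed

text \<open>No randomness is involved: were the interval to reach r + h, the form at r would be at
  least h/\<kappa> and the iteration a contraction for every start vector. Hence a failure at r
  excludes r + h, not r.\<close>

lemma failed_imp_not_Psd:
  assumes \<sigma>: "\<sigma> = 1 \<or> \<sigma> = -1" and r: "0 \<le> r" "0 < h"
    and fail: "ip n v v < ip n (iterate (\<gamma>h + \<sigma> * r) h v k) (iterate (\<gamma>h + \<sigma> * r) h v k)"
  shows "\<not> Psd \<sigma> (r + h)"
proof
  assume P: "Psd \<sigma> (r + h)"
  have "Psd \<sigma> r" by (rule Psd_mono[OF P _ _ \<sigma>]) (use r in auto)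
  then have "psd (\<gamma>h + \<sigma> * r)" by (simp add: Psd_def)
  then have abs: "\<bar>\<gamma>h + \<sigma> * r\<bar> \<le> \<zeta>" using psd_pos psd_le_\<zeta> by force
  have "ip n (fst (cheb (cheb_op (A (\<gamma>h + \<sigma> * r)) (4 * \<zeta>) (1 + 2 * (h / \<kappa>) / (4 * \<zeta>))) v k))
     (fst (cheb (cheb_op (A (\<gamma>h + \<sigma> * r)) (4 * \<zeta>) (1 + 2 * (h / \<kappa>) / (4 * \<zeta>))) v k)) \<le> ip n v v"
  proof (rule cheb_test_bounded[OF A_self_adjoint])
    fix w
    show "h / \<kappa> * ip n w w \<le> ip n w (A (\<gamma>h + \<sigma> * r) w)"
      using form_lower_if_Psd[OF P \<sigma> r] .
    have "(1 + \<bar>\<gamma>h + \<sigma> * r\<bar>) * ip n w w \<le> (4 * \<zeta>) * ip n w w"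
      using abs \<zeta> by (intro mult_right_mono) auto
    then show "ip n w (A (\<gamma>h + \<sigma> * r) w) \<le> 4 * \<zeta> * ip n w w"
      using form_upper[of w "\<gamma>h + \<sigma> * r"] by linarith
  qed (use \<zeta> \<kappa>_ge_1 r in auto)
  then show False using fail by (simp add: iterate_def gap_eq)
qed

lemma step_logic:
  assumes good: "good v" and \<sigma>: "\<sigma> = 1 \<or> \<sigma> = -1" and j: "\<delta> < step_len j" and h: "h = step_len j"
    and lo: "lo = real m * h" "Psd \<sigma> lo" and \<gamma>: "\<gamma> = \<gamma>h + \<sigma> * (lo + h)"
    and res: "lo' = lo + h \<and> passed \<gamma> h v \<or>
      lo' = lo \<and> failed \<gamma> h v"
  shows "Psd \<sigma> lo'" "lo' = lo + h \<or> lo' = lo \<and> \<not> Psd \<sigma> (lo + 2 * h)"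
proof -
  have hpos: "0 < h" using h step_len_pos by simp
  have "Psd \<sigma> lo' \<and> (lo' = lo + h \<or> lo' = lo \<and> \<not> Psd \<sigma> (lo + 2 * h))"
    using res unfolding passed_def failed_def
  proof (elim disjE conjE exE)
    fix k assume "lo' = lo + h" "thr h \<le> fst (cheb_real (1 + gap h) k)"
      "ip n (iterate \<gamma> h v k) (iterate \<gamma> h v k) \<le> ip n v v"
    then show ?thesis using passed_imp_Psd[OF good \<sigma> j, of lo m k] lo h \<gamma> by simp
  next
    fix k assume "lo' = lo" "ip n v v < ip n (iterate \<gamma> h v k) (iterate \<gamma> h v k)"
    then show ?thesis using failed_imp_not_Psd[OF \<sigma>, of "lo + h" h v k] lo hpos \<gamma> by (simp add: algebra_simps)
  qed
  then show "Psd \<sigma> lo'" "lo' = lo + h \<or> lo' = lo \<and> \<not> Psd \<sigma> (lo + 2 * h)" by auto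
qed

text \<open>The order of the cost of a test at the finest resolution: about sqrt(\<kappa>
  \<zeta>/\<delta>) rounds per unit of the logarithm, each with a bounded number of matrix
  products.\<close>

definition level_cost :: real where
  "level_cost = N * (sqrt (\<kappa> * \<zeta> / \<delta>) * log_factor (real n / p))"

section \<open>Cost of the search\<close>

lemma log_factor_ge: "1 \<le> log_factor x" "ln x \<le> log_factor x"
  by (simp_all add: log_factor_def)

text \<open>Let y be the fourth root of \<delta>/h. The number of rounds per unit of the logarithm
  decays like y^2, while the logarithm of the threshold exceeds a multiple of log(n/p) by O(1/y)
  only. One power of y survives, so the bound grows by the factor 2^(1/4) from level to level and
  its sum is dominated by the last one.\<close>

lemma test_time_le:
  assumes h: "\<delta> < h" "h \<le> \<zeta>"
  shows "test_time h \<le> 1548 * (level_cost * sqrt (sqrt (\<delta> / h)))" "1 \<le> level_cost * sqrt (sqrt (\<delta> / h))"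
proof -
  define y where "y = sqrt (sqrt (\<delta> / h))"
  define Q where "Q = sqrt (\<kappa> * \<zeta> / \<delta>)"
  define lf where "lf = log_factor (real n / p)"
  have hp: "0 < h" using h \<delta>_pos by simp
  have y0: "0 < y" using hp \<delta>_pos by (simp add: y_def)
  have y2: "y\<^sup>2 = sqrt (\<delta> / h)" using hp \<delta>_pos by (simp add: y_def)
  have y4: "y ^ 4 = \<delta> / h"
  proof -
    have "y ^ 4 = (y\<^sup>2)\<^sup>2" by (simp add: power_mult[symmetric])
    also have "\<dots> = \<delta> / h" unfolding y2 using hp \<delta>_pos by simp
    finally show ?thesis .
  qed
  have "sqrt (\<delta> / h) \<le> 1" using hp h by simp
  then have y1: "y \<le> 1" unfolding y_def by simp
  have lf: "1 \<le> lf" "ln (real n / p) \<le> lf" using log_factor_ge by (simp_all add: lf_def)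
  have Q: "1 \<le> Q * y\<^sup>2"
  proof -
    have "h \<le> \<kappa> * \<zeta>" using h \<kappa>_ge_1 \<zeta> mult_right_mono[of 1 \<kappa> \<zeta>] by linarith
    then have "1 \<le> (\<kappa> * \<zeta> / \<delta>) * (\<delta> / h)" using hp \<delta>_pos by (simp add: field_simps)
    then have "1 \<le> sqrt ((\<kappa> * \<zeta> / \<delta>) * (\<delta> / h))" by simp
    then show ?thesis unfolding Q_def y2 real_sqrt_mult .
  qed
  have Q0: "0 \<le> Q" using \<kappa>_ge_1 \<zeta> \<delta>_pos by (simp add: Q_def)
  have inv: "1 / sqrt (2 * gap h) = Q * y\<^sup>2"
  proof -
    have "1 / (2 * gap h) = (\<kappa> * \<zeta> / \<delta>) * (\<delta> / h)"
      using \<xi> \<zeta> \<delta>_pos hp by (simp add: gap_def \<kappa>_def field_simps)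
    then have "sqrt (1 / (2 * gap h)) = sqrt (\<kappa> * \<zeta> / \<delta>) * sqrt (\<delta> / h)" by (simp only: real_sqrt_mult)
    then show ?thesis unfolding Q_def y2 by (simp add: real_sqrt_divide)
  qed
  have logs: "max 0 (ln (2 * thr h)) \<le> 9 * lf + 8 / y"
  proof -
    have l128: "ln (128::real) = 7 * ln 2" using ln_realpow[of 2 7] by simp
    have "2 * thr h = 128 * real n * ((h / \<delta>) ^ 2 / p ^ 2)"
      by (simp add: thr_def power2_eq_square mult_ac)
    also have "ln \<dots> = 7 * ln 2 + ln (real n) + (2 * ln (h / \<delta>) - 2 * ln p)"
      using n_pos hp \<delta>_pos p by (simp add: ln_mult ln_div ln_realpow l128)
    finally have "ln (2 * thr h) = 7 * ln 2 + ln (real n) + 2 * ln (h / \<delta>) - 2 * ln p" by simp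
    moreover have "ln (2::real) \<le> 1" using ln_le_minus_one[of 2] by simp
    moreover have "0 \<le> ln (real n)" using n_pos by simp
    moreover have "ln (real n / p) = ln (real n) - ln p" using n_pos p by (simp add: ln_div)
    \<comment> \<open>The inequality ln z \<le> z - 1 is used for the fourth root z = 1/y, which
      costs only half of the decay available in y^2.\<close>
    moreover have "ln (h / \<delta>) \<le> 4 / y"
    proof -
      have "h / \<delta> = (1 / y) ^ 4" using y4 by (simp add: power_divide)
      then have "ln (h / \<delta>) = 4 * ln (1 / y)" using y0 by (simp add: ln_realpow)
      moreover have "ln (1 / y) \<le> 1 / y - 1" using y0 by (intro ln_le_minus_one) simp
      ultimately show ?thesis by simp
    qed
    ultimately have "ln (2 * thr h) \<le> 9 * lf + 8 / y" using lf by linarith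
    moreover have "0 \<le> 9 * lf + 8 / y" using lf y0 by simp
    ultimately show ?thesis by simp
  qed
  have "1 \<le> Q * y * 1"
  proof -
    have "y\<^sup>2 \<le> y" using y0 y1 by (simp add: power2_eq_square mult_left_le)
    then have "Q * y\<^sup>2 \<le> Q * y" using Q0 by (rule mult_left_mono)
    then show ?thesis using Q by simp
  qed
  also have "\<dots> \<le> Q * y * lf" using lf Q0 y0 by (intro mult_left_mono) auto
  finally have one: "1 \<le> Q * lf * y" by (simp add: mult_ac)
  have "max 0 (ln (2 * thr h)) / sqrt (2 * gap h) = max 0 (ln (2 * thr h)) * (Q * y\<^sup>2)"
    unfolding inv[symmetric] by simp
  also have "\<dots> \<le> (9 * lf + 8 / y) * (Q * y\<^sup>2)"
    using logs Q by (intro mult_right_mono) auto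
  also have "\<dots> = Q * (9 * (lf * y\<^sup>2) + 8 * y)" using y0 by (simp add: power2_eq_square field_simps)
  also have "\<dots> \<le> Q * (9 * (lf * y) + 8 * (lf * y))"
  proof (intro mult_left_mono add_mono)
    show "y\<^sup>2 \<le> y" using y0 y1 by (simp add: power2_eq_square mult_left_le)
    show "y \<le> lf * y" using lf y0 by simp
  qed (use Q0 lf in auto)
  finally have two: "max 0 (ln (2 * thr h)) / sqrt (2 * gap h) \<le> 17 * (Q * lf * y)" by (simp add: algebra_simps)
  have N0: "1 \<le> N" by (rule N_ge)
  have "test_time h \<le> N * (72 * (Q * lf * y) + 86 * (17 * (Q * lf * y)))"
    unfolding test_time_def using one two N0 by (intro mult_left_mono) auto
  also have "\<dots> = 1534 * (N * (Q * lf) * y)" by simp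
  also have "\<dots> \<le> 1548 * (N * (Q * lf) * y)"
    using mult_mono[of 1 N 0 "Q * lf * y"] one N0 by (simp add: mult_ac)
  finally show "test_time h \<le> 1548 * (level_cost * sqrt (sqrt (\<delta> / h)))"
    unfolding level_cost_def Q_def lf_def y_def .
  have "1 * 1 \<le> N * (Q * lf * y)" using one N0 by (intro mult_mono) auto
  then show "1 \<le> level_cost * sqrt (sqrt (\<delta> / h))"
    unfolding level_cost_def Q_def lf_def y_def by (simp add: mult_ac)
qed

lemma runs_search:
  assumes s: "static s" "rvar s ''sg'' = \<sigma>" "rvar s ''delta'' = \<delta>" "v = rarr s ''v''"
    and \<sigma>: "\<sigma> = 1 \<or> \<sigma> = -1"
  shows "runs search s (\<lambda>t s'. frame {''i''} searchR testD s s' \<and>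
    0 < rvar s' ''h'' \<and> rvar s' ''h'' \<le> \<delta> \<and> 0 \<le> rvar s' ''lo'' \<and>
    (good v \<longrightarrow> Psd \<sigma> (rvar s' ''lo'') \<and> \<not> Psd \<sigma> (rvar s' ''lo'' + 4 * rvar s' ''h'')) \<and>
    t \<le> 40000 * level_cost + 3)"
proof -
  define s1 where "s1 = s\<lparr>rvar := (rvar s)(''lo'' := 0, ''h'' := \<zeta> / 2)\<rparr>"
  define W where "W = 3200 * level_cost"
  \<comment> \<open>A level with fourth root y costs at most W y. Halving h multiplies y by 2^(1/4)
    \<ge> 7/6, so the potential drops by at least 6 W (y/6). It stays nonnegative because h >
    \<delta>/2 keeps y below 2.\<close>
  define \<Phi> where "\<Phi> s' = 6 * W * (2 - sqrt (sqrt (\<delta> / rvar s' ''h'')))" for s' :: state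
  define I where "I s' \<longleftrightarrow> frame {''i''} searchR testD s s' \<and>
    (\<exists>j m. rvar s' ''h'' = step_len j \<and> rvar s' ''lo'' = real m * step_len j \<and> \<delta> / 2 < step_len j \<and>
      (good v \<longrightarrow> Psd \<sigma> (real m * step_len j) \<and> \<not> Psd \<sigma> (real m * step_len j + 4 * step_len j)))" for s'
  let ?b = "RLess (RVar ''delta'') (RVar ''h'')"
  let ?c = "Seq eig_step (Seq eig_step (RAssign ''h'' (RDiv (RVar ''h'') (lit 2))))"
  have \<delta>\<zeta>: "\<delta> < \<zeta>"
  proof -
    have "\<delta> \<le> \<kappa> * \<zeta> / (1000 * \<kappa>\<^sup>2)" unfolding \<delta>_def using \<epsilon> \<kappa>_ge_1 by (intro divide_right_mono) auto
    also have "\<dots> = \<zeta> / (1000 * \<kappa>)" using \<kappa>_ge_1 by (simp add: power2_eq_square)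
    also have "\<dots> < \<zeta> / 1" using \<kappa>_ge_1 \<zeta> by (intro divide_strict_left_mono) auto
    finally show ?thesis by simp
  qed
  have lc: "0 \<le> level_cost"
    using N_ge \<kappa>_ge_1 \<zeta> \<delta>_pos log_factor_ge(1)[of "real n / p"] by (simp add: level_cost_def)
  have "runs (While ?b ?c) s1 (\<lambda>t s'. I s' \<and> \<not> bval ?b s' \<and> t \<le> \<Phi> s1 + 1)"
  proof (rule runs_While_potential)
    \<comment> \<open>The first step is \<zeta>/2, so the invariant with 4 h starts at 2 \<zeta>,
      which exceeds every distance inside the interval.\<close>
    have "\<not> Psd \<sigma> (2 * \<zeta>)" using Psd_le[OF _ \<sigma>, of "2 * \<zeta>"] \<zeta> by auto
    moreover have "frame {''i''} searchR testD s s1" by (auto simp: s1_def frame_def)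
    ultimately show "I s1" unfolding I_def using Psd_0 \<delta>\<zeta>
      by (intro conjI exI[of _ 0]) (auto simp: s1_def step_len_def)
  next
    fix s' assume I: "I s'" and b: "bval ?b s'"
    then obtain j m where f: "frame {''i''} searchR testD s s'"
      and h: "rvar s' ''h'' = step_len j" and lo: "rvar s' ''lo'' = real m * step_len j"
      and P: "good v \<Longrightarrow> Psd \<sigma> (real m * step_len j) \<and> \<not> Psd \<sigma> (real m * step_len j + 4 * step_len j)"
      unfolding I_def by blast
    define H where "H = step_len j"
    have H: "0 < H" "H \<le> \<zeta>" using step_len_pos[of j] step_len_le[of j] \<zeta> by (auto simp: H_def)
    have \<delta>H: "\<delta> < H" using b h s by (simp add: frameD[OF f] H_def)
    have st: "static s'" using static_frame[OF s(1) f] by simp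
    have r: "rvar s' ''sg'' = \<sigma>" "rvar s' ''delta'' = \<delta>" "v = rarr s' ''v''"
      using s by (simp_all add: frameD[OF f])
    obtain t1 s1' where e1: "exec eig_step s' t1 s1'" and f1: "frame {''i''} stepR testD s' s1'"
      and res1: "rvar s1' ''lo'' = real m * H + H \<and> passed (\<gamma>h + \<sigma> * (real m * H + H)) H v \<or>
        rvar s1' ''lo'' = real m * H \<and> failed (\<gamma>h + \<sigma> * (real m * H + H)) H v"
      and t1: "real t1 \<le> test_time H + 3"
      using runs_eig_step[OF st r(1,2) h[folded H_def] lo[folded H_def] H r(3) refl] unfolding runs_def by blast
    define lo1 where "lo1 = rvar s1' ''lo''"
    have "lo1 = real (m + 1) * H \<or> lo1 = real m * H" using res1 by (auto simp: lo1_def algebra_simps)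
    then obtain m1 :: nat where m1: "lo1 = real m1 * H" by blast
    have st1: "static s1'" using static_frame[OF st f1] by simp
    have r1: "rvar s1' ''sg'' = \<sigma>" "rvar s1' ''delta'' = \<delta>" "v = rarr s1' ''v''" "rvar s1' ''h'' = H"
      using r h by (simp_all add: frameD[OF f1] H_def)
    obtain t2 s2 where e2: "exec eig_step s1' t2 s2" and f2: "frame {''i''} stepR testD s1' s2"
      and res2: "rvar s2 ''lo'' = lo1 + H \<and> passed (\<gamma>h + \<sigma> * (lo1 + H)) H v \<or>
        rvar s2 ''lo'' = lo1 \<and> failed (\<gamma>h + \<sigma> * (lo1 + H)) H v"
      and t2: "real t2 \<le> test_time H + 3"
      using runs_eig_step[OF st1 r1(1,2,4) lo1_def[symmetric] H r1(3) refl] unfolding runs_def by blast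
    define lo2 where "lo2 = rvar s2 ''lo''"
    have "lo2 = real (m1 + 1) * H \<or> lo2 = real m1 * H" using res2 m1 by (auto simp: lo2_def algebra_simps)
    then obtain m2 :: nat where m2: "lo2 = real m2 * H" by blast
    have P2: "Psd \<sigma> lo2 \<and> \<not> Psd \<sigma> (lo2 + 2 * H)" if good: "good v"
    proof -
      note one = step_logic[OF good \<sigma> \<delta>H[unfolded H_def] H_def refl _ refl res1[folded lo1_def]]
      have P1: "Psd \<sigma> lo1" "lo1 = real m * H + H \<or> lo1 = real m * H \<and> \<not> Psd \<sigma> (real m * H + 2 * H)"
        using one P[OF good] by (simp_all add: H_def)
      note two = step_logic[OF good \<sigma> \<delta>H[unfolded H_def] H_def m1 P1(1) refl res2[folded lo2_def]]
      have not4: "\<not> Psd \<sigma> (real m * H + 4 * H)" using P[OF good] by (simp add: H_def)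
      have lo0: "0 \<le> lo1" using m1 H by simp
      \<comment> \<open>After either outcome the end lies below lo1 + 3 H: a pass shifts the bound 4
        H of the invariant by H, and a failure already gives the stronger bound 2 H.\<close>
      have "\<not> Psd \<sigma> (lo1 + H + 2 * H)"
      proof
        assume Q: "Psd \<sigma> (lo1 + H + 2 * H)"
        from P1(2) show False
        proof
          assume "lo1 = real m * H + H"
          then have "lo1 + H + 2 * H = real m * H + 4 * H" by simp
          then show False using Q not4 by metis
        next
          assume *: "lo1 = real m * H \<and> \<not> Psd \<sigma> (real m * H + 2 * H)"
          have "Psd \<sigma> (lo1 + 2 * H)" by (rule Psd_mono[OF Q _ _ \<sigma>]) (use lo0 H in auto)
          then show False using * by simp
        qed
      qed
      then show ?thesis using two by auto
    qed
    define s3 where "s3 = s2\<lparr>rvar := (rvar s2)(''h'' := H / 2)\<rparr>"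
    have h2: "rvar s2 ''h'' = H" using r1(4) by (simp add: frameD[OF f2])
    have e3: "exec (RAssign ''h'' (RDiv (RVar ''h'') (lit 2))) s2 1 s3"
      unfolding s3_def using exec_RAssign[of "''h''" "RDiv (RVar ''h'') (lit 2)" s2] h2 by simp
    have f02: "frame {''i''} searchR testD s s2"
      by (intro frame_trans[OF frame_trans[OF f f1] f2]) auto
    have f3: "frame {''i''} searchR testD s s3" using f02 by (auto simp: s3_def frame_def)
    have H2: "H / 2 = step_len (Suc j)" by (simp add: H_def step_len_def)
    \<comment> \<open>The grids are nested: halving the step doubles the index of \<open>lo\<close>,
      which stays a grid point as \<open>passed_imp_Psd\<close> requires.\<close>
    have m2': "lo2 = real (2 * m2) * step_len (Suc j)" using m2 by (simp add: H2[symmetric])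
    have "I s3" unfolding I_def
    proof (intro conjI exI)
      show "frame {''i''} searchR testD s s3" by (rule f3)
      show "rvar s3 ''h'' = step_len (Suc j)" by (simp add: s3_def H2)
      show "rvar s3 ''lo'' = real (2 * m2) * step_len (Suc j)" using m2' by (simp add: s3_def lo2_def)
      show "\<delta> / 2 < step_len (Suc j)" using \<delta>H by (simp add: H2[symmetric])
      show "good v \<longrightarrow> Psd \<sigma> (real (2 * m2) * step_len (Suc j)) \<and> \<not> Psd \<sigma> (real (2 * m2) * step_len (Suc j) + 4 * step_len (Suc j))"
        unfolding m2'[symmetric] using P2 by (simp add: H2[symmetric])
    qed
    moreover have "real (t1 + (t2 + 1)) + 1 + \<Phi> s3 \<le> \<Phi> s'"
    proof -
      define y where "y = sqrt (sqrt (\<delta> / H))"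
      have "\<delta> / (H / 2) = 2 * (\<delta> / H)" by simp
      then have y3: "sqrt (sqrt (\<delta> / (H / 2))) = sqrt (sqrt 2) * y" by (simp only: real_sqrt_mult y_def)
      have "7 / 6 \<le> sqrt (sqrt (2::real))"
        by (intro real_le_rsqrt) (simp add: power2_eq_square)
      moreover have "0 \<le> W * y" using lc \<delta>_pos H by (simp add: W_def y_def)
      ultimately have "W * y * (7 / 6) \<le> W * y * sqrt (sqrt 2)" by (intro mult_left_mono)
      then have "W * y \<le> 6 * W * (sqrt (sqrt 2) * y - y)" by (simp add: algebra_simps)
      moreover have "\<Phi> s' - \<Phi> s3 = 6 * W * (sqrt (sqrt 2) * y - y)"
        unfolding \<Phi>_def s3_def using h y3 by (simp add: H_def[symmetric] y_def[symmetric] algebra_simps)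
      moreover have "real (t1 + (t2 + 1)) + 1 \<le> W * y"
        using t1 t2 test_time_le[OF \<delta>H H(2)] unfolding W_def y_def[symmetric] by simp
      ultimately show ?thesis by linarith
    qed
    ultimately show "runs ?c s' (\<lambda>t s''. I s'' \<and> t + 1 + \<Phi> s'' \<le> \<Phi> s')"
      unfolding runs_def using exec_Seq[OF e1 exec_Seq[OF e2 e3]] by blast
  next
    fix s' assume "I s'"
    then obtain j where h: "rvar s' ''h'' = step_len j" "\<delta> / 2 < step_len j" unfolding I_def by blast
    have "\<delta> / step_len j \<le> 2" using h step_len_pos[of j] by (simp add: field_simps)
    then have "sqrt (sqrt (\<delta> / step_len j)) \<le> sqrt (sqrt 16)" by (intro real_sqrt_le_mono) simp
    also have "sqrt (sqrt 16) = (2::real)"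
    proof -
      have "sqrt 16 = sqrt ((4::real)\<^sup>2)" by simp
      also have "\<dots> = 4" by (simp only: real_sqrt_abs)
      finally show ?thesis by simp
    qed
    finally show "0 \<le> \<Phi> s'" unfolding \<Phi>_def h(1) using lc by (simp add: W_def)
  qed
  moreover have "runs search s Q \<longleftrightarrow> runs (While ?b ?c) s1 (\<lambda>t. Q (1 + (1 + t)))" for Q
    using s unfolding search_def runs_Seq runs_RAssign by (simp add: static_def s1_def)
  moreover have "\<Phi> s1 \<le> 40000 * level_cost"
  proof -
    have "0 \<le> sqrt (sqrt (\<delta> / rvar s1 ''h''))" using \<delta>_pos \<zeta> by (simp add: s1_def)
    then have "6 * W * (2 - sqrt (sqrt (\<delta> / rvar s1 ''h''))) \<le> 6 * W * 2"
      using lc by (intro mult_left_mono) (auto simp: W_def)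
    then show ?thesis using lc by (simp add: \<Phi>_def W_def)
  qed
  ultimately have "runs (While ?b ?c) s1 (\<lambda>t s'. I s' \<and> \<not> bval ?b s' \<and> 1 + (1 + t) \<le> 40000 * level_cost + 3)"
    and unfold: "\<And>Q. runs search s Q \<longleftrightarrow> runs (While ?b ?c) s1 (\<lambda>t. Q (1 + (1 + t)))"
    by (auto elim!: runs_mono)
  then show ?thesis unfolding unfold
  proof (elim runs_mono)
    fix t s' assume *: "I s' \<and> \<not> bval ?b s' \<and> 1 + (1 + t) \<le> 40000 * level_cost + 3"
    then obtain j m where f: "frame {''i''} searchR testD s s'"
      and h: "rvar s' ''h'' = step_len j" and lo: "rvar s' ''lo'' = real m * step_len j"
      and P: "good v \<longrightarrow> Psd \<sigma> (real m * step_len j) \<and> \<not> Psd \<sigma> (real m * step_len j + 4 * step_len j)"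
      unfolding I_def by blast
    have "rvar s' ''delta'' = \<delta>" using s by (simp add: frameD[OF f])
    then show "frame {''i''} searchR testD s s' \<and>
      0 < rvar s' ''h'' \<and> rvar s' ''h'' \<le> \<delta> \<and> 0 \<le> rvar s' ''lo'' \<and>
      (good v \<longrightarrow> Psd \<sigma> (rvar s' ''lo'') \<and> \<not> Psd \<sigma> (rvar s' ''lo'' + 4 * rvar s' ''h'')) \<and>
      1 + (1 + t) \<le> 40000 * level_cost + 3"
      using f P * h step_len_pos[of j] by (simp add: lo)
  qed
qed

end

section \<open>The program\<close>

definition sample_vector :: com where
  "sample_vector = for_loop ''n'' (Seq (Sample ''u'') (RStore ''v'' (NVar ''i'') (RVar ''u'')))"

abbreviation (input) "t_update \<equiv>
     RDiv (RAdd (lit 1) (RSqrt (RAdd (lit 1) (RMul (lit 4) (RMul (RVar ''t'') (RVar ''t'')))))) (lit 2)"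
abbreviation (input) "y_update \<equiv>
     RAdd (entry ''x'') (RMul (RDiv (lit 1) (RVar ''t'')) (RSub (entry ''z'') (entry ''x'')))"
abbreviation (input) "df_summand \<equiv>
     RMul (entry ''y'') (RAdd (RSub (entry ''G'') (entry ''H'')) (RMul (RMul (lit 2) (RSub (RVar ''gm'')
     (RVar ''gp''))) (entry ''b1'')))"
abbreviation (input) "G_update \<equiv>
     RMul (lit 2) (RAdd (entry ''G'') (RAdd (entry ''b0'') (RMul (RVar ''gm'') (entry ''b1''))))"
abbreviation (input) "H_update \<equiv>
     RMul (lit 2) (RAdd (entry ''H'') (RAdd (entry ''b0'') (RMul (RVar ''gp'') (entry ''b1''))))"
abbreviation (input) "num_summand \<equiv>
     RMul (entry ''H'') (RSub (entry ''G'') (entry ''H''))"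
abbreviation (input) "num_update \<equiv>
     RSub (RMul (RMul (lit 4) (RVar ''zeta'')) (RAdd (RVar ''df'') (RMul (RSub (RVar ''gm'') (RVar
     ''gp'')) (RVar ''c1'')))) (RVar ''num'')"
abbreviation (input) "den_summand \<equiv>
     RMul (RSub (entry ''G'') (entry ''H'')) (RSub (entry ''G'') (entry ''H''))"
abbreviation (input) "x_update \<equiv>
     RSub (entry ''y'') (RMul (RDiv (lit 1) (RMul (lit 4) (RVar ''zeta''))) (RAdd (RMul (RVar ''lam'')
     (entry ''G'')) (RMul (RSub (lit 1) (RVar ''lam'')) (entry ''H''))))"
abbreviation (input) "z_update \<equiv>
     RAdd (entry ''z'') (RMul (RVar ''t'') (RSub (entry ''x'') (entry ''y'')))"

definition agd_weight :: com where
  "agd_weight =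
    Cond (RLess (lit 0) (RVar ''num''))
      (Cond (RLess (RVar ''num'') (RVar ''den''))
        (RAssign ''lam'' (RDiv (RVar ''num'') (RVar ''den'')))
        (RAssign ''lam'' (lit 1)))
      (RAssign ''lam'' (lit 0))"

definition agd_body :: com where
  "agd_body =
    Seq (RAssign ''t'' t_update)
   (Seq (vec_loop ''y'' y_update)
   (Seq (mat_vec (RVar ''gm'') ''y'' ''G'')
   (Seq (mat_vec (RVar ''gp'') ''y'' ''H'')
   (Seq (sum_loop ''df'' df_summand)
   (Seq (vec_loop ''G'' G_update)
   (Seq (vec_loop ''H'' H_update)
   (Seq (sum_loop ''num'' num_summand)
   (Seq (RAssign ''num'' num_update)
   (Seq (sum_loop ''den'' den_summand)
   (Seq agd_weight
   (Seq (vec_loop ''x'' x_update)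
        (vec_loop ''z'' z_update))))))))))))"

text \<open>The initial potential is at most 2 \<zeta> 25 \<kappa>^2 = 50 \<zeta> \<kappa>^2.
  Stopping once t^2 \<epsilon> \<ge> 400 \<zeta> \<kappa>^2 makes the remaining error at most
  \<epsilon>/8.\<close>

definition agd_guard :: bexp where
  "agd_guard = RLess (RMul (RMul (RVar ''t'') (RVar ''t'')) (RVar ''epsilon''))
     (RMul (RMul (lit 400) (RVar ''zeta'')) (RMul (RDiv (RVar ''zeta'') (RVar ''xi'')) (RDiv (RVar ''zeta'') (RVar ''xi''))))"

text \<open>Starting with t = 0 removes the value at the start point from the potential; the first
  step then has parameter 1.\<close>

definition agd :: com where
  "agd = Seq (RAssign ''t'' (lit 0)) (Seq (vec_loop ''x'' (lit 0)) (Seq (vec_loop ''z'' (lit 0))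
     (While agd_guard agd_body)))"

abbreviation (input) "set_delta \<equiv>
     Seq (RAssign ''delta'' (RDiv (RMul (RVar ''epsilon'') (RMul (RVar ''xi'') (RVar ''xi''))) (RMul (lit
     1000) (RMul (RVar ''zeta'') (RVar ''zeta''))))) (RAssign ''sg'' (lit 1))"
abbreviation (input) "set_plus \<equiv>
     Seq (RAssign ''gp'' (RAdd (RVar ''gamma_hat'') (RVar ''lo''))) (Seq (RAssign ''gamma_plus'' (RAdd
     (RVar ''gamma_hat'') (RAdd (RVar ''lo'') (RMul (lit 4) (RVar ''h''))))) (RAssign ''sg'' (RSub (lit
     0) (lit 1))))"
text \<open>The returned lower parameter must be nonnegative, for otherwise a feasible point could
  have a value above its q0. Clipping at 0 keeps it outside the interval, because A0 has a negative
  eigenvalue.\<close>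

abbreviation (input) "set_minus \<equiv>
     Seq (RAssign ''gm'' (RSub (RVar ''gamma_hat'') (RVar ''lo''))) (Seq (RAssign ''gamma_minus'' (RSub
     (RVar ''gamma_hat'') (RAdd (RVar ''lo'') (RMul (lit 4) (RVar ''h''))))) (Cond (RLess (RVar
     ''gamma_minus'') (lit 0)) (RAssign ''gamma_minus'' (lit 0)) Skip))"

definition approx_convex :: com where
  "approx_convex =
    Seq sample_vector
   (Seq set_delta
   (Seq search
   (Seq set_plus
   (Seq search
   (Seq set_minus
        agd)))))"

abbreviation (input) "agdR \<equiv> {''t'', ''df'', ''num'', ''den'', ''lam''}"
abbreviation (input) "agdD \<equiv> {''x'', ''y'', ''z'', ''G'', ''H''}"

context gtrs_machine
begin

lemma sample_vectorE:
  assumes "nvar s ''n'' = n"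
  obtains t s' where "exec sample_vector s t s'" "frame {''i''} {''u''} {''v''} s s'"
    "\<And>i. i < n \<Longrightarrow> rarr s' ''v'' i = tape s (head s + i)" "real t \<le> 6 * N"
proof -
  have "runs sample_vector s (\<lambda>t s'. frame {''i''} {''u''} {''v''} s s' \<and>
     ((\<forall>i<n. rarr s' ''v'' i = tape s (head s + i)) \<and> head s' = head s + n) \<and> t \<le> real n * (2 + 2) + 2)"
    unfolding sample_vector_def
  proof (rule runs_for_loop[where I = "\<lambda>k s'. (\<forall>i<k. rarr s' ''v'' i = tape s (head s + i)) \<and> head s' = head s + k"])
    fix k s' assume "k < n" "frame {''i''} {''u''} {''v''} s s'" "nvar s' ''i'' = k"
      "(\<forall>i<k. rarr s' ''v'' i = tape s (head s + i)) \<and> head s' = head s + k"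
    then show "runs (Seq (Sample ''u'') (RStore ''v'' (NVar ''i'') (RVar ''u''))) s'
      (\<lambda>t s''. frame ({''i''} - {''i''}) {''u''} {''v''} s' s'' \<and>
        ((\<forall>i<Suc k. rarr (s''\<lparr>nvar := (nvar s'')(''i'' := Suc k)\<rparr>) ''v'' i = tape s (head s + i)) \<and>
         head (s''\<lparr>nvar := (nvar s'')(''i'' := Suc k)\<rparr>) = head s + Suc k) \<and> t \<le> 2)"
      by (auto simp: runs_simps frame_def less_Suc_eq)
  qed (use assms in auto)
  then obtain t s' where *: "exec sample_vector s t s'" "frame {''i''} {''u''} {''v''} s s'"
    "\<forall>i<n. rarr s' ''v'' i = tape s (head s + i)" "real t \<le> real n * (2 + 2) + 2"
    unfolding runs_def by blast
  show thesis by (rule that[OF *(1,2)]) (use *(3,4) N_ge in auto)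
qed

section \<open>The accelerated method as it is executed\<close>

definition F :: "real \<Rightarrow> real \<Rightarrow> (nat \<Rightarrow> real) \<Rightarrow> real" where "F \<gamma>m \<gamma>p w = max (q \<gamma>m w) (q \<gamma>p w)"

definition grad :: "real \<Rightarrow> (nat \<Rightarrow> real) \<Rightarrow> nat \<Rightarrow> real" where
  "grad \<gamma> y = 2 *\<^sub>R (A \<gamma> y + (b0 + \<gamma> *\<^sub>R b1))"

definition weight :: "real \<Rightarrow> real \<Rightarrow> (nat \<Rightarrow> real) \<Rightarrow> real" where
  "weight \<gamma>m \<gamma>p y = prox_weight (4 * \<zeta> * (q \<gamma>m y - q \<gamma>p y) - ip n (grad \<gamma>p y) (grad \<gamma>m y - grad \<gamma>p y))
     (ip n (grad \<gamma>m y - grad \<gamma>p y) (grad \<gamma>m y - grad \<gamma>p y))"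

definition prox :: "real \<Rightarrow> real \<Rightarrow> (nat \<Rightarrow> real) \<Rightarrow> nat \<Rightarrow> real" where
  "prox \<gamma>m \<gamma>p y = y - (1 / (4 * \<zeta>)) *\<^sub>R (weight \<gamma>m \<gamma>p y *\<^sub>R grad \<gamma>m y + (1 - weight \<gamma>m \<gamma>p y) *\<^sub>R grad \<gamma>p y)"

definition next_t :: "real \<Rightarrow> real" where "next_t t = (1 + sqrt (1 + 4 * (t * t))) / 2"

definition mid :: "real \<Rightarrow> (nat \<Rightarrow> real) \<Rightarrow> (nat \<Rightarrow> real) \<Rightarrow> nat \<Rightarrow> real" where
  "mid t x z = x + (1 / t) *\<^sub>R (z - x)"

lemma q_cong: "(\<And>i. i < n \<Longrightarrow> x i = y i) \<Longrightarrow> q \<gamma> x = q \<gamma> y"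
  unfolding q_def qf_def using A_cong[of x y \<gamma>] by (simp add: ip_def)

lemma F_cong: "(\<And>i. i < n \<Longrightarrow> x i = y i) \<Longrightarrow> F \<gamma>m \<gamma>p x = F \<gamma>m \<gamma>p y"
  unfolding F_def using q_cong[of x y] by simp

text \<open>The lower increment 1/2 bounds the number of rounds, and the upper increment 1 bounds
  the overshoot beyond the stopping value; the quadratic identity is what
  \<open>accelerated_step\<close> needs.\<close>

lemma next_t:
  assumes "0 \<le> t"
  shows "1 \<le> next_t t" "(next_t t)\<^sup>2 - next_t t = t\<^sup>2" "t + 1 / 2 \<le> next_t t" "next_t t \<le> t + 1"
proof -
  have s: "(sqrt (1 + 4 * (t * t)))\<^sup>2 = 1 + 4 * (t * t)" by (rule real_sqrt_pow2) simp
  show "1 \<le> next_t t" by (simp add: next_t_def)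
  show "(next_t t)\<^sup>2 - next_t t = t\<^sup>2"
    using s unfolding next_t_def by (simp add: power2_eq_square field_simps)
  have "2 * t \<le> sqrt (1 + 4 * (t * t))"
    using assms by (intro real_le_rsqrt) (simp add: power2_eq_square)
  then show "t + 1 / 2 \<le> next_t t" by (simp add: next_t_def)
  have "sqrt (1 + 4 * (t * t)) \<le> 1 + 2 * t"
    using assms by (intro real_le_lsqrt) (simp_all add: power2_eq_square algebra_simps)
  then show "next_t t \<le> t + 1" by (simp add: next_t_def)
qed

text \<open>Both forms are at most 1 + \<gamma> \<le> 2 \<zeta>, which is L/2 for L = 4 \<zeta>. The
  point of comparison is the constrained solution: its values do not exceed Opt, as both parameters
  are positive and q1 is nonpositive there.\<close>

lemma agd_decrease:
  assumes psd: "psd \<gamma>m" "psd \<gamma>p" and t: "0 \<le> t"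
    and y: "y = mid (next_t t) x z"
  shows "(next_t t)\<^sup>2 * (F \<gamma>m \<gamma>p (prox \<gamma>m \<gamma>p y) - q0 x0)
      + 4 * \<zeta> / 2 * ip n (x0 - (z + next_t t *\<^sub>R (prox \<gamma>m \<gamma>p y - y))) (x0 - (z + next_t t *\<^sub>R (prox \<gamma>m \<gamma>p y - y)))
    \<le> t\<^sup>2 * (F \<gamma>m \<gamma>p x - q0 x0) + 4 * \<zeta> / 2 * ip n (x0 - z) (x0 - z)"
proof (rule accelerated_step[OF _ _ next_t(1,2)[OF t] y[unfolded mid_def] refl])
  have form: "ip n w (A \<gamma> w) \<le> 4 * \<zeta> / 2 * ip n w w" if "psd \<gamma>" for \<gamma> w
  proof -
    have "\<bar>\<gamma>\<bar> \<le> \<zeta>" using psd_pos[OF that] psd_le_\<zeta>[OF that] by simp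
    then have "(1 + \<bar>\<gamma>\<bar>) * ip n w w \<le> (4 * \<zeta> / 2) * ip n w w" using \<zeta> by (intro mult_right_mono) auto
    then show ?thesis using form_upper[of w \<gamma>] by linarith
  qed
  fix w
  show "F \<gamma>m \<gamma>p (prox \<gamma>m \<gamma>p y) \<le> F \<gamma>m \<gamma>p w
      + 4 * \<zeta> / 2 * (ip n (w - y) (w - y) - ip n (w - prox \<gamma>m \<gamma>p y) (w - prox \<gamma>m \<gamma>p y))"
    unfolding F_def q_def
  proof (rule prox_step[OF A_self_adjoint _ _ A_self_adjoint _ _ _ refl refl refl refl])
    show "0 \<le> ip n w (A \<gamma>m w)" "0 \<le> ip n w (A \<gamma>p w)" for w using psd by (auto simp: psd_def)
    show "ip n w (A \<gamma>m w) \<le> 4 * \<zeta> / 2 * ip n w w" "ip n w (A \<gamma>p w) \<le> 4 * \<zeta> / 2 * ip n w w" for w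
      using form psd by auto
    show "0 < 4 * \<zeta>" using \<zeta> by simp
  qed (simp only: prox_def weight_def grad_def q_def)
next
  have "0 \<le> 1 / next_t t" "1 / next_t t \<le> 1" using next_t(1)[OF t] by auto
  then show "F \<gamma>m \<gamma>p (x + (1 / next_t t) *\<^sub>R (x0 - x)) \<le> (1 - 1 / next_t t) * F \<gamma>m \<gamma>p x + 1 / next_t t * F \<gamma>m \<gamma>p x0"
    unfolding F_def q_def using psd
    by (intro max_qf_convex A_self_adjoint) (auto simp: psd_def)
  show "F \<gamma>m \<gamma>p x0 \<le> q0 x0"
    unfolding F_def using q_x0_le psd_pos psd by (simp add: less_imp_le)
qed

lemma runs_agd_body:
  assumes s: "static s" "rvar s ''gm'' = \<gamma>m" "rvar s ''gp'' = \<gamma>p" "rvar s ''t'' = t"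
    and y: "y = mid (next_t t) (rarr s ''x'') (rarr s ''z'')"
  shows "runs agd_body s (\<lambda>T s'. frame {''i''} agdR agdD s s' \<and> rvar s' ''t'' = next_t t \<and>
    (\<forall>i<n. rarr s' ''x'' i = prox \<gamma>m \<gamma>p y i) \<and>
    (\<forall>i<n. rarr s' ''z'' i = (rarr s ''z'' + next_t t *\<^sub>R (prox \<gamma>m \<gamma>p y - y)) i) \<and> T \<le> 72 * N)"
proof -
  define s1 where "s1 = s\<lparr>rvar := (rvar s)(''t'' := next_t t)\<rparr>"
  have e1: "exec (RAssign ''t'' t_update) s 1 s1"
    using exec_RAssign[of "''t''" "t_update" s] s
    by (simp add: s1_def next_t_def)
  have f1: "frame {''i''} {''t''} {} s s1" by (auto simp: s1_def frame_def)
  have st1: "static s1" using static_frame[OF s(1) f1] by simp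
  have l1: "loaded s1" using st1 by (simp add: static_def)
  have t1: "rvar s1 ''t'' = next_t t" by (simp add: s1_def)
  note v1 = frameD[OF f1]
  obtain u2 s2 where e2: "exec (vec_loop ''y'' y_update) s1 u2 s2"
    and f2: "frame {''i''} {} {''y''} s1 s2" and y2: "\<And>i. i < n \<Longrightarrow> rarr s2 ''y'' i = y i" and u2: "real u2 \<le> 5 * N"
  proof (rule vec_loopE[OF loaded_n[OF l1], of "''y''" _ y])
    fix k s' assume k: "k < n" "nvar s' ''i'' = k" and f: "frame {''i''} {} {''y''} s1 s'"
    show "rval y_update s' = y k"
      using k t1 by (simp add: frameD[OF f] v1 y mid_def)
  qed blast
  note v2 = frameD[OF f2]
  have l2: "loaded s2" using loaded_frame[OF l1 f2] by simp
  have g2: "rvar s2 ''gm'' = \<gamma>m" using s by (simp add: v2 v1)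
  obtain u3 s3 where e3: "exec (mat_vec (RVar ''gm'') ''y'' ''G'') s2 u3 s3" and f3: "frame {''i''} {} {''G''} s2 s3"
    and G3': "\<And>i. i < n \<Longrightarrow> rarr s3 ''G'' i = A \<gamma>m (rarr s2 ''y'') i" and u3: "real u3 \<le> 12 * N"
    by (rule mat_vecE[OF l2 _ _ _ g2, of "''G''" "''y''"]) auto
  note v3 = frameD[OF f3]
  have G3: "rarr s3 ''G'' i = A \<gamma>m y i" if "i < n" for i using G3'[OF that] A_cong[of "rarr s2 ''y''" y \<gamma>m i] y2 by simp
  have l3: "loaded s3" using loaded_frame[OF l2 f3] by simp
  have g3: "rvar s3 ''gp'' = \<gamma>p" using s by (simp add: v3 v2 v1)
  obtain u4 s4 where e4: "exec (mat_vec (RVar ''gp'') ''y'' ''H'') s3 u4 s4" and f4: "frame {''i''} {} {''H''} s3 s4"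
    and H4': "\<And>i. i < n \<Longrightarrow> rarr s4 ''H'' i = A \<gamma>p (rarr s3 ''y'') i" and u4: "real u4 \<le> 12 * N"
    by (rule mat_vecE[OF l3 _ _ _ g3, of "''H''" "''y''"]) auto
  note v4 = frameD[OF f4]
  have H4: "rarr s4 ''H'' i = A \<gamma>p y i" if "i < n" for i
    using H4'[OF that] A_cong[of "rarr s3 ''y''" y \<gamma>p i] y2 by (simp add: v3)
  have f04: "frame {''i''} {''t''} {''y'', ''G'', ''H''} s s4"
    by (intro frame_trans[OF frame_trans[OF frame_trans[OF frame_mono[OF f1] f2] f3] f4]) auto
  have st4: "static s4" using static_frame[OF s(1) f04] by simp
  have l4: "loaded s4" using st4 by (simp add: static_def)
  have r4: "rvar s4 ''gm'' = \<gamma>m" "rvar s4 ''gp'' = \<gamma>p" "rvar s4 ''t'' = next_t t"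
    using s t1 by (simp_all add: v4 v3 v2 v1)
  have a4: "rarr s4 ''y'' i = y i" "rarr s4 ''G'' i = A \<gamma>m y i" "rarr s4 ''b0'' i = b0 i" "rarr s4 ''b1'' i = b1 i" if "i < n" for i
    using that y2 G3 st4 by (simp_all add: v4 v3 static_def)
  \<comment> \<open>The difference of the two values is computed while \<open>G\<close> and
    \<open>H\<close> still hold the bare products with the pencil; in it \<open>c0\<close>
    cancels.\<close>
  obtain u5 s5 where e5: "exec (sum_loop ''df'' df_summand) s4 u5 s5"
    and f5: "frame {''i''} {''df''} {} s4 s5"
    and df: "rvar s5 ''df'' = (\<Sum>k<n. y k * (A \<gamma>m y k - A \<gamma>p y k + 2 * (\<gamma>m - \<gamma>p) * b1 k))" and u5: "real u5 \<le> 6 * N"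
  proof (rule sum_loopE[OF loaded_n[OF l4], of "''df''" _ "\<lambda>k. y k * (A \<gamma>m y k - A \<gamma>p y k + 2 * (\<gamma>m - \<gamma>p) * b1 k)"])
    fix k s' assume k: "k < n" "nvar s' ''i'' = k" and f: "frame {''i''} {''df''} {} s4 s'"
    show "rval df_summand s' = y k * (A \<gamma>m y k - A \<gamma>p y k + 2 * (\<gamma>m - \<gamma>p) * b1 k)"
      using k a4 H4 r4 by (simp add: frameD[OF f])
  qed blast
  have df': "rvar s5 ''df'' + (\<gamma>m - \<gamma>p) * c1 = q \<gamma>m y - q \<gamma>p y"
  proof -
    have "rvar s5 ''df'' = ip n y (A \<gamma>m y - A \<gamma>p y + (2 * (\<gamma>m - \<gamma>p)) *\<^sub>R b1)"
      unfolding df ip_def by simp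
    also have "\<dots> = ip n y (A \<gamma>m y) - ip n y (A \<gamma>p y) + 2 * (\<gamma>m - \<gamma>p) * ip n b1 y"
      by (simp add: ip_simps ip_commute)
    finally show ?thesis by (simp add: q_def qf_def ip_simps algebra_simps)
  qed
  note v5 = frameD[OF f5]
  have l5: "loaded s5" using loaded_frame[OF l4 f5] by simp
  obtain u6 s6 where e6: "exec (vec_loop ''G'' G_update) s5 u6 s6"
    and f6: "frame {''i''} {} {''G''} s5 s6" and G6: "\<And>i. i < n \<Longrightarrow> rarr s6 ''G'' i = grad \<gamma>m y i" and u6: "real u6 \<le> 5 * N"
  proof (rule vec_loopE[OF loaded_n[OF l5], of "''G''" _ "grad \<gamma>m y"])
    fix k s' assume k: "k < n" "nvar s' ''i'' = k" "rarr s' ''G'' k = rarr s5 ''G'' k" and f: "frame {''i''} {} {''G''} s5 s'"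
    show "rval G_update s' = grad \<gamma>m y k"
      using k a4 r4 by (simp add: frameD[OF f] v5 grad_def)
  qed blast
  note v6 = frameD[OF f6]
  have l6: "loaded s6" using loaded_frame[OF l5 f6] by simp
  obtain u7 s7 where e7: "exec (vec_loop ''H'' H_update) s6 u7 s7"
    and f7: "frame {''i''} {} {''H''} s6 s7" and H7: "\<And>i. i < n \<Longrightarrow> rarr s7 ''H'' i = grad \<gamma>p y i" and u7: "real u7 \<le> 5 * N"
  proof (rule vec_loopE[OF loaded_n[OF l6], of "''H''" _ "grad \<gamma>p y"])
    fix k s' assume k: "k < n" "nvar s' ''i'' = k" "rarr s' ''H'' k = rarr s6 ''H'' k" and f: "frame {''i''} {} {''H''} s6 s'"
    show "rval H_update s' = grad \<gamma>p y k"
      using k a4 H4 r4 by (simp add: frameD[OF f] v6 v5 grad_def)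
  qed blast
  note v7 = frameD[OF f7]
  have l7: "loaded s7" using loaded_frame[OF l6 f7] by simp
  have G7: "rarr s7 ''G'' i = grad \<gamma>m y i" if "i < n" for i using G6[OF that] by (simp add: v7)
  obtain u8 s8 where e8: "exec (sum_loop ''num'' num_summand) s7 u8 s8"
    and f8: "frame {''i''} {''num''} {} s7 s8"
    and num8: "rvar s8 ''num'' = (\<Sum>k<n. grad \<gamma>p y k * (grad \<gamma>m y - grad \<gamma>p y) k)" and u8: "real u8 \<le> 6 * N"
  proof (rule sum_loopE[OF loaded_n[OF l7], of "''num''" _ "\<lambda>k. grad \<gamma>p y k * (grad \<gamma>m y - grad \<gamma>p y) k"])
    fix k s' assume k: "k < n" "nvar s' ''i'' = k" and f: "frame {''i''} {''num''} {} s7 s'"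
    show "rval num_summand s' = grad \<gamma>p y k * (grad \<gamma>m y - grad \<gamma>p y) k"
      using k G7 H7 by (simp add: frameD[OF f])
  qed blast
  note v8 = frameD[OF f8]
  define num where "num = 4 * \<zeta> * (q \<gamma>m y - q \<gamma>p y) - ip n (grad \<gamma>p y) (grad \<gamma>m y - grad \<gamma>p y)"
  define den where "den = ip n (grad \<gamma>m y - grad \<gamma>p y) (grad \<gamma>m y - grad \<gamma>p y)"
  define s9 where "s9 = s8\<lparr>rvar := (rvar s8)(''num'' := num)\<rparr>"
  have z8: "rvar s8 ''zeta'' = \<zeta>" "rvar s8 ''c1'' = c1" "rvar s8 ''gm'' = \<gamma>m" "rvar s8 ''gp'' = \<gamma>p" "rvar s8 ''df'' = rvar s5 ''df''"
    using st4 r4 by (simp_all add: v8 v7 v6 v5 static_def)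
  have e9: "exec (RAssign ''num'' num_update) s8 1 s9"
  proof -
    have "rval num_update s8 = num"
      unfolding num_def df'[symmetric] ip_def using num8 by (simp add: z8)
    then show ?thesis unfolding s9_def by (metis exec_RAssign)
  qed
  have f9: "frame {''i''} {''num''} {} s8 s9" by (auto simp: s9_def frame_def)
  note v9 = frameD[OF f9]
  have f79: "frame {''i''} {''num''} {} s7 s9" using f8 f9 by (rule frame_trans) auto
  have l9: "loaded s9" using loaded_frame[OF l7 f79] by simp
  obtain u10 s10 where e10: "exec (sum_loop ''den'' den_summand) s9 u10 s10"
    and f10: "frame {''i''} {''den''} {} s9 s10"
    and den10: "rvar s10 ''den'' = (\<Sum>k<n. (grad \<gamma>m y - grad \<gamma>p y) k * (grad \<gamma>m y - grad \<gamma>p y) k)" and u10: "real u10 \<le> 6 * N"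
  proof (rule sum_loopE[OF loaded_n[OF l9], of "''den''" _ "\<lambda>k. (grad \<gamma>m y - grad \<gamma>p y) k * (grad \<gamma>m y - grad \<gamma>p y) k"])
    fix k s' assume k: "k < n" "nvar s' ''i'' = k" and f: "frame {''i''} {''den''} {} s9 s'"
    show "rval den_summand s' = (grad \<gamma>m y - grad \<gamma>p y) k * (grad \<gamma>m y - grad \<gamma>p y) k"
      using k G7 H7 by (simp add: frameD[OF f] frameD[OF f79])
  qed blast
  note v10 = frameD[OF f10]
  have nd: "rvar s10 ''num'' = num" "rvar s10 ''den'' = den"
    using den10 by (simp_all add: v10 s9_def den_def ip_def)
  define s11 where "s11 = s10\<lparr>rvar := (rvar s10)(''lam'' := weight \<gamma>m \<gamma>p y)\<rparr>"
  obtain u11 where e11: "exec agd_weight s10 u11 s11" and u11: "real u11 \<le> 3"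
  proof -
    have "runs agd_weight s10 (\<lambda>t s'. s' = s11 \<and> t \<le> 3)"
      unfolding agd_weight_def s11_def weight_def num_def[symmetric] den_def[symmetric]
      by (simp add: runs_simps nd prox_weight_def)
    then show thesis using that unfolding runs_def by blast
  qed
  have f11: "frame {''i''} {''lam''} {} s10 s11" by (auto simp: s11_def frame_def)
  note v11 = frameD[OF f11]
  have f0_11: "frame {''i''} agdR agdD s s11"
    by (intro frame_trans[OF frame_trans[OF frame_trans[OF frame_trans[OF frame_trans[OF frame_trans[OF frame_mono[OF f04] f5] f6] f7] f79] f10] f11]) auto
  have st11: "static s11" using static_frame[OF s(1) f0_11] by simp
  have l11: "loaded s11" using st11 by (simp add: static_def)
  have lam: "rvar s11 ''lam'' = weight \<gamma>m \<gamma>p y" by (simp add: s11_def)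
  have a11: "rarr s11 ''G'' i = grad \<gamma>m y i" "rarr s11 ''H'' i = grad \<gamma>p y i" "rarr s11 ''y'' i = y i" if "i < n" for i
    using that G7 H7 a4(1) by (simp_all add: v11 v10 frameD[OF f79] v7 v6 v5)
  have t11: "rvar s11 ''t'' = next_t t" using r4(3) by (simp add: v11 v10 frameD[OF f79] v7 v6 v5)
  have z11: "rarr s11 ''z'' = rarr s ''z''" by (simp add: v11 v10 frameD[OF f79] v7 v6 v5 frameD[OF f04])
  obtain u12 s12 where e12: "exec (vec_loop ''x'' x_update) s11 u12 s12"
    and f12: "frame {''i''} {} {''x''} s11 s12" and x12: "\<And>i. i < n \<Longrightarrow> rarr s12 ''x'' i = prox \<gamma>m \<gamma>p y i" and u12: "real u12 \<le> 5 * N"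
  proof (rule vec_loopE[OF loaded_n[OF l11], of "''x''" _ "prox \<gamma>m \<gamma>p y"])
    fix k s' assume k: "k < n" "nvar s' ''i'' = k" and f: "frame {''i''} {} {''x''} s11 s'"
    show "rval x_update s' = prox \<gamma>m \<gamma>p y k"
      using k a11 lam st11 by (simp add: frameD[OF f] prox_def static_def)
  qed blast
  note v12 = frameD[OF f12]
  have l12: "loaded s12" using loaded_frame[OF l11 f12] by simp
  obtain u13 s13 where e13: "exec (vec_loop ''z'' z_update) s12 u13 s13"
    and f13: "frame {''i''} {} {''z''} s12 s13"
    and z13: "\<And>i. i < n \<Longrightarrow> rarr s13 ''z'' i = (rarr s ''z'' + next_t t *\<^sub>R (prox \<gamma>m \<gamma>p y - y)) i" and u13: "real u13 \<le> 5 * N"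
  proof (rule vec_loopE[OF loaded_n[OF l12], of "''z''" _ "rarr s ''z'' + next_t t *\<^sub>R (prox \<gamma>m \<gamma>p y - y)"])
    fix k s' assume k: "k < n" "nvar s' ''i'' = k" "rarr s' ''z'' k = rarr s12 ''z'' k" and f: "frame {''i''} {} {''z''} s12 s'"
    show "rval z_update s' = (rarr s ''z'' + next_t t *\<^sub>R (prox \<gamma>m \<gamma>p y - y)) k"
      using k a11 x12 t11 z11 by (simp add: frameD[OF f] v12)
  qed blast
  note v13 = frameD[OF f13]
  show ?thesis
    unfolding runs_def
  proof (intro exI conjI)
    show "exec agd_body s (1 + (u2 + (u3 + (u4 + (u5 + (u6 + (u7 + (u8 + (1 + (u10 + (u11 + (u12 + u13)))))))))))) s13"
      unfolding agd_body_def
      by (rule exec_Seq[OF e1 exec_Seq[OF e2 exec_Seq[OF e3 exec_Seq[OF e4 exec_Seq[OF e5 exec_Seq[OF e6 exec_Seq[OF e7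
        exec_Seq[OF e8 exec_Seq[OF e9 exec_Seq[OF e10 exec_Seq[OF e11 exec_Seq[OF e12 e13]]]]]]]]]]]])
    show "frame {''i''} agdR agdD s s13"
      by (intro frame_trans[OF frame_trans[OF f0_11 f12] f13]) auto
    show "rvar s13 ''t'' = next_t t" using t11 by (simp add: v13 v12)
    show "\<forall>i<n. rarr s13 ''x'' i = prox \<gamma>m \<gamma>p y i" using x12 by (simp add: v13)
    show "\<forall>i<n. rarr s13 ''z'' i = (rarr s ''z'' + next_t t *\<^sub>R (prox \<gamma>m \<gamma>p y - y)) i" using z13 by simp
    show "real (1 + (u2 + (u3 + (u4 + (u5 + (u6 + (u7 + (u8 + (1 + (u10 + (u11 + (u12 + u13)))))))))))) \<le> 72 * N"
      using u2 u3 u4 u5 u6 u7 u8 u10 u11 u12 u13 N_ge(2) by simp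
  qed
qed

end

context gtrs_machine
begin

definition agd_steps :: real where "agd_steps = \<kappa> * sqrt (\<zeta> / \<epsilon>)"

lemma agd_steps: "1 \<le> agd_steps" "agd_steps * agd_steps * \<epsilon> = \<zeta> * (\<kappa> * \<kappa>)"
proof -
  have "1 * \<epsilon> \<le> \<kappa> * (\<kappa> * \<zeta>)" using \<kappa>_ge_1 \<epsilon> by (intro mult_mono) auto
  then have "1 \<le> \<kappa>\<^sup>2 * (\<zeta> / \<epsilon>)" using \<epsilon> by (simp add: power2_eq_square field_simps)
  then have "1 \<le> sqrt (\<kappa>\<^sup>2 * (\<zeta> / \<epsilon>))" by simp
  also have "\<dots> = agd_steps" using \<kappa>_ge_1 by (simp only: real_sqrt_mult real_sqrt_abs agd_steps_def)
  finally show "1 \<le> agd_steps" .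
  have "sqrt (\<zeta> / \<epsilon>) * sqrt (\<zeta> / \<epsilon>) = \<zeta> / \<epsilon>" using \<zeta> \<epsilon> by simp
  then show "agd_steps * agd_steps * \<epsilon> = \<zeta> * (\<kappa> * \<kappa>)"
    using \<epsilon> unfolding agd_steps_def by (simp add: field_simps)
qed

lemma runs_agd:
  assumes s: "static s" "rvar s ''gm'' = \<gamma>m" "rvar s ''gp'' = \<gamma>p"
  shows "runs agd s (\<lambda>T s'. frame {''i''} agdR agdD s s' \<and>
    (psd \<gamma>m \<and> psd \<gamma>p \<longrightarrow> F \<gamma>m \<gamma>p (rarr s' ''x'') \<le> q0 x0 + \<epsilon> / 8) \<and> T \<le> 4000 * (N * agd_steps))"
proof -
  define s1 where "s1 = s\<lparr>rvar := (rvar s)(''t'' := 0)\<rparr>"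
  have e1: "exec (RAssign ''t'' (lit 0)) s 1 s1"
    using exec_RAssign[of "''t''" "lit 0" s] by (simp add: s1_def)
  have f1: "frame {''i''} agdR agdD s s1" by (auto simp: s1_def frame_def)
  have st1: "static s1" using static_frame[OF s(1) f1] by simp
  have l1: "loaded s1" using st1 by (simp add: static_def)
  obtain u2 s2 where e2: "exec (vec_loop ''x'' (lit 0)) s1 u2 s2" and f2: "frame {''i''} {} {''x''} s1 s2"
    and u2: "real u2 \<le> 5 * N"
    by (rule vec_loopE[OF loaded_n[OF l1], of "''x''" "lit 0" "\<lambda>_. 0"]) auto
  have l2: "loaded s2" using loaded_frame[OF l1 f2] by simp
  obtain u3 s3 where e3: "exec (vec_loop ''z'' (lit 0)) s2 u3 s3" and f3: "frame {''i''} {} {''z''} s2 s3"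
    and z3: "\<And>i. i < n \<Longrightarrow> rarr s3 ''z'' i = 0" and u3: "real u3 \<le> 5 * N"
    by (rule vec_loopE[OF loaded_n[OF l2], of "''z''" "lit 0" "\<lambda>_. 0"]) auto
  have f03: "frame {''i''} agdR agdD s s3" by (intro frame_trans[OF frame_trans[OF f1 f2] f3]) auto
  \<comment> \<open>At this t both sides of the guard are equal, because 20^2 = 400.\<close>
  define top where "top = 20 * agd_steps"
  \<comment> \<open>Each round raises t by at least 1/2, so the potential drops by 73 N, which
    covers the 72 N of the body and the guard.\<close>
  define \<Phi> where "\<Phi> s' = 146 * N * (top + 1 - rvar s' ''t'')" for s' :: state
  define I where "I s' \<longleftrightarrow> frame {''i''} agdR agdD s s' \<and> 0 \<le> rvar s' ''t'' \<and> rvar s' ''t'' \<le> top + 1 \<and>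
    (psd \<gamma>m \<and> psd \<gamma>p \<longrightarrow> (rvar s' ''t'')\<^sup>2 * (F \<gamma>m \<gamma>p (rarr s' ''x'') - q0 x0)
      + 4 * \<zeta> / 2 * ip n (x0 - rarr s' ''z'') (x0 - rarr s' ''z'') \<le> 4 * \<zeta> / 2 * ip n x0 x0)" for s'
  have guard: "bval agd_guard s' \<longleftrightarrow> rvar s' ''t'' * rvar s' ''t'' * \<epsilon> < 400 * (\<zeta> * (\<kappa> * \<kappa>))"
    if "I s'" for s'
  proof -
    have "static s'" using static_frame[OF s(1), of agdR agdD s'] that by (simp add: I_def)
    then show ?thesis by (simp add: agd_guard_def static_def \<kappa>_def mult.assoc)
  qed
  have "runs (While agd_guard agd_body) s3 (\<lambda>T s'. I s' \<and> \<not> bval agd_guard s' \<and> T \<le> \<Phi> s3 + 1)"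
  proof (rule runs_While_potential)
    have "rvar s3 ''t'' = 0" by (simp add: frameD[OF f3] frameD[OF f2] s1_def)
    moreover have "ip n (x0 - rarr s3 ''z'') (x0 - rarr s3 ''z'') = ip n x0 x0"
      using z3 by (intro ip_cong) auto
    ultimately show "I s3" unfolding I_def using f03 agd_steps(1) by (simp add: top_def)
  next
    fix s' assume I: "I s'" and b: "bval agd_guard s'"
    then have f: "frame {''i''} agdR agdD s s'" and t0: "0 \<le> rvar s' ''t''" by (auto simp: I_def)
    define t where "t = rvar s' ''t''"
    define y where "y = mid (next_t t) (rarr s' ''x'') (rarr s' ''z'')"
    have st: "static s'" using static_frame[OF s(1) f] by simp
    have g: "rvar s' ''gm'' = \<gamma>m" "rvar s' ''gp'' = \<gamma>p" using s by (simp_all add: frameD[OF f])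
    have ttop: "t < top"
    proof (rule ccontr)
      assume "\<not> t < top"
      then have "top * top * \<epsilon> \<le> t * t * \<epsilon>" using agd_steps(1) \<epsilon> by (intro mult_right_mono mult_mono) (auto simp: top_def)
      moreover have "top * top * \<epsilon> = 400 * (agd_steps * agd_steps * \<epsilon>)" by (simp add: top_def)
      ultimately show False using b guard[OF I] agd_steps(2) by (simp add: t_def)
    qed
    show "runs agd_body s' (\<lambda>T s''. I s'' \<and> T + 1 + \<Phi> s'' \<le> \<Phi> s')"
    proof (rule runs_mono[OF runs_agd_body[OF st g t_def[symmetric] y_def]])
      fix T s'' assume *: "frame {''i''} agdR agdD s' s'' \<and> rvar s'' ''t'' = next_t t \<and>
        (\<forall>i<n. rarr s'' ''x'' i = prox \<gamma>m \<gamma>p y i) \<and>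
        (\<forall>i<n. rarr s'' ''z'' i = (rarr s' ''z'' + next_t t *\<^sub>R (prox \<gamma>m \<gamma>p y - y)) i) \<and> T \<le> 72 * N"
      note nt = next_t[OF t0[folded t_def]]
      have "frame {''i''} agdR agdD s s''" using f conjunct1[OF *] by (rule frame_trans) auto
      moreover have "(next_t t)\<^sup>2 * (F \<gamma>m \<gamma>p (rarr s'' ''x'') - q0 x0)
        + 4 * \<zeta> / 2 * ip n (x0 - rarr s'' ''z'') (x0 - rarr s'' ''z'') \<le> 4 * \<zeta> / 2 * ip n x0 x0"
        if psd: "psd \<gamma>m" "psd \<gamma>p"
      proof -
        have eqF: "F \<gamma>m \<gamma>p (rarr s'' ''x'') = F \<gamma>m \<gamma>p (prox \<gamma>m \<gamma>p y)" using * by (intro F_cong) auto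
        have eqz: "ip n (x0 - rarr s'' ''z'') (x0 - rarr s'' ''z'')
          = ip n (x0 - (rarr s' ''z'' + next_t t *\<^sub>R (prox \<gamma>m \<gamma>p y - y))) (x0 - (rarr s' ''z'' + next_t t *\<^sub>R (prox \<gamma>m \<gamma>p y - y)))"
          using * by (intro ip_cong) auto
        have "t\<^sup>2 * (F \<gamma>m \<gamma>p (rarr s' ''x'') - q0 x0)
          + 4 * \<zeta> / 2 * ip n (x0 - rarr s' ''z'') (x0 - rarr s' ''z'') \<le> 4 * \<zeta> / 2 * ip n x0 x0"
          using I psd by (simp add: I_def t_def)
        then show ?thesis
          unfolding eqF eqz using agd_decrease[OF psd t0[folded t_def] y_def] by (rule order_trans[rotated])
      qed
      ultimately have "I s''" unfolding I_def using * nt ttop t0 by (simp add: t_def)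
      moreover have "T + 1 + \<Phi> s'' \<le> \<Phi> s'"
      proof -
        have "146 * N * (t + 1 / 2) \<le> 146 * N * next_t t" using nt(3) N_ge by (intro mult_left_mono) auto
        then have "73 * N + \<Phi> s'' \<le> \<Phi> s'" unfolding \<Phi>_def t_def[symmetric] using * by (simp add: algebra_simps)
        then show ?thesis using * N_ge(2) by linarith
      qed
      ultimately show "I s'' \<and> T + 1 + \<Phi> s'' \<le> \<Phi> s'" by simp
    qed
  next
    fix s' assume "I s'"
    then show "0 \<le> \<Phi> s'" using N_ge by (simp add: I_def \<Phi>_def)
  qed
  then obtain u4 s4 where e4: "exec (While agd_guard agd_body) s3 u4 s4" and I4: "I s4"
    and b4: "\<not> bval agd_guard s4" and u4: "real u4 \<le> \<Phi> s3 + 1"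
    unfolding runs_def by blast
  show ?thesis
    unfolding runs_def
  proof (intro exI conjI impI)
    show "exec agd s (1 + (u2 + (u3 + u4))) s4"
      unfolding agd_def by (rule exec_Seq[OF e1 exec_Seq[OF e2 exec_Seq[OF e3 e4]]])
    show "frame {''i''} agdR agdD s s4" using I4 by (simp add: I_def)
    assume psd: "psd \<gamma>m \<and> psd \<gamma>p"
    define t where "t = rvar s4 ''t''"
    define D where "D = F \<gamma>m \<gamma>p (rarr s4 ''x'') - q0 x0"
    have "t\<^sup>2 * D + 4 * \<zeta> / 2 * ip n (x0 - rarr s4 ''z'') (x0 - rarr s4 ''z'') \<le> 4 * \<zeta> / 2 * ip n x0 x0"
      using I4 psd by (simp add: I_def t_def D_def)
    moreover have "0 \<le> 4 * \<zeta> / 2 * ip n (x0 - rarr s4 ''z'') (x0 - rarr s4 ''z'')" using \<zeta> by simp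
    moreover have "4 * \<zeta> / 2 * ip n x0 x0 \<le> 4 * \<zeta> / 2 * (25 * \<kappa>\<^sup>2)"
      using x0_bound \<zeta> by (intro mult_left_mono) auto
    ultimately have 1: "t * t * D \<le> 50 * (\<zeta> * (\<kappa> * \<kappa>))" by (simp add: power2_eq_square)
    have 2: "400 * (\<zeta> * (\<kappa> * \<kappa>)) \<le> t * t * \<epsilon>" using b4 guard[OF I4] by (simp add: t_def)
    have "0 < 400 * (\<zeta> * (\<kappa> * \<kappa>))" using \<zeta> \<kappa>_ge_1 by simp
    then have "0 < t * t" using 2 \<epsilon> by (metis less_le_trans not_square_less_zero not_less_iff_gr_or_eq mult_zero_left)
    moreover have "t * t * D \<le> t * t * (\<epsilon> / 8)" using 1 2 by simp
    ultimately have "D \<le> \<epsilon> / 8" by (simp only: mult_le_cancel_left_pos)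
    then show "F \<gamma>m \<gamma>p (rarr s4 ''x'') \<le> q0 x0 + \<epsilon> / 8" by (simp add: D_def)
  next
    have t3: "rvar s3 ''t'' = 0" by (simp add: frameD[OF f3] frameD[OF f2] s1_def)
    have "N * 1 \<le> N * agd_steps" using agd_steps(1) N_ge by (intro mult_left_mono) auto
    moreover have "\<Phi> s3 = 2920 * (N * agd_steps) + 146 * N" by (simp add: \<Phi>_def t3 top_def algebra_simps)
    ultimately show "real (1 + (u2 + (u3 + u4))) \<le> 4000 * (N * agd_steps)"
      using u2 u3 u4 N_ge(2) unfolding of_nat_add of_nat_1 mult_1_right by linarith
  qed
qed

section \<open>The complete program and its success probability\<close>

lemma good_cong: "(\<And>i. i < n \<Longrightarrow> v i = w i) \<Longrightarrow> good v = good w"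
proof -
  assume "\<And>i. i < n \<Longrightarrow> v i = w i"
  then have "ip n v v = ip n w w" "ip n u v = ip n u w" for u by (auto intro!: ip_cong)
  then show ?thesis by (simp add: good_def)
qed

text \<open>The time bound holds on every tape; only the claims about the output depend on a good
  vector, since wrong decisions change \<open>lo\<close> but not the sequence of steps h.\<close>

lemma runs_approx_convex:
  assumes s: "static s" "head s = 0" "tape s = \<omega>"
  shows "runs approx_convex s (\<lambda>T s'. T \<le> 80000 * level_cost + 5000 * (N * agd_steps) \<and>
    (good \<omega> \<longrightarrow> 0 \<le> out_gamma_minus s' \<and> 0 \<le> out_gamma_plus s' \<and>
      (\<forall>z. q0 x0 \<le> max (q (out_gamma_minus s') z) (q (out_gamma_plus s') z)) \<and>
      max (q (out_gamma_minus s') (rarr s' ''x'')) (q (out_gamma_plus s') (rarr s' ''x'')) \<le> q0 x0 + \<epsilon> / 2))"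
proof -
  have l: "loaded s" using s by (simp add: static_def)
  obtain u1 s1 where e1: "exec sample_vector s u1 s1" and f1: "frame {''i''} {''u''} {''v''} s s1"
    and v1: "\<And>i. i < n \<Longrightarrow> rarr s1 ''v'' i = tape s (head s + i)" and u1: "real u1 \<le> 6 * N"
    using sample_vectorE[OF loaded_n[OF l]] by blast
  have st1: "static s1" using static_frame[OF s(1) f1] by simp
  define v where "v = rarr s1 ''v''"
  \<comment> \<open>The array agrees with the tape on the first n entries, the only ones that count,
    so the event can be stated for the tape itself.\<close>
  have good: "good v = good \<omega>" using v1 s by (intro good_cong) (simp add: v_def)
  define s2 where "s2 = s1\<lparr>rvar := (rvar s1)(''delta'' := \<delta>, ''sg'' := 1)\<rparr>"
  have "runs set_delta s1 (\<lambda>t s'. s' = s2 \<and> t \<le> 2)"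
    using st1 \<xi> \<zeta> by (simp add: runs_simps s2_def static_def \<delta>_def \<kappa>_def power2_eq_square)
  then obtain u2 where e2: "exec set_delta s1 u2 s2" and u2: "real u2 \<le> 2"
    unfolding runs_def by blast
  have f2: "frame {''i''} {''delta'', ''sg''} {} s1 s2" by (auto simp: s2_def frame_def)
  have st2: "static s2" using static_frame[OF st1 f2] by simp
  have r2: "rvar s2 ''sg'' = 1" "rvar s2 ''delta'' = \<delta>" "v = rarr s2 ''v''" by (simp_all add: s2_def v_def)
  obtain u3 s3 where e3: "exec search s2 u3 s3" and f3: "frame {''i''} searchR testD s2 s3"
    and h3: "0 < rvar s3 ''h''" "rvar s3 ''h'' \<le> \<delta>" "0 \<le> rvar s3 ''lo''"
    and P3: "good v \<longrightarrow> Psd 1 (rvar s3 ''lo'') \<and> \<not> Psd 1 (rvar s3 ''lo'' + 4 * rvar s3 ''h'')"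
    and u3: "real u3 \<le> 40000 * level_cost + 3"
    using runs_search[OF st2 r2] unfolding runs_def by blast
  define lo1 h1 where "lo1 = rvar s3 ''lo''" and "h1 = rvar s3 ''h''"
  have st3: "static s3" using static_frame[OF st2 f3] by simp
  define s4 where "s4 = s3\<lparr>rvar := (rvar s3)(''gp'' := \<gamma>h + lo1, ''gamma_plus'' := \<gamma>h + (lo1 + 4 * h1), ''sg'' := -1)\<rparr>"
  have "runs set_plus s3 (\<lambda>t s'. s' = s4 \<and> t \<le> 3)"
    using st3 by (simp add: runs_simps s4_def static_def lo1_def h1_def)
  then obtain u4 where e4: "exec set_plus s3 u4 s4" and u4: "real u4 \<le> 3"
    unfolding runs_def by blast
  have f4: "frame {''i''} {''gp'', ''gamma_plus'', ''sg''} {} s3 s4" by (auto simp: s4_def frame_def)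
  have st4: "static s4" using static_frame[OF st3 f4] by simp
  have r4: "rvar s4 ''sg'' = -1" "rvar s4 ''delta'' = \<delta>" "v = rarr s4 ''v''"
    using r2 by (simp_all add: s4_def frameD[OF f3])
  obtain u5 s5 where e5: "exec search s4 u5 s5" and f5: "frame {''i''} searchR testD s4 s5"
    and h5: "0 < rvar s5 ''h''" "rvar s5 ''h'' \<le> \<delta>" "0 \<le> rvar s5 ''lo''"
    and P5: "good v \<longrightarrow> Psd (-1) (rvar s5 ''lo'') \<and> \<not> Psd (-1) (rvar s5 ''lo'' + 4 * rvar s5 ''h'')"
    and u5: "real u5 \<le> 40000 * level_cost + 3"
    using runs_search[OF st4 r4] unfolding runs_def by blast
  define lo2 h2 where "lo2 = rvar s5 ''lo''" and "h2 = rvar s5 ''h''"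
  have st5: "static s5" using static_frame[OF st4 f5] by simp
  define gm' where "gm' = max 0 (\<gamma>h - (lo2 + 4 * h2))"
  define s6 where "s6 = s5\<lparr>rvar := (rvar s5)(''gm'' := \<gamma>h - lo2, ''gamma_minus'' := gm')\<rparr>"
  have "runs set_minus s5 (\<lambda>t s'. s' = s6 \<and> t \<le> 4)"
    using st5 by (simp add: runs_simps s6_def static_def lo2_def h2_def gm'_def max_def)
  then obtain u6 where e6: "exec set_minus s5 u6 s6" and u6: "real u6 \<le> 4"
    unfolding runs_def by blast
  have f6: "frame {''i''} {''gm'', ''gamma_minus''} {} s5 s6" by (auto simp: s6_def frame_def)
  have st6: "static s6" using static_frame[OF st5 f6] by simp
  have gp6: "rvar s6 ''gp'' = \<gamma>h + lo1" "rvar s6 ''gamma_plus'' = \<gamma>h + (lo1 + 4 * h1)"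
    by (simp_all add: frameD[OF f6] frameD[OF f5] s4_def)
  have gm6: "rvar s6 ''gm'' = \<gamma>h - lo2" "rvar s6 ''gamma_minus'' = gm'"
    by (simp_all add: s6_def)
  obtain u7 s7 where e7: "exec agd s6 u7 s7" and f7: "frame {''i''} agdR agdD s6 s7"
    and F7: "psd (\<gamma>h - lo2) \<and> psd (\<gamma>h + lo1) \<longrightarrow> F (\<gamma>h - lo2) (\<gamma>h + lo1) (rarr s7 ''x'') \<le> q0 x0 + \<epsilon> / 8"
    and u7: "real u7 \<le> 4000 * (N * agd_steps)"
    using runs_agd[OF st6 gm6(1) gp6(1)] unfolding runs_def by blast
  have out: "out_gamma_minus s7 = gm'" "out_gamma_plus s7 = \<gamma>h + (lo1 + 4 * h1)"
    using gm6 gp6 by (simp_all add: out_gamma_minus_def out_gamma_plus_def frameD[OF f7])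
  show ?thesis
    unfolding runs_def
  proof (intro exI conjI impI)
    show "exec approx_convex s (u1 + (u2 + (u3 + (u4 + (u5 + (u6 + u7)))))) s7"
      unfolding approx_convex_def
      by (rule exec_Seq[OF e1 exec_Seq[OF e2 exec_Seq[OF e3 exec_Seq[OF e4 exec_Seq[OF e5 exec_Seq[OF e6 e7]]]]]])
    have "N * 1 \<le> N * agd_steps" using agd_steps(1) N_ge by (intro mult_left_mono) auto
    then show "real (u1 + (u2 + (u3 + (u4 + (u5 + (u6 + u7)))))) \<le> 80000 * level_cost + 5000 * (N * agd_steps)"
      using u1 u2 u3 u4 u5 u6 u7 N_ge(2) unfolding of_nat_add mult_1_right by linarith
  next
    assume g: "good \<omega>"
    have p1: "psd (\<gamma>h + lo1)" "\<not> psd (\<gamma>h + (lo1 + 4 * h1))"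
      using P3 g good by (auto simp: Psd_def lo1_def h1_def)
    have p2: "psd (\<gamma>h - lo2)" "\<not> psd (\<gamma>h - (lo2 + 4 * h2))"
      using P5 g good by (auto simp: Psd_def lo2_def h2_def algebra_simps)
    have b: "0 < h1" "h1 \<le> \<delta>" "0 \<le> lo1" "0 < h2" "h2 \<le> \<delta>" "0 \<le> lo2"
      using h3 h5 by (auto simp: lo1_def h1_def lo2_def h2_def)
    \<comment> \<open>If the clipping acts, \<open>gm'\<close> is 0: still outside the interval, and
      closer to the inner parameter than before.\<close>
    have gm': "\<not> psd gm'" "0 \<le> gm'" "gm' \<le> \<gamma>h - lo2" "\<gamma>h - lo2 - gm' \<le> 4 * \<delta>"
      using p2 not_psd_0 psd_pos[OF p2(1)] b by (auto simp: gm'_def max_def)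
    have opt: "q0 x0 \<le> max (q gm' z) (q (\<gamma>h + (lo1 + 4 * h1)) z)" for z
      using gm' p1 b by (intro outer_opt_le) auto
    have val: "max (q gm' (rarr s7 ''x'')) (q (\<gamma>h + (lo1 + 4 * h1)) (rarr s7 ''x'')) \<le> q0 x0 + \<epsilon> / 2"
      using gm' p1 p2 b F7 \<epsilon>
      by (intro outer_value_le[where \<gamma>m = "\<gamma>h - lo2" and \<gamma>p = "\<gamma>h + lo1" and \<delta> = \<delta>]) (auto simp: F_def \<delta>_def)
    show "0 \<le> out_gamma_minus s7" "0 \<le> out_gamma_plus s7"
      using gm' \<gamma>h b by (simp_all add: out)
    show "\<forall>z. q0 x0 \<le> max (q (out_gamma_minus s7) z) (q (out_gamma_plus s7) z)"
      unfolding out using opt by simp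
    show "max (q (out_gamma_minus s7) (rarr s7 ''x'')) (q (out_gamma_plus s7) (rarr s7 ''x'')) \<le> q0 x0 + \<epsilon> / 2"
      unfolding out by (rule val)
  qed
qed

text \<open>The share p \<delta>/(4 h) doubles from level to level and is at most p/4 at the last
  level with h > \<delta>, so the levels of one search sum to at most p/2. The two searches together
  use p.\<close>

lemma good_event:
  assumes p1: "p < 1"
  shows "\<exists>E\<in>sets tape_measure. 1 - p \<le> measure tape_measure E \<and> (\<forall>\<omega>\<in>E. good \<omega>)"
proof -
  define J where "J = {j. \<delta> < step_len j}"
  obtain M where M: "\<zeta> / \<delta> < 2 ^ M" using real_arch_pow[of 2 "\<zeta> / \<delta>"] by auto
  have J: "J \<subseteq> {..<M}"
  proof
    fix j assume "j \<in> J"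
    then have "\<delta> * 2 ^ Suc j < \<zeta>" by (simp add: J_def step_len_def field_simps)
    then have "2 ^ Suc j < \<zeta> / \<delta>" using \<delta>_pos by (simp add: field_simps)
    then have "(2::real) ^ Suc j < 2 ^ M" using M by linarith
    then have "Suc j < M" by (simp only: power_strict_increasing_iff[of "2::real"])
    then show "j \<in> {..<M}" by simp
  qed
  then have fin: "finite J" using finite_subset by blast
  define pr where "pr j = p * \<delta> / (4 * step_len j)" for j
  have thr: "thr (step_len j) = 4 * real n / (pr j)\<^sup>2" for j
    using step_len_pos[of j] \<delta>_pos p by (simp add: thr_def pr_def power2_eq_square field_simps)
  have pr: "0 < pr j \<and> pr j \<le> 1" if "j \<in> J" for j
  proof
    show "0 < pr j" using step_len_pos[of j] \<delta>_pos p by (simp add: pr_def)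
    have "p * \<delta> \<le> 1 * (4 * step_len j)" using that p p1 \<delta>_pos step_len_pos[of j] by (intro mult_mono) (auto simp: J_def)
    then show "pr j \<le> 1" using step_len_pos[of j] by (simp add: pr_def)
  qed
  have sum: "(\<Sum>j\<in>J. pr j) \<le> p / 2"
  proof (cases "J = {}")
    case False
    define m where "m = Max J"
    have m: "m \<in> J" "J \<subseteq> {..m}" using False fin by (auto simp: m_def)
    have pr2: "pr j = p * \<delta> / (2 * \<zeta>) * 2 ^ j" for j
      using \<zeta> by (simp add: pr_def step_len_def field_simps)
    have "(\<Sum>j\<in>J. pr j) \<le> (\<Sum>j\<le>m. p * \<delta> / (2 * \<zeta>) * 2 ^ j)"
      unfolding pr2 using m \<delta>_pos \<zeta> p by (intro sum_mono2) auto
    also have "\<dots> = p * \<delta> / (2 * \<zeta>) * (2 ^ Suc m - 1)"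
      unfolding sum_distrib_left[symmetric] lessThan_Suc_atMost[symmetric] by (subst geometric_sum) auto
    also have "\<dots> \<le> p * \<delta> / (2 * \<zeta>) * 2 ^ Suc m"
      using \<delta>_pos \<zeta> p by (intro mult_left_mono) auto
    also have "\<dots> = p / 2 * (\<delta> / step_len m)" by (simp add: step_len_def)
    also have "\<dots> \<le> p / 2 * 1"
      using m(1) step_len_pos[of m] p by (intro mult_left_mono) (auto simp: J_def)
    finally show ?thesis by simp
  qed (use p in simp)
  define K where "K = {1, -1 :: real} \<times> J"
  have "(\<Sum>k\<in>K. pr (snd k)) = (\<Sum>\<sigma>\<in>{1, -1 :: real}. \<Sum>j\<in>J. pr j)"
    unfolding K_def by (subst sum.cartesian_product) (simp add: case_prod_beta)
  also have "\<dots> \<le> p" using sum by simp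
  finally have le: "(\<Sum>k\<in>K. pr (snd k)) \<le> p" .
  have "\<exists>E\<in>sets tape_measure. 1 - p \<le> measure tape_measure E \<and>
    (\<forall>\<omega>\<in>E. \<forall>k\<in>K. ip n \<omega> \<omega> < (4 * real n / (pr (snd k))\<^sup>2)\<^sup>2 * (ip n (bad_vec (fst k) (snd k)) \<omega>)\<^sup>2)"
    using fin le pr n_pos by (intro tape_good_event) (auto simp: K_def intro!: bad_vec(1))
  then show ?thesis
    by (elim bexE conjE, intro bexI conjI) (auto simp: good_def K_def J_def thr)
qed

end

section \<open>Matrices as operators on sequences\<close>

lemma scalar_prod_vec: "scalar_prod (Matrix.vec n x) (Matrix.vec n y) = ip n x y"
  by (simp add: scalar_prod_def ip_def atLeast0LessThan)

lemma scalar_prod_vec_right: "scalar_prod b (Matrix.vec n x) = ip n (vec_index b) x"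
  by (simp add: scalar_prod_def ip_def atLeast0LessThan)

lemma mult_mat_vec_vec:
  assumes "B \<in> carrier_mat n n"
  shows "B *\<^sub>v Matrix.vec n x = Matrix.vec n (op n B x)"
  using assms by (intro eq_vecI) (simp_all add: op_def scalar_prod_def atLeast0LessThan)

lemma vec_of_carrier: "v \<in> carrier_vec n \<Longrightarrow> v = Matrix.vec n (vec_index v)"
  by (intro eq_vecI) auto

lemma quad_vec:
  assumes "B \<in> carrier_mat n n"
  shows "quad B b c (Matrix.vec n x) = qf n (op n B) (vec_index b) c x"
  unfolding quad_def qf_def mult_mat_vec_vec[OF assms]
  by (subst scalar_prod_vec, subst scalar_prod_vec_right, rule refl)

lemma op_self_adjoint:
  assumes B: "B \<in> carrier_mat n n" "transpose_mat B = B"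
  shows "self_adjoint n (op n B)"
proof -
  have sym: "B $$ (i, j) = B $$ (j, i)" if "i < n" "j < n" for i j
    using that B index_transpose_mat(1)[of i B j] by auto
  have "ip n x (op n B y) = ip n (op n B x) y" for x y
  proof -
    have "ip n x (op n B y) = (\<Sum>i<n. \<Sum>j<n. x i * (B $$ (i, j) * y j))"
      by (simp add: ip_def op_def sum_distrib_left)
    also have "\<dots> = (\<Sum>j<n. \<Sum>i<n. x i * (B $$ (i, j) * y j))" by (rule sum.swap)
    also have "\<dots> = (\<Sum>j<n. \<Sum>i<n. (B $$ (j, i) * x i) * y j)"
      using sym by (intro sum.cong refl) (simp add: mult_ac)
    also have "\<dots> = ip n (op n B x) y" by (simp add: ip_def op_def sum_distrib_right)
    finally show ?thesis .
  qed
  moreover have "linear (op n B)"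
    by (intro linearI ext) (auto simp: op_def ring_distribs sum.distrib sum_distrib_left mult_ac)
  ultimately show ?thesis by (simp add: self_adjoint_def)
qed

lemma op_pencil:
  assumes "A0 \<in> carrier_mat n n" "A1 \<in> carrier_mat n n"
  shows "op n (pencil A0 A1 \<gamma>) x = op n A0 x + \<gamma> *\<^sub>R op n A1 x"
  using assms
  by (intro ext) (simp add: op_def pencil_def ring_distribs sum.distrib sum_distrib_left mult_ac)

lemma pencil_carrier:
  assumes "A0 \<in> carrier_mat n n" "A1 \<in> carrier_mat n n"
  shows "pencil A0 A1 \<gamma> \<in> carrier_mat n n"
  using assms by (simp add: pencil_def)

lemma pencil_symmetric:
  assumes "A0 \<in> carrier_mat n n" "A1 \<in> carrier_mat n n" "transpose_mat A0 = A0" "transpose_mat A1 = A1"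
  shows "transpose_mat (pencil A0 A1 \<gamma>) = pencil A0 A1 \<gamma>"
proof (rule eq_matI)
  fix i j assume "i < dim_row (pencil A0 A1 \<gamma>)" "j < dim_col (pencil A0 A1 \<gamma>)"
  then have ij: "i < n" "j < n" using assms by (auto simp: pencil_def)
  have "A0 $$ (i, j) = A0 $$ (j, i)" "A1 $$ (i, j) = A1 $$ (j, i)"
    using ij assms index_transpose_mat(1)[of i A0 j] index_transpose_mat(1)[of i A1 j] by auto
  then show "transpose_mat (pencil A0 A1 \<gamma>) $$ (i, j) = pencil A0 A1 \<gamma> $$ (i, j)"
    using ij assms by (simp add: pencil_def)
qed (use assms in \<open>auto simp: pencil_def\<close>)

lemma pos_semidef_iff:
  assumes "B \<in> carrier_mat n n"
  shows "pos_semidef B \<longleftrightarrow> (\<forall>w. 0 \<le> ip n w (op n B w))"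
proof
  assume *: "pos_semidef B"
  show "\<forall>w. 0 \<le> ip n w (op n B w)"
  proof
    fix w :: "nat \<Rightarrow> real"
    have "Matrix.vec n w \<in> carrier_vec (dim_row B)" using assms by simp
    then have "0 \<le> scalar_prod (Matrix.vec n w) (B *\<^sub>v Matrix.vec n w)" using * unfolding pos_semidef_def by blast
    then show "0 \<le> ip n w (op n B w)" by (simp add: mult_mat_vec_vec[OF assms] scalar_prod_vec)
  qed
next
  assume *: "\<forall>w. 0 \<le> ip n w (op n B w)"
  show "pos_semidef B" unfolding pos_semidef_def
  proof
    fix v :: "real Matrix.vec" assume "v \<in> carrier_vec (dim_row B)"
    then have v: "v = Matrix.vec n (vec_index v)" using assms by (intro vec_of_carrier) simp
    show "0 \<le> scalar_prod v (B *\<^sub>v v)"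
      using * by (subst (1 2) v) (simp only: mult_mat_vec_vec[OF assms] scalar_prod_vec)
  qed
qed

text \<open>Values of quadratics ignore the coordinates beyond n, but compactness requires these to
  be fixed; setting them to 0 loses no value.\<close>

definition restr :: "nat \<Rightarrow> (nat \<Rightarrow> real) \<Rightarrow> nat \<Rightarrow> real" where "restr n x i = (if i < n then x i else 0)"

lemma qf_cong:
  assumes "\<And>i. i < n \<Longrightarrow> x i = y i"
  shows "qf n (op n B) b c x = qf n (op n B) b c y"
  unfolding qf_def ip_def using assms op_cong[of n x y B] by simp

section \<open>Existence of minimizers and the smallest eigenvalue\<close>

lemma compact_box: "compact {x::nat \<Rightarrow> real. (\<forall>i\<ge>n. x i = 0) \<and> (\<forall>i<n. \<bar>x i\<bar> \<le> R)}"
proof -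
  have "compactin (product_topology (\<lambda>i. euclidean) UNIV) (PiE UNIV (\<lambda>i. if i < n then {-R..R} else {0::real}))"
    unfolding compactin_PiE by auto
  then have "compact (PiE UNIV (\<lambda>i. if i < n then {-R..R} else {0::real}))"
    by (simp add: euclidean_product_topology)
  moreover have "PiE UNIV (\<lambda>i. if i < n then {-R..R} else {0::real})
      = {x. (\<forall>i\<ge>n. x i = 0) \<and> (\<forall>i<n. \<bar>x i\<bar> \<le> R)}"
    by (auto simp: PiE_iff abs_le_iff minus_le_iff split: if_splits)
  ultimately show ?thesis by simp
qed

lemma continuous_on_ip [continuous_intros]:
  "continuous_on UNIV f \<Longrightarrow> continuous_on UNIV g \<Longrightarrow> continuous_on UNIV (\<lambda>x. ip n (f x) (g x))"
  unfolding ip_def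
  by (intro continuous_on_sum continuous_on_mult; erule continuous_on_product_then_coordinatewise)

lemma continuous_on_op [continuous_intros]: "continuous_on UNIV (op n B)"
proof (rule continuous_on_coordinatewise_then_product)
  show "continuous_on UNIV (\<lambda>x. op n B x i)" for i
    unfolding op_def by (cases "i < n") (auto intro!: continuous_intros)
qed

lemma continuous_on_qf: "continuous_on UNIV (qf n (op n B) b c)"
  unfolding qf_def[abs_def]
  by (intro continuous_on_add continuous_on_mult continuous_on_ip continuous_on_op continuous_on_const continuous_on_id)

lemma attains_min_supported:
  fixes f :: "(nat \<Rightarrow> real) \<Rightarrow> real"
  assumes cont: "continuous_on UNIV f" and closed: "closed S"
    and supp: "\<And>x i. x \<in> S \<Longrightarrow> n \<le> i \<Longrightarrow> x i = 0" and xb: "xb \<in> S"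
    and bound: "\<And>x. x \<in> S \<Longrightarrow> f x \<le> f xb \<Longrightarrow> ip n x x \<le> R"
  shows "\<exists>x\<in>S. \<forall>y\<in>S. f x \<le> f y"
proof -
  define K where "K = {x::nat \<Rightarrow> real. (\<forall>i\<ge>n. x i = 0) \<and> (\<forall>i<n. \<bar>x i\<bar> \<le> sqrt R)} \<inter> S"
  have inK: "x \<in> K" if "x \<in> S" "f x \<le> f xb" for x
  proof -
    have "\<bar>x i\<bar> \<le> sqrt R" if "i < n" for i
    proof -
      have "x i * x i \<le> ip n x x"
        unfolding ip_def using that by (intro member_le_sum) auto
      then have "(x i)\<^sup>2 \<le> R" using bound[OF \<open>x \<in> S\<close> \<open>f x \<le> f xb\<close>] by (simp add: power2_eq_square)
      then have "sqrt ((x i)\<^sup>2) \<le> sqrt R" by (rule real_sqrt_le_mono)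
      then show ?thesis by simp
    qed
    then show ?thesis using that supp by (simp add: K_def)
  qed
  have "compact K" unfolding K_def using compact_box closed by (rule compact_Int_closed)
  moreover have "xb \<in> K" using inK xb by simp
  ultimately obtain x where x: "x \<in> K" "\<forall>y\<in>K. f x \<le> f y"
    using continuous_attains_inf[of K f] continuous_on_subset[OF cont] by blast
  have "f x \<le> f y" if "y \<in> S" for y
    using x(2) \<open>xb \<in> K\<close> inK[OF that] by (metis linear order_trans)
  then show ?thesis using x(1) by (auto simp: K_def)
qed

text \<open>A unit vector u that minimizes the form, with minimum l, annihilates the positive
  semidefinite form of T = B - l; Cauchy-Schwarz for this form then yields T u = 0. No multiplier
  rule and no diagonalization enter.\<close>

lemma smallest_eigenvector:
  assumes B: "B \<in> carrier_mat n n" "transpose_mat B = B" and n: "0 < n"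
  obtains u l where "ip n u u = 1" "op n B u = l *\<^sub>R u" "\<And>w. l * ip n w w \<le> ip n w (op n B w)"
proof -
  note sa = op_self_adjoint[OF B]
  define S where "S = {u::nat \<Rightarrow> real. (\<forall>i\<ge>n. u i = 0) \<and> ip n u u = 1}"
  define f where "f u = ip n u (op n B u)" for u
  have "\<exists>x\<in>S. \<forall>y\<in>S. f x \<le> f y"
  proof (rule attains_min_supported[where n = n and R = 1])
    show "continuous_on UNIV f" unfolding f_def by (intro continuous_intros)
    have "closed {u::nat \<Rightarrow> real. u i = 0}" for i
      by (intro closed_Collect_eq) auto
    then have "closed (\<Inter>i\<in>{n..}. {u::nat \<Rightarrow> real. u i = 0})" by blast
    moreover have "closed {u. ip n u u = 1}"
      by (intro closed_Collect_eq continuous_intros)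
    ultimately have "closed ((\<Inter>i\<in>{n..}. {u::nat \<Rightarrow> real. u i = 0}) \<inter> {u. ip n u u = 1})" by (rule closed_Int)
    moreover have "(\<Inter>i\<in>{n..}. {u::nat \<Rightarrow> real. u i = 0}) \<inter> {u. ip n u u = 1} = S" by (auto simp: S_def)
    ultimately show "closed S" by simp
    have "ip n (\<lambda>i. if i = 0 then 1 else 0) (\<lambda>i. if i = 0 then 1 else 0) = 1"
      using n by (simp add: ip_def if_distrib[of "\<lambda>x. x * _"] cong: if_cong)
    then show "(\<lambda>i. if i = 0 then 1 else 0) \<in> S" using n by (simp add: S_def)
  qed (auto simp: S_def)
  then obtain u where u: "u \<in> S" "\<And>y. y \<in> S \<Longrightarrow> f u \<le> f y" by blast
  define l where "l = f u"
  have unit: "ip n u u = 1" using u by (simp add: S_def)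
  have low: "l * ip n w w \<le> ip n w (op n B w)" for w
  proof (cases "ip n w w = 0")
    case True
    have "(ip n w (op n B w))\<^sup>2 \<le> ip n w w * ip n (op n B w) (op n B w)" by (rule ip_Cauchy_Schwarz)
    then show ?thesis using True by simp
  next
    case False
    then have pos: "0 < ip n w w" by (simp add: order_less_le)
    define y where "y = restr n ((1 / sqrt (ip n w w)) *\<^sub>R w)"
    have eq: "ip n y (op n B y) = ip n w (op n B w) / ip n w w" "ip n y y = 1"
    proof -
      have c: "\<And>i. i < n \<Longrightarrow> y i = ((1 / sqrt (ip n w w)) *\<^sub>R w) i" by (simp add: y_def restr_def)
      have "ip n y (op n B y) = ip n ((1 / sqrt (ip n w w)) *\<^sub>R w) (op n B ((1 / sqrt (ip n w w)) *\<^sub>R w))"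
        using c op_cong[of n y "(1 / sqrt (ip n w w)) *\<^sub>R w" B] by (intro ip_cong) auto
      also have "\<dots> = (1 / sqrt (ip n w w)) * ((1 / sqrt (ip n w w)) * ip n w (op n B w))"
        unfolding self_adjointD(3)[OF sa] ip_simps ..
      also have "\<dots> = ip n w (op n B w) / ip n w w" using pos by simp
      finally show "ip n y (op n B y) = ip n w (op n B w) / ip n w w" .
      have "ip n y y = ip n ((1 / sqrt (ip n w w)) *\<^sub>R w) ((1 / sqrt (ip n w w)) *\<^sub>R w)"
        using c by (intro ip_cong) auto
      also have "\<dots> = (1 / sqrt (ip n w w)) * ((1 / sqrt (ip n w w)) * ip n w w)"
        unfolding ip_simps ..
      also have "\<dots> = 1" using pos by simp
      finally show "ip n y y = 1" .
    qed
    then have "y \<in> S" by (simp add: S_def y_def restr_def)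
    then have "l \<le> ip n w (op n B w) / ip n w w" using u(2)[of y] eq by (simp add: l_def f_def)
    then show ?thesis using pos by (simp add: field_simps)
  qed
  define T where "T = (\<lambda>w. 1 *\<^sub>R op n B w + (- l) *\<^sub>R w)"
  have T: "self_adjoint n T" unfolding T_def using sa self_adjoint_id by (rule self_adjoint_add_scale)
  have Tpsd: "0 \<le> ip n w (T w)" for w using low[of w] by (simp add: T_def ip_simps)
  have Tu: "ip n u (T u) = 0" using unit by (simp add: T_def ip_simps l_def f_def)
  have "ip n (T u) (T u) = 0"
    using psd_form_Cauchy_Schwarz[OF T Tpsd, of "T u" u] Tu by simp
  then have "T u i = 0" if "i < n" for i
    using that by (auto simp: ip_def sum_nonneg_eq_0_iff)
  then have "op n B u i = (l *\<^sub>R u) i" for i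
    using u(1) by (cases "i < n") (auto simp: T_def S_def op_def)
  then have "op n B u = l *\<^sub>R u" by (rule ext)
  then show thesis using that unit low by blast
qed

lemma eigenvalue_op:
  assumes B: "B \<in> carrier_mat n n" and u: "ip n u u = 1" "op n B u = l *\<^sub>R u"
  shows "eigenvalue B l"
proof -
  have "Matrix.vec n u \<noteq> 0\<^sub>v n"
  proof
    assume "Matrix.vec n u = 0\<^sub>v n"
    then have "scalar_prod (Matrix.vec n u) (Matrix.vec n u) = 0" by simp
    then show False using u(1) by (simp add: scalar_prod_vec)
  qed
  moreover have "B *\<^sub>v Matrix.vec n u = l \<cdot>\<^sub>v Matrix.vec n u"
    unfolding mult_mat_vec_vec[OF B] u(2) by (intro eq_vecI) auto
  ultimately show ?thesis using B unfolding eigenvalue_def eigenvector_def by (intro exI[of _ "Matrix.vec n u"]) simp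
qed

lemma lambda_min_le_form:
  assumes B: "B \<in> carrier_mat n n" "transpose_mat B = B" and n: "0 < n" and \<xi>: "\<xi> \<le> lambda_min B"
  shows "\<xi> * ip n w w \<le> ip n w (op n B w)"
proof -
  obtain u l where u: "ip n u u = 1" "op n B u = l *\<^sub>R u" "\<And>w. l * ip n w w \<le> ip n w (op n B w)"
    by (rule smallest_eigenvector[OF B n]) blast
  have "l \<in> {k. eigenvalue B k}" using eigenvalue_op[OF B(1) u(1,2)] by simp
  moreover have "finite {k. eigenvalue B k}"
    using card_finite_spectrum(1)[OF B(1)] by (simp add: spectrum_def)
  ultimately have "lambda_min B \<le> l" unfolding lambda_min_def by (rule Min_le[rotated])
  then have "\<xi> * ip n w w \<le> l * ip n w w" using \<xi> by (intro mult_right_mono) auto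
  then show ?thesis using u(3)[of w] by linarith
qed

section \<open>The assumptions on matrices as inequalities between forms\<close>

lemma neg_eigenvalue_form:
  assumes B: "B \<in> carrier_mat n n" and k: "eigenvalue B k" "k < 0"
  obtains w where "ip n w (op n B w) < 0" "0 < ip n w w"
proof -
  obtain v where v: "v \<in> carrier_vec n" "v \<noteq> 0\<^sub>v n" "B *\<^sub>v v = k \<cdot>\<^sub>v v"
    using k B by (auto simp: eigenvalue_def eigenvector_def)
  define w where "w = vec_index v"
  have vw: "v = Matrix.vec n w" unfolding w_def using v(1) by (rule vec_of_carrier)
  have "ip n w w \<noteq> 0"
  proof
    assume "ip n w w = 0"
    then have "\<forall>i<n. w i = 0" by (auto simp: ip_def sum_nonneg_eq_0_iff)
    then have "v = 0\<^sub>v n" using v(1) by (intro eq_vecI) (auto simp: w_def)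
    with v(2) show False by simp
  qed
  then have pos: "0 < ip n w w" by (simp add: order_less_le)
  have "Matrix.vec n (op n B w) = Matrix.vec n (k *\<^sub>R w)"
    using v(3) unfolding mult_mat_vec_vec[OF B, symmetric] vw[symmetric] by (simp add: vw) (auto intro!: eq_vecI)
  then have "ip n w (op n B w) = ip n w (k *\<^sub>R w)"
    unfolding scalar_prod_vec[symmetric] by simp
  also have "\<dots> = k * ip n w w" by (simp only: ip_simps)
  finally have "ip n w (op n B w) < 0" using pos k(2) by (simp add: mult_neg_pos)
  then show thesis using that pos by blast
qed

lemma spectral_norm_form:
  assumes B: "B \<in> carrier_mat n n" and norm: "spectral_norm B \<le> 1"
  shows "\<bar>ip n w (op n B w)\<bar> \<le> ip n w w"
proof -
  let ?S = "{vec_norm (B *\<^sub>v x) |x. x \<in> carrier_vec (dim_col B) \<and> vec_norm x \<le> 1}"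
  \<comment> \<open>A real supremum says something about its set only if the set is bounded above;
    the Frobenius norm is a bound.\<close>
  have bdd: "bdd_above ?S"
  proof (rule bdd_aboveI)
    fix r assume "r \<in> ?S"
    then obtain x where x: "x \<in> carrier_vec n" "vec_norm x \<le> 1" "r = vec_norm (B *\<^sub>v x)" using B by auto
    define y where "y = vec_index x"
    have xy: "x = Matrix.vec n y" unfolding y_def using x(1) by (rule vec_of_carrier)
    have y1: "ip n y y \<le> 1" using x(2) unfolding xy vec_norm_def scalar_prod_vec by simp
    have "ip n (op n B y) (op n B y) = (\<Sum>i<n. (ip n (\<lambda>j. B $$ (i, j)) y)\<^sup>2)"
      by (simp add: ip_def op_def power2_eq_square)
    also have "\<dots> \<le> (\<Sum>i<n. ip n (\<lambda>j. B $$ (i, j)) (\<lambda>j. B $$ (i, j)) * 1)"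
      using y1 by (intro sum_mono order_trans[OF ip_Cauchy_Schwarz] mult_left_mono) auto
    finally have "ip n (op n B y) (op n B y) \<le> (\<Sum>i<n. ip n (\<lambda>j. B $$ (i, j)) (\<lambda>j. B $$ (i, j)))" by simp
    then show "r \<le> sqrt (\<Sum>i<n. ip n (\<lambda>j. B $$ (i, j)) (\<lambda>j. B $$ (i, j)))"
      unfolding x(3) xy mult_mat_vec_vec[OF B] vec_norm_def scalar_prod_vec by simp
  qed
  show ?thesis
  proof (cases "ip n w w = 0")
    case True
    then show ?thesis using ip_Cauchy_Schwarz[of n w "op n B w"] by simp
  next
    case False
    then have pos: "0 < ip n w w" by (simp add: order_less_le)
    define a where "a = 1 / sqrt (ip n w w)"
    have a: "a * a * ip n w w = 1" using pos by (simp add: a_def)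
    have lin: "op n B (a *\<^sub>R w) = a *\<^sub>R op n B w"
      by (intro ext) (simp add: op_def sum_distrib_left mult_ac)
    have "vec_norm (B *\<^sub>v Matrix.vec n (a *\<^sub>R w)) \<in> ?S"
    proof -
      have "vec_norm (Matrix.vec n (a *\<^sub>R w)) \<le> 1"
        unfolding vec_norm_def scalar_prod_vec ip_simps using a by (simp add: mult.assoc)
      then show ?thesis using B by (intro CollectI exI[of _ "Matrix.vec n (a *\<^sub>R w)"]) simp
    qed
    then have "vec_norm (B *\<^sub>v Matrix.vec n (a *\<^sub>R w)) \<le> spectral_norm B"
      unfolding spectral_norm_def using bdd by (rule cSup_upper)
    then have "sqrt (ip n (op n B (a *\<^sub>R w)) (op n B (a *\<^sub>R w))) \<le> 1"
      using norm unfolding mult_mat_vec_vec[OF B] vec_norm_def scalar_prod_vec by linarith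
    then have "ip n (op n B (a *\<^sub>R w)) (op n B (a *\<^sub>R w)) \<le> 1" by simp
    then have "a * a * ip n (op n B w) (op n B w) \<le> a * a * ip n w w"
      unfolding lin ip_simps using a by (simp add: mult.assoc)
    moreover have "0 < a * a" using pos by (simp add: a_def)
    ultimately have "ip n (op n B w) (op n B w) \<le> ip n w w" by (simp only: mult_le_cancel_left_pos)
    then have "(ip n w (op n B w))\<^sup>2 \<le> ip n w w * ip n w w"
      using ip_Cauchy_Schwarz[of n w "op n B w"] mult_left_mono[of _ "ip n w w" "ip n w w"]
      by (meson ip_nonneg order_trans)
    then have "\<bar>ip n w (op n B w)\<bar>\<^sup>2 \<le> (ip n w w)\<^sup>2" by (simp add: power2_eq_square)
    then show ?thesis by (rule power2_le_imp_le) simp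
  qed
qed

lemma vec_norm_form:
  assumes "b \<in> carrier_vec n" "vec_norm b \<le> 1"
  shows "\<bar>ip n (vec_index b) w\<bar> \<le> sqrt (ip n w w)"
proof -
  have "scalar_prod b b = ip n (vec_index b) (vec_index b)"
    using scalar_prod_vec[of n "vec_index b" "vec_index b"]
    unfolding vec_of_carrier[OF assms(1), symmetric] .
  then have "ip n (vec_index b) (vec_index b) \<le> 1" using assms(2) by (simp add: vec_norm_def)
  then have "(ip n (vec_index b) w)\<^sup>2 \<le> 1 * ip n w w"
    by (intro order_trans[OF ip_Cauchy_Schwarz] mult_right_mono) auto
  then have "(ip n (vec_index b) w)\<^sup>2 \<le> ip n w w" by simp
  from real_sqrt_le_mono[OF this] show ?thesis by simp
qed

text \<open>The direction of negative curvature of A1 leads to a feasible point. On the feasible set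
  q0 dominates q0 + \<gamma> q1, which is coercive by the lower bound \<xi>, so sublevel sets are
  bounded.\<close>

lemma optimum_exists:
  assumes A: "A0 \<in> carrier_mat n n" "A1 \<in> carrier_mat n n"
    and sym: "transpose_mat A0 = A0" "transpose_mat A1 = A1" and \<gamma>: "0 \<le> \<gamma>" and \<xi>: "0 < \<xi>"
    and hat: "\<And>w. \<xi> * ip n w w \<le> ip n w (op n A0 w + \<gamma> *\<^sub>R op n A1 w)"
    and neg: "ip n w1 (op n A1 w1) < 0"
  obtains x0 where "qf n (op n A1) b1 c1 x0 \<le> 0"
    "\<And>y. qf n (op n A1) b1 c1 y \<le> 0 \<Longrightarrow> qf n (op n A0) b0 c0 x0 \<le> qf n (op n A0) b0 c0 y"
proof -
  let ?q0 = "qf n (op n A0) b0 c0" and ?q1 = "qf n (op n A1) b1 c1"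
  have restr: "?q0 (restr n x) = ?q0 x" "?q1 (restr n x) = ?q1 x" for x
    by (intro qf_cong; simp add: restr_def)+
  define S where "S = {x. (\<forall>i\<ge>n. x i = 0) \<and> ?q1 x \<le> 0}"
  obtain t where t: "?q1 (t *\<^sub>R w1) \<le> 0"
  proof -
    define a b where "a = - ip n w1 (op n A1 w1)" and "b = ip n b1 w1"
    define t where "t = (2 * \<bar>b\<bar> + \<bar>c1\<bar>) / a + 1"
    have a: "0 < a" using neg by (simp add: a_def)
    have t1: "1 \<le> t" "2 * \<bar>b\<bar> + \<bar>c1\<bar> \<le> a * t" using a by (auto simp: t_def field_simps)
    have eq: "?q1 (t *\<^sub>R w1) = - (a * t) * t + 2 * (b * t) + c1"
      unfolding qf_def self_adjointD(3)[OF op_self_adjoint[OF A(2) sym(2)]] ip_simps by (simp add: a_def b_def)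
    have "(2 * \<bar>b\<bar> + \<bar>c1\<bar>) * t \<le> (a * t) * t" using t1 by (intro mult_right_mono) auto
    moreover have "b * t \<le> \<bar>b\<bar> * t" using t1 by (intro mult_right_mono) auto
    moreover have "c1 \<le> \<bar>c1\<bar> * t" using t1 mult_left_mono[of 1 t "\<bar>c1\<bar>"] by simp
    ultimately have "?q1 (t *\<^sub>R w1) \<le> 0" unfolding eq by (simp add: algebra_simps)
    then show thesis by (rule that)
  qed
  define xb where "xb = restr n (t *\<^sub>R w1)"
  have xb: "xb \<in> S" using t restr(2)[of "t *\<^sub>R w1"] unfolding S_def xb_def by (simp add: restr_def)
  define b where "b = b0 + \<gamma> *\<^sub>R b1"
  have "\<exists>x\<in>S. \<forall>y\<in>S. ?q0 x \<le> ?q0 y"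
  proof (rule attains_min_supported[where n = n and xb = xb])
    show "continuous_on UNIV ?q0" by (rule continuous_on_qf)
    have "closed {u::nat \<Rightarrow> real. u i = 0}" for i
      by (intro closed_Collect_eq) auto
    then have "closed (\<Inter>i\<in>{n..}. {u::nat \<Rightarrow> real. u i = 0})" by blast
    moreover have "closed {x. ?q1 x \<le> 0}"
      by (intro closed_Collect_le continuous_on_qf continuous_on_const)
    ultimately have "closed ((\<Inter>i\<in>{n..}. {u::nat \<Rightarrow> real. u i = 0}) \<inter> {x. ?q1 x \<le> 0})" by (rule closed_Int)
    moreover have "(\<Inter>i\<in>{n..}. {u::nat \<Rightarrow> real. u i = 0}) \<inter> {x. ?q1 x \<le> 0} = S" by (auto simp: S_def)
    ultimately show "closed S" by simp
    fix x assume x: "x \<in> S" "?q0 x \<le> ?q0 xb"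
    have "\<gamma> * ?q1 x \<le> 0" using x(1) \<gamma> by (simp add: S_def mult_nonneg_nonpos)
    then have "?q0 x + \<gamma> * ?q1 x \<le> ?q0 xb" using x(2) by linarith
    moreover have "?q0 x + \<gamma> * ?q1 x = ip n x (op n A0 x + \<gamma> *\<^sub>R op n A1 x) + 2 * ip n b x + (c0 + \<gamma> * c1)"
      by (simp add: qf_def b_def ip_simps algebra_simps)
    ultimately have 1: "\<xi> * ip n x x + 2 * ip n b x + (c0 + \<gamma> * c1) \<le> ?q0 xb"
      using hat[of x] by linarith
    have "0 \<le> ip n ((\<xi> / 2) *\<^sub>R x + b) ((\<xi> / 2) *\<^sub>R x + b)" by simp
    then have "0 \<le> \<xi> * \<xi> / 4 * ip n x x + \<xi> * ip n b x + ip n b b"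
      by (simp add: ip_simps ip_commute[of n x b] algebra_simps)
    then have "0 \<le> (2 / \<xi>) * (\<xi> * \<xi> / 4 * ip n x x + \<xi> * ip n b x + ip n b b)" using \<xi> by simp
    also have "\<dots> = \<xi> / 2 * ip n x x + 2 * ip n b x + 2 / \<xi> * ip n b b" using \<xi> by (simp add: field_simps)
    finally have "\<xi> / 2 * ip n x x \<le> ?q0 xb - (c0 + \<gamma> * c1) + 2 / \<xi> * ip n b b" using 1 by linarith
    then show "ip n x x \<le> (?q0 xb - (c0 + \<gamma> * c1) + 2 / \<xi> * ip n b b) / (\<xi> / 2)"
      using \<xi> by (simp add: field_simps)
  qed (use xb in \<open>auto simp: S_def\<close>)
  then obtain x0 where x0: "x0 \<in> S" "\<And>y. y \<in> S \<Longrightarrow> ?q0 x0 \<le> ?q0 y" by blast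
  have "?q0 x0 \<le> ?q0 y" if "?q1 y \<le> 0" for y
  proof -
    have "restr n y \<in> S" using that restr(2)[of y] unfolding S_def by (simp add: restr_def)
    from x0(2)[OF this] show ?thesis unfolding restr .
  qed
  moreover have "?q1 x0 \<le> 0" using x0(1) by (simp add: S_def)
  ultimately show thesis using that by blast
qed

text \<open>The operator \<open>GREATEST\<close> is meaningful only if a maximum exists: the
  admissible parameters form a closed set, and the direction \<open>w1\<close> bounds it from
  above.\<close>

lemma le_gamma_plus:
  assumes A: "A0 \<in> carrier_mat n n" "A1 \<in> carrier_mat n n"
    and neg: "ip n w1 (op n A1 w1) < 0"
    and \<gamma>: "0 \<le> \<gamma>" "\<And>w. 0 \<le> ip n w (op n A0 w + \<gamma> *\<^sub>R op n A1 w)"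
  shows "\<gamma> \<le> gamma_plus A0 A1"
proof -
  define G where "G = {\<gamma>. 0 \<le> \<gamma> \<and> (\<forall>w. 0 \<le> ip n w (op n A0 w) + \<gamma> * ip n w (op n A1 w))}"
  have G: "0 \<le> \<gamma> \<and> pos_semidef (pencil A0 A1 \<gamma>) \<longleftrightarrow> \<gamma> \<in> G" for \<gamma>
    using pos_semidef_iff[OF pencil_carrier[OF A]] by (simp add: G_def op_pencil[OF A] ip_simps)
  have "\<gamma> \<in> G" using \<gamma> by (simp add: G_def ip_simps)
  have bdd: "bdd_above G"
  proof (rule bdd_aboveI)
    fix g assume "g \<in> G"
    then have "0 \<le> ip n w1 (op n A0 w1) + g * ip n w1 (op n A1 w1)" by (simp add: G_def)
    then show "g \<le> ip n w1 (op n A0 w1) / (- ip n w1 (op n A1 w1))" using neg by (simp add: field_simps)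
  qed
  have "closed {g. 0 \<le> ip n w (op n A0 w) + g * ip n w (op n A1 w)}" for w
    by (intro closed_Collect_le continuous_intros)
  then have "closed ({0..} \<inter> (\<Inter>w. {g. 0 \<le> ip n w (op n A0 w) + g * ip n w (op n A1 w)}))"
    by (intro closed_Int closed_INT) auto
  moreover have "{0..} \<inter> (\<Inter>w. {g. 0 \<le> ip n w (op n A0 w) + g * ip n w (op n A1 w)}) = G"
    by (auto simp: G_def)
  ultimately have "closed G" by simp
  then have "Sup G \<in> G" using closed_contains_Sup[of G] bdd \<open>\<gamma> \<in> G\<close> by blast
  then have "gamma_plus A0 A1 = Sup G"
    unfolding gamma_plus_def G using bdd by (intro Greatest_equality) (auto intro: cSup_upper)
  then show ?thesis using bdd \<open>\<gamma> \<in> G\<close> by (simp add: cSup_upper)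
qed

text \<open>Testing the lower bound \<xi> on unit coordinate vectors shows that every diagonal entry
  of the pencil is positive, so each index has a nonzero diagonal entry in A0 or in A1.\<close>

lemma dim_le_nnz:
  assumes A: "A0 \<in> carrier_mat n n" "A1 \<in> carrier_mat n n" and \<xi>: "0 < \<xi>"
    and hat: "\<And>w. \<xi> * ip n w w \<le> ip n w (op n A0 w + \<gamma> *\<^sub>R op n A1 w)"
  shows "n \<le> nnz A0 + nnz A1"
proof -
  define D where "D B = {i. i < n \<and> B $$ (i, i) \<noteq> (0::real)}" for B
  have cardD: "card (D B) \<le> nnz B" if "B \<in> carrier_mat n n" for B
  proof -
    have "nonzero_positions B \<subseteq> {..<n} \<times> {..<n}" using that by (auto simp: nonzero_positions_def)
    then have "finite (nonzero_positions B)" by (rule finite_subset) simp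
    moreover have "(\<lambda>i. (i, i)) ` D B \<subseteq> nonzero_positions B" using that by (auto simp: D_def nonzero_positions_def)
    ultimately have "card ((\<lambda>i. (i, i)) ` D B) \<le> nnz B" unfolding nnz_def by (rule card_mono)
    then show ?thesis by (simp add: card_image inj_on_def)
  qed
  have "{..<n} \<subseteq> D A0 \<union> D A1"
  proof
    fix i assume i: "i \<in> {..<n}"
    define e where "e j = (if j = i then 1 else (0::real))" for j
    have "ip n e e = 1" using i by (simp add: ip_def e_def if_distrib[of "\<lambda>x. x * _"] cong: if_cong)
    moreover have "ip n e (op n B e) = B $$ (i, i)" for B
      using i by (simp add: ip_def op_def e_def if_distrib[of "\<lambda>x. x * _"] if_distrib[of "\<lambda>x. _ * x"] cong: if_cong)
    ultimately have "\<xi> \<le> A0 $$ (i, i) + \<gamma> * A1 $$ (i, i)" using hat[of e] by (simp add: ip_simps)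
    then have "A0 $$ (i, i) \<noteq> 0 \<or> A1 $$ (i, i) \<noteq> 0" using \<xi> by auto
    then show "i \<in> D A0 \<union> D A1" using i by (auto simp: D_def)
  qed
  then have "card {..<n} \<le> card (D A0 \<union> D A1)" by (intro card_mono) (auto simp: D_def)
  also have "\<dots> \<le> card (D A0) + card (D A1)" by (rule card_Un_le)
  finally show ?thesis using cardD[OF A(1)] cardD[OF A(2)] by simp
qed

section \<open>Running time in closed form and assembly\<close>

lemma length_nonzeros: "lists_nonzeros L B \<Longrightarrow> length L = nnz B"
  by (metis lists_nonzeros_def nnz_def distinct_card)

lemma minimum_on_eq: "x \<in> S \<Longrightarrow> (\<And>y. y \<in> S \<Longrightarrow> f x \<le> f y) \<Longrightarrow> minimum_on f S = f x"
  unfolding minimum_on_def by (intro Least_equality) auto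

text \<open>With R = \<kappa>^(3/2) sqrt(\<zeta>/\<epsilon>) the choice of \<delta> gives \<kappa>
  \<zeta>/\<delta> = 1000 R^2 \<le> (32 R)^2, so the searches account for R. The descent takes
  \<kappa> sqrt(\<zeta>/\<epsilon>) \<le> R rounds up to a constant.\<close>

lemma (in gtrs_machine) total_time:
  "80000 * level_cost + 5000 * (N * agd_steps)
    \<le> 2600000 * main_time n (length L0 + length L1) \<zeta> (\<zeta> / \<xi>) \<epsilon> p"
proof -
  define R where "R = \<kappa> powr (3/2) * sqrt \<zeta> / sqrt \<epsilon>"
  define lf where "lf = log_factor (real n / p)"
  have pos: "0 < \<kappa>" using \<kappa>_ge_1 by simp
  have R0: "0 \<le> R" using \<zeta> \<epsilon> by (simp add: R_def)
  have "(\<kappa> powr (3/2))\<^sup>2 = \<kappa> ^ 3"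
  proof -
    have "(\<kappa> powr (3/2))\<^sup>2 = \<kappa> powr (3/2 + 3/2)" by (simp only: power2_eq_square powr_add)
    also have "\<dots> = \<kappa> ^ 3" using pos powr_realpow[of \<kappa> 3] by simp
    finally show ?thesis .
  qed
  then have R2: "R\<^sup>2 = \<kappa> ^ 3 * \<zeta> / \<epsilon>"
    using \<zeta> \<epsilon> by (simp add: R_def power_mult_distrib power_divide)
  have "\<kappa> * \<zeta> / \<delta> = 1000 * (\<kappa> ^ 3 * \<zeta> / \<epsilon>)"
    using pos by (simp add: \<delta>_def power2_eq_square power3_eq_cube)
  also have "\<dots> \<le> 1024 * R\<^sup>2" unfolding R2[symmetric] by simp
  also have "\<dots> = (32 * R)\<^sup>2" by (simp add: power_mult_distrib)
  finally have s1: "sqrt (\<kappa> * \<zeta> / \<delta>) \<le> 32 * R" using R0 by (intro real_le_lsqrt) auto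
  have s2: "agd_steps \<le> R"
  proof (rule power2_le_imp_le[OF _ R0])
    have "agd_steps\<^sup>2 = 1 * (\<kappa>\<^sup>2 * \<zeta> / \<epsilon>)"
      using \<zeta> \<epsilon> by (simp add: agd_steps_def power_mult_distrib)
    also have "\<dots> \<le> \<kappa> * (\<kappa>\<^sup>2 * \<zeta> / \<epsilon>)" using \<kappa>_ge_1 \<zeta> \<epsilon> by (intro mult_right_mono) auto
    also have "\<dots> = R\<^sup>2" unfolding R2 by (simp add: power2_eq_square power3_eq_cube)
    finally show "agd_steps\<^sup>2 \<le> R\<^sup>2" .
  qed
  have lf: "1 \<le> lf" using log_factor_ge by (simp add: lf_def)
  have "level_cost \<le> N * (32 * R * lf)"
    unfolding level_cost_def lf_def[symmetric] using s1 lf N_ge by (intro mult_left_mono mult_right_mono) auto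
  moreover have "N * agd_steps \<le> N * (R * lf)"
  proof (intro mult_left_mono)
    show "agd_steps \<le> R * lf" using s2 R0 lf mult_left_mono[of 1 lf R] by simp
  qed (use N_ge in simp)
  ultimately have "80000 * level_cost + 5000 * (N * agd_steps) \<le> 2565000 * (N * R * lf)"
    by (simp add: algebra_simps)
  also have "\<dots> \<le> 2600000 * (N * R * lf)" using N_ge R0 lf by simp
  also have "\<dots> \<le> 2600000 * (N * R * lf * log_factor (\<zeta> / \<xi> / \<epsilon>))"
    using N_ge R0 lf log_factor_ge(1)[of "\<zeta> / \<xi> / \<epsilon>"] mult_left_mono[of 1 "log_factor (\<zeta> / \<xi> / \<epsilon>)" "N * R * lf"]
    by simp
  also have "N * R * lf * log_factor (\<zeta> / \<xi> / \<epsilon>) = main_time n (length L0 + length L1) \<zeta> (\<zeta> / \<xi>) \<epsilon> p"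
    by (simp add: main_time_def R_def lf_def N_def \<kappa>_def)
  finally show ?thesis .
qed

theorem theorem6:
  shows "\<exists>(ApproxConvex :: com) (C :: real) (k :: nat).
    \<forall>(n :: nat) A0 A1 b0 b1 c0 c1 \<xi> \<zeta> \<gamma>hat \<epsilon> p L0 L1.
      quadratic_data n A0 A1 b0 b1 \<longrightarrow>
      assumption_A A0 A1 b0 b1 c1 \<longrightarrow>
      regular_pair A0 A1 \<xi> \<zeta> \<longrightarrow>
      0 \<le> \<gamma>hat \<longrightarrow> \<xi> \<le> lambda_min (pencil A0 A1 \<gamma>hat) \<longrightarrow>
      0 < \<epsilon> \<longrightarrow> \<epsilon> \<le> (\<zeta> / \<xi>)\<^sup>2 * \<xi> \<longrightarrow>
      0 < p \<longrightarrow>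
      lists_nonzeros L0 A0 \<longrightarrow> lists_nonzeros L1 A1 \<longrightarrow>
      (let \<kappa> = \<zeta> / \<xi>;
           q0 = quad A0 b0 c0;
           q1 = quad A1 b1 c1;
           q = (\<lambda>\<gamma> x. q0 x + \<gamma> * q1 x);
           feasible = {x \<in> carrier_vec n. q1 x \<le> 0};
           Opt = minimum_on q0 feasible;
           N = nnz A0 + nnz A1;
           start = input_state n A0 A1 L0 L1 b0 b1 c0 c1 \<xi> \<zeta> \<gamma>hat \<epsilon> p;
           success = (\<lambda>s.
             let f = (\<lambda>x. max (q (out_gamma_minus s) x) (q (out_gamma_plus s) x));
                 Opt' = minimum_on f (carrier_vec n)
             in attains_minimum_on q0 feasible \<and> attains_minimum_on f (carrier_vec n) \<and>
                Opt \<le> f (out_x n s) \<and> f (out_x n s) \<le> Opt' + \<epsilon> / 2 \<and>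
                Opt' + \<epsilon> / 2 \<le> Opt + \<epsilon>)
       in (\<forall>\<omega>. \<exists>t s. exec ApproxConvex (start \<omega>) t s \<and>
             real t \<le> C * main_time n N \<zeta> \<kappa> \<epsilon> p * loglog_factor n \<kappa> \<epsilon> p ^ k) \<and>
          (\<exists>E \<in> sets tape_measure. 1 - p \<le> measure tape_measure E \<and>
             (\<forall>\<omega>\<in>E. \<exists>t s. exec ApproxConvex (start \<omega>) t s \<and> success s)))"
proof (rule exI[of _ approx_convex], rule exI[of _ 2600000], rule exI[of _ 0], intro allI impI)
  fix n :: nat and A0 A1 b0 b1 and c0 c1 \<xi> \<zeta> \<gamma>hat \<epsilon> p :: real and L0 L1
  assume data: "quadratic_data n A0 A1 b0 b1" and asmA: "assumption_A A0 A1 b0 b1 c1"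
    and reg: "regular_pair A0 A1 \<xi> \<zeta>" and \<gamma>hat: "0 \<le> \<gamma>hat" "\<xi> \<le> lambda_min (pencil A0 A1 \<gamma>hat)"
    and \<epsilon>: "0 < \<epsilon>" "\<epsilon> \<le> (\<zeta> / \<xi>)\<^sup>2 * \<xi>" and p: "0 < p"
    and L: "lists_nonzeros L0 A0" "lists_nonzeros L1 A1"
  from data have A: "A0 \<in> carrier_mat n n" "A1 \<in> carrier_mat n n"
    and sym: "transpose_mat A0 = A0" "transpose_mat A1 = A1"
    and b: "b0 \<in> carrier_vec n" "b1 \<in> carrier_vec n" by (auto simp: quadratic_data_def)
  from asmA obtain k0 k1 where k: "k0 < 0" "eigenvalue A0 k0" "k1 < 0" "eigenvalue A1 k1"
    by (auto simp: assumption_A_def)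
  obtain w0 where w0: "ip n w0 (op n A0 w0) < 0" "0 < ip n w0 w0"
    using neg_eigenvalue_form[OF A(1) k(2,1)] by blast
  obtain w1 where w1: "ip n w1 (op n A1 w1) < 0"
    using neg_eigenvalue_form[OF A(2) k(4,3)] by blast
  have n: "0 < n" using w0(2) by (cases n) (auto simp: ip_def)
  have \<xi>: "0 < \<xi>" "\<xi> \<le> 1" and \<zeta>: "max 1 (gamma_plus A0 A1) \<le> \<zeta>"
    using reg by (auto simp: regular_pair_def xi_star_def zeta_star_def)
  note P = pencil_carrier[OF A] pencil_symmetric[OF A sym]
  have hat: "\<xi> * ip n w w \<le> ip n w (op n A0 w + \<gamma>hat *\<^sub>R op n A1 w)" for w
    using lambda_min_le_form[OF P n \<gamma>hat(2), of w] by (simp only: op_pencil[OF A])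
  obtain x0 where x0: "qf n (op n A1) (vec_index b1) c1 x0 \<le> 0"
    "\<And>y. qf n (op n A1) (vec_index b1) c1 y \<le> 0 \<Longrightarrow>
      qf n (op n A0) (vec_index b0) c0 x0 \<le> qf n (op n A0) (vec_index b0) c0 y"
    using optimum_exists[OF A sym \<gamma>hat(1) \<xi>(1) hat w1] by blast
  have len: "length L0 = nnz A0" "length L1 = nnz A1" using L by (auto intro: length_nonzeros)
  interpret gtrs n "op n A0" "op n A1" "vec_index b0" "vec_index b1" c0 c1 \<xi> \<zeta> \<gamma>hat x0
  proof (unfold_locales)
    show "\<exists>u l. ip n u u = 1 \<and> l \<le> 0 \<and> (\<forall>y. ip n y (op n A0 u + \<gamma> *\<^sub>R op n A1 u) = l * ip n y u)"
      if "ip n w (op n A0 w + \<gamma> *\<^sub>R op n A1 w) < 0" for w \<gamma>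
    proof -
      obtain u l where u: "ip n u u = 1" "op n (pencil A0 A1 \<gamma>) u = l *\<^sub>R u"
        "\<And>w. l * ip n w w \<le> ip n w (op n (pencil A0 A1 \<gamma>) w)"
        by (rule smallest_eigenvector[OF P n]) blast
      have "l * ip n w w < 0" using u(3)[of w] that unfolding op_pencil[OF A] by linarith
      then have "l \<le> 0" by (smt (verit) ip_nonneg mult_nonneg_nonneg)
      moreover have "ip n y (op n A0 u + \<gamma> *\<^sub>R op n A1 u) = l * ip n y u" for y
        using u(2) unfolding op_pencil[OF A] by (simp only: ip_scale_right)
      ultimately show ?thesis using u(1) by blast
    qed
    show "\<gamma> \<le> \<zeta>" if "0 \<le> \<gamma>" "\<And>w. 0 \<le> ip n w (op n A0 w + \<gamma> *\<^sub>R op n A1 w)" for \<gamma>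
      using le_gamma_plus[OF A w1 that] \<zeta> by simp
  qed (use A sym b asmA \<xi> \<zeta> \<gamma>hat hat x0 w0 in
      \<open>auto simp: assumption_A_def intro!: op_self_adjoint spectral_norm_form vec_norm_form\<close>)
  interpret gtrs_machine n A0 A1 "vec_index b0" "vec_index b1" c0 c1 \<xi> \<zeta> \<gamma>hat x0 L0 L1 \<epsilon> p
  proof (unfold_locales)
    show "n \<le> length L0 + length L1" unfolding len by (rule dim_le_nnz[OF A \<xi>(1) hat])
    show "\<epsilon> \<le> \<kappa> * \<zeta>" using \<epsilon>(2) \<xi>(1) by (simp add: \<kappa>_def power2_eq_square)
  qed (use A n \<epsilon> p L in auto)
  let ?start = "input_state n A0 A1 L0 L1 b0 b1 c0 c1 \<xi> \<zeta> \<gamma>hat \<epsilon> p"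
  have start: "static (?start \<omega>)" "head (?start \<omega>) = 0" "tape (?start \<omega>) = \<omega>" for \<omega>
    using b by (auto simp: static_def holds_matrices_def input_state_def array_of_def list_of_vec_index)
  define f where "f s x = max (quad A0 b0 c0 x + out_gamma_minus s * quad A1 b1 c1 x)
    (quad A0 b0 c0 x + out_gamma_plus s * quad A1 b1 c1 x)" for s x
  have run: "\<exists>t s. exec approx_convex (?start \<omega>) t s \<and>
      real t \<le> 2600000 * main_time n (nnz A0 + nnz A1) \<zeta> (\<zeta> / \<xi>) \<epsilon> p \<and>
      (good \<omega> \<longrightarrow> 0 \<le> out_gamma_minus s \<and> 0 \<le> out_gamma_plus s \<and>
        (\<forall>z. q0 x0 \<le> f s (Matrix.vec n z)) \<and> f s (out_x n s) \<le> q0 x0 + \<epsilon> / 2)" for \<omega>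
    using runs_approx_convex[OF start] total_time unfolding runs_def len f_def out_x_def
    unfolding quad_vec[OF A(1)] quad_vec[OF A(2)] q_eq by (meson order_trans)
  let ?feasible = "{x \<in> carrier_vec n. quad A1 b1 c1 x \<le> 0}"
  have x0v: "Matrix.vec n x0 \<in> ?feasible" using x0(1) by (simp add: quad_vec[OF A(2)])
  have x0q: "quad A0 b0 c0 (Matrix.vec n x0) = q0 x0" by (simp add: quad_vec[OF A(1)])
  have opt: "quad A0 b0 c0 (Matrix.vec n x0) \<le> quad A0 b0 c0 y" if "y \<in> ?feasible" for y
  proof -
    have y: "y = Matrix.vec n (vec_index y)" using that by (intro vec_of_carrier) simp
    have "q1 (vec_index y) \<le> 0" using that quad_vec[OF A(2), of b1 c1 "vec_index y"] y by simp
    from x0(2)[OF this] show ?thesis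
      using quad_vec[OF A(1), of b0 c0 "vec_index y"] y x0q by simp
  qed
  have Opt: "minimum_on (quad A0 b0 c0) ?feasible = q0 x0"
    using minimum_on_eq[OF x0v, of "quad A0 b0 c0", OF opt] x0q by simp
  have att: "attains_minimum_on (quad A0 b0 c0) ?feasible"
    unfolding attains_minimum_on_def using x0v opt by blast
  have success: "attains_minimum_on (f s) (carrier_vec n) \<and> q0 x0 \<le> f s (out_x n s) \<and>
      f s (out_x n s) \<le> minimum_on (f s) (carrier_vec n) + \<epsilon> / 2 \<and>
      minimum_on (f s) (carrier_vec n) + \<epsilon> / 2 \<le> q0 x0 + \<epsilon>"
    if s: "0 \<le> out_gamma_minus s" "0 \<le> out_gamma_plus s" "\<forall>z. q0 x0 \<le> f s (Matrix.vec n z)"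
      "f s (out_x n s) \<le> q0 x0 + \<epsilon> / 2" for s
  proof -
    have "quad A1 b1 c1 (Matrix.vec n x0) \<le> 0" using x0v by simp
    then have le: "f s (Matrix.vec n x0) \<le> q0 x0"
      unfolding f_def x0q using s(1,2) by (simp add: mult_nonneg_nonpos)
    have ge: "q0 x0 \<le> f s y" if "y \<in> carrier_vec n" for y
      using s(3) vec_of_carrier[OF that] by metis
    \<comment> \<open>Nonnegative parameters give \<le> at the feasible optimum, and the outer
      inequality gives \<ge> everywhere: the outer minimum is Opt and is attained at the constrained
      solution.\<close>
    have fx0: "f s (Matrix.vec n x0) = q0 x0" using le ge by (simp add: order_antisym)
    have min: "minimum_on (f s) (carrier_vec n) = q0 x0"
      using minimum_on_eq[of "Matrix.vec n x0" "carrier_vec n" "f s"] ge fx0 by simp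
    have "attains_minimum_on (f s) (carrier_vec n)"
      unfolding attains_minimum_on_def using ge fx0 by (intro bexI[of _ "Matrix.vec n x0"]) auto
    moreover have "q0 x0 \<le> f s (out_x n s)" using s(3) by (simp add: out_x_def)
    ultimately show ?thesis using s(4) \<epsilon>(1) unfolding min by simp
  qed
  have event: "\<exists>E\<in>sets tape_measure. 1 - p \<le> measure tape_measure E \<and> (\<forall>\<omega>\<in>E. good \<omega>)"
  proof (cases "p < 1")
    \<comment> \<open>For p \<ge> 1 the required probability is nonpositive, so the empty event
      suffices.\<close>
    case False
    then show ?thesis by (intro bexI[of _ "{}"]) auto
  qed (rule good_event)
  show "let \<kappa> = \<zeta> / \<xi>;
           q0 = quad A0 b0 c0;
           q1 = quad A1 b1 c1;
           q = (\<lambda>\<gamma> x. q0 x + \<gamma> * q1 x);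
           feasible = {x \<in> carrier_vec n. q1 x \<le> 0};
           Opt = minimum_on q0 feasible;
           N = nnz A0 + nnz A1;
           start = ?start;
           success = (\<lambda>s.
             let f = (\<lambda>x. max (q (out_gamma_minus s) x) (q (out_gamma_plus s) x));
                 Opt' = minimum_on f (carrier_vec n)
             in attains_minimum_on q0 feasible \<and> attains_minimum_on f (carrier_vec n) \<and>
                Opt \<le> f (out_x n s) \<and> f (out_x n s) \<le> Opt' + \<epsilon> / 2 \<and>
                Opt' + \<epsilon> / 2 \<le> Opt + \<epsilon>)
       in (\<forall>\<omega>. \<exists>t s. exec approx_convex (start \<omega>) t s \<and>
             real t \<le> 2600000 * main_time n N \<zeta> \<kappa> \<epsilon> p * loglog_factor n \<kappa> \<epsilon> p ^ 0) \<and>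
          (\<exists>E \<in> sets tape_measure. 1 - p \<le> measure tape_measure E \<and>
             (\<forall>\<omega>\<in>E. \<exists>t s. exec approx_convex (start \<omega>) t s \<and> success s))"
    unfolding Let_def Opt f_def[symmetric] power_0 mult_1_right
  proof (intro conjI allI)
    show "\<exists>t s. exec approx_convex (?start \<omega>) t s \<and>
      real t \<le> 2600000 * main_time n (nnz A0 + nnz A1) \<zeta> (\<zeta> / \<xi>) \<epsilon> p" for \<omega>
      using run[of \<omega>] by blast
    from event obtain E where E: "E \<in> sets tape_measure" "1 - p \<le> measure tape_measure E" "\<And>\<omega>. \<omega> \<in> E \<Longrightarrow> good \<omega>"
      by blast
    have "\<exists>t s. exec approx_convex (?start \<omega>) t s \<and>
       attains_minimum_on (quad A0 b0 c0) ?feasible \<and> attains_minimum_on (f s) (carrier_vec n) \<and>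
       q0 x0 \<le> f s (out_x n s) \<and> f s (out_x n s) \<le> minimum_on (f s) (carrier_vec n) + \<epsilon> / 2 \<and>
       minimum_on (f s) (carrier_vec n) + \<epsilon> / 2 \<le> q0 x0 + \<epsilon>" if "\<omega> \<in> E" for \<omega>
      using run[of \<omega>] E(3)[OF that] success att by blast
    then show "\<exists>E\<in>sets tape_measure. 1 - p \<le> measure tape_measure E \<and>
      (\<forall>\<omega>\<in>E. \<exists>t s. exec approx_convex (?start \<omega>) t s \<and>
       attains_minimum_on (quad A0 b0 c0) ?feasible \<and> attains_minimum_on (f s) (carrier_vec n) \<and>
       q0 x0 \<le> f s (out_x n s) \<and> f s (out_x n s) \<le> minimum_on (f s) (carrier_vec n) + \<epsilon> / 2 \<and>
       minimum_on (f s) (carrier_vec n) + \<epsilon> / 2 \<le> q0 x0 + \<epsilon>)"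
      using E(1,2) by blast
  qed
qed

end
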